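(* Consider $H=H(G,\chi,\eta,b,c,0)$ with $G$ finitely generated abelian. Suppose $q=\chi(c)=\eta(b)^{-1}$ is a primitive $n$th root of unity and $\mathrm{Im}(\chi)=\langle q\rangle$. Let $V$ be an $x$-torsion-free, $y$-torsion simple $H$-module. Then there exist $(\alpha,\lambda)\in\mathbb{K}^\times\times\widehat{N}$ with $N=\ker(\chi)$ such that $V$ has a $\mathbb{K}$-basis $\{v_0,\ldots,v_{n-1}\}$ with $$y\cdot v_i=0,\qquad x\cdot v_i=q^i\alpha v_i,\qquad h\cdot v_i=\lambda(h)v_i,$$ and $$c\cdot v_i=\begin{cases}\lambda(c^n)v_0&\text{if }i=n-1,\\ v_{i+1}&\text{otherwise,}\end{cases}$$ for all $0\le i\le n-1$ and $h\in N$. Denote this module by $V_x(\alpha,\lambda)$. Moreover, $V_x(\alpha,\lambda)\simeq V_x(\alpha',\lambda')$ as $H$-modules if and only if $\lambda=\lambda'$ and $\alpha=q^i\alpha'$ for some $i$.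
   Context: $\mathbb{K}$ is an algebraically closed field of characteristic zero; $\widehat{G}$ is the group of homomorphisms $G\to\mathbb{K}^\times$. $G$ is a finitely generated abelian group, $b,c\in G$, and $\chi,\eta\in\widehat{G}$ have finite order and satisfy $\eta(b)=\chi(c)^{-1}$. The Hopf algebra $H(G,\chi,\eta,b,c,0)$ is written, after replacing its second Ore variable $y$ by $c^{-1}y$, as the skew group ring $\mathbb{K}[x,y]\#G$: it is generated by $G,x,y$ with $xy=yx$, $xg=\chi(g)gx$, $yg=\eta(g)gy$ for $g\in G$, and has $\mathbb{K}$-basis $\{x^iy^jg\mid i,j\ge 0,\ g\in G\}$ (elements of $G$ group-like, $\Delta(x)=x\otimes1+b\otimes x$, $\Delta(y)=y\otimes c^{-1}+1\otimes y$). A module $M$ is $x$-torsion if each $m\in M$ is killed by some $x^k$, $k\ge1$, and $x$-torsion-free if no nonzero $m\in M$ is killed by a power of $x$; similarly for $y$. *)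

theory Defs
  imports "HOL-Algebra.Module" "HOL-Algebra.Generated_Groups"
    "HOL-Computational_Algebra.Polynomial" "HOL-Library.Poly_Mapping"
begin

definition Kunits :: "'k::field monoid" where
  "Kunits = \<lparr>carrier = UNIV - {0}, monoid.mult = (*), monoid.one = 1\<rparr>"

text \<open>The group of characters of \<open>G\<close>. Characters are normalised to be \<open>undefined\<close> outside
  the carrier, so that equality of characters is equality of functions.\<close>
definition char_group :: "('g, 'm) monoid_scheme \<Rightarrow> ('g \<Rightarrow> 'k::field) monoid" where
  "char_group G = \<lparr>carrier = hom G Kunits \<inter> extensional (carrier G),
     monoid.mult = (\<lambda>\<phi> \<psi>. \<lambda>g\<in>carrier G. \<phi> g * \<psi> g),
     monoid.one = (\<lambda>g\<in>carrier G. 1)\<rparr>"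

definition finite_order :: "('g, 'm) monoid_scheme \<Rightarrow> 'g \<Rightarrow> bool" where
  "finite_order G g \<longleftrightarrow> (\<exists>k::nat. k > 0 \<and> g [^]\<^bsub>G\<^esub> k = \<one>\<^bsub>G\<^esub>)"

definition finitely_generated :: "('g, 'm) monoid_scheme \<Rightarrow> bool" where
  "finitely_generated G \<longleftrightarrow> (\<exists>S. finite S \<and> S \<subseteq> carrier G \<and> generate G S = carrier G)"

definition primitive_root_of_unity :: "nat \<Rightarrow> 'k::field \<Rightarrow> bool" where
  "primitive_root_of_unity n q \<longleftrightarrow> n > 0 \<and> q ^ n = 1 \<and> (\<forall>k. 0 < k \<and> k < n \<longrightarrow> q ^ k \<noteq> 1)"

text \<open>The algebra underlying \<open>H(G,\<chi>,\<eta>,b,c,0)\<close>, that is, the skew group ring of \<open>G\<close> over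
  \<open>K[x,y]\<close>. The index \<open>(i,j,g)\<close> stands for the basis element \<open>x^i y^j g\<close>; the relations
  \<open>x g = \<chi>(g) g x\<close> and \<open>y g = \<eta>(g) g y\<close> give
  \<open>(x^i y^j g) (x^k y^l h) = \<chi>(g)^(-k) \<eta>(g)^(-l) x^(i+k) y^(j+l) g h\<close>.
  Here \<open>y\<close> is \<open>c\<inverse>\<close> times the second Ore variable, so that \<open>xy = yx\<close>.
  The elements \<open>b\<close> and \<open>c\<close> enter only the coalgebra structure, which does not affect the notion
  of a module.\<close>

definition skew_mult :: "('g, 'm) monoid_scheme \<Rightarrow> ('g \<Rightarrow> 'k::field) \<Rightarrow> ('g \<Rightarrow> 'k) \<Rightarrow>
    (nat \<times> nat \<times> 'g \<Rightarrow>\<^sub>0 'k) \<Rightarrow> (nat \<times> nat \<times> 'g \<Rightarrow>\<^sub>0 'k) \<Rightarrow> (nat \<times> nat \<times> 'g \<Rightarrow>\<^sub>0 'k)" where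
  "skew_mult G \<chi> \<eta> p r =
     (\<Sum>(i, j, g)\<in>Poly_Mapping.keys p. \<Sum>(k, l, h)\<in>Poly_Mapping.keys r.
        Poly_Mapping.single (i + k, j + l, g \<otimes>\<^bsub>G\<^esub> h)
          (Poly_Mapping.lookup p (i, j, g) * Poly_Mapping.lookup r (k, l, h)
             * inverse (\<chi> g) ^ k * inverse (\<eta> g) ^ l))"

definition skew_group_ring :: "('g, 'm) monoid_scheme \<Rightarrow> ('g \<Rightarrow> 'k::field) \<Rightarrow> ('g \<Rightarrow> 'k) \<Rightarrow>
    (nat \<times> nat \<times> 'g \<Rightarrow>\<^sub>0 'k) ring" where
  "skew_group_ring G \<chi> \<eta> =
     \<lparr>carrier = {p. Poly_Mapping.keys p \<subseteq> UNIV \<times> UNIV \<times> carrier G},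
      monoid.mult = skew_mult G \<chi> \<eta>,
      monoid.one = Poly_Mapping.single (0, 0, \<one>\<^bsub>G\<^esub>) 1,
      ring.zero = 0,
      ring.add = (+)\<rparr>"

definition gen_x :: "('g, 'm) monoid_scheme \<Rightarrow> (nat \<times> nat \<times> 'g \<Rightarrow>\<^sub>0 'k::field)" where
  "gen_x G = Poly_Mapping.single (1, 0, \<one>\<^bsub>G\<^esub>) 1"

definition gen_y :: "('g, 'm) monoid_scheme \<Rightarrow> (nat \<times> nat \<times> 'g \<Rightarrow>\<^sub>0 'k::field)" where
  "gen_y G = Poly_Mapping.single (0, 1, \<one>\<^bsub>G\<^esub>) 1"

definition gen_grp :: "'g \<Rightarrow> (nat \<times> nat \<times> 'g \<Rightarrow>\<^sub>0 'k::field)" where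
  "gen_grp g = Poly_Mapping.single (0, 0, g) 1"

definition scalar :: "('g, 'm) monoid_scheme \<Rightarrow> 'k::field \<Rightarrow> (nat \<times> nat \<times> 'g \<Rightarrow>\<^sub>0 'k)" where
  "scalar G a = Poly_Mapping.single (0, 0, \<one>\<^bsub>G\<^esub>) a"

text \<open>The library locale \<open>module\<close> requires a commutative ring; the axioms are the same here.\<close>
locale left_module = R?: ring R + M?: abelian_group M
  for R :: "('r, 's) ring_scheme" (structure) and M :: "('r, 'a, 'b) module_scheme" (structure) +
  assumes smult_closed [simp, intro]:
      "\<lbrakk>a \<in> carrier R; m \<in> carrier M\<rbrakk> \<Longrightarrow> a \<odot>\<^bsub>M\<^esub> m \<in> carrier M"
    and smult_l_distr:
      "\<lbrakk>a \<in> carrier R; b \<in> carrier R; m \<in> carrier M\<rbrakk> \<Longrightarrow>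
       (a \<oplus>\<^bsub>R\<^esub> b) \<odot>\<^bsub>M\<^esub> m = a \<odot>\<^bsub>M\<^esub> m \<oplus>\<^bsub>M\<^esub> b \<odot>\<^bsub>M\<^esub> m"
    and smult_r_distr:
      "\<lbrakk>a \<in> carrier R; m \<in> carrier M; m' \<in> carrier M\<rbrakk> \<Longrightarrow>
       a \<odot>\<^bsub>M\<^esub> (m \<oplus>\<^bsub>M\<^esub> m') = a \<odot>\<^bsub>M\<^esub> m \<oplus>\<^bsub>M\<^esub> a \<odot>\<^bsub>M\<^esub> m'"
    and smult_assoc1:
      "\<lbrakk>a \<in> carrier R; b \<in> carrier R; m \<in> carrier M\<rbrakk> \<Longrightarrow>
       (a \<otimes>\<^bsub>R\<^esub> b) \<odot>\<^bsub>M\<^esub> m = a \<odot>\<^bsub>M\<^esub> (b \<odot>\<^bsub>M\<^esub> m)"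
    and smult_one [simp]: "m \<in> carrier M \<Longrightarrow> \<one>\<^bsub>R\<^esub> \<odot>\<^bsub>M\<^esub> m = m"

definition simple_module :: "('r, 's) ring_scheme \<Rightarrow> ('r, 'a, 'b) module_scheme \<Rightarrow> bool" where
  "simple_module R M \<longleftrightarrow> left_module R M \<and> carrier M \<noteq> {\<zero>\<^bsub>M\<^esub>} \<and>
     (\<forall>W. submodule W R M \<longrightarrow> W = {\<zero>\<^bsub>M\<^esub>} \<or> W = carrier M)"

definition module_isomorphic ::
    "('r, 's) ring_scheme \<Rightarrow> ('r, 'a, 'b) module_scheme \<Rightarrow> ('r, 'c, 'd) module_scheme \<Rightarrow> bool" where
  "module_isomorphic R M M' \<longleftrightarrow> (\<exists>f \<in> iso (add_monoid M) (add_monoid M').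
     \<forall>r\<in>carrier R. \<forall>m\<in>carrier M. f (r \<odot>\<^bsub>M\<^esub> m) = r \<odot>\<^bsub>M'\<^esub> f m)"

definition torsion_wrt ::
    "('r, 's) ring_scheme \<Rightarrow> ('r, 'a, 'b) module_scheme \<Rightarrow> 'r \<Rightarrow> bool" where
  "torsion_wrt R M r \<longleftrightarrow>
     (\<forall>m\<in>carrier M. \<exists>k::nat. k \<ge> 1 \<and> (r [^]\<^bsub>R\<^esub> k) \<odot>\<^bsub>M\<^esub> m = \<zero>\<^bsub>M\<^esub>)"

definition torsion_free_wrt ::
    "('r, 's) ring_scheme \<Rightarrow> ('r, 'a, 'b) module_scheme \<Rightarrow> 'r \<Rightarrow> bool" where
  "torsion_free_wrt R M r \<longleftrightarrow>
     (\<forall>m\<in>carrier M. \<forall>k::nat. k \<ge> 1 \<and> (r [^]\<^bsub>R\<^esub> k) \<odot>\<^bsub>M\<^esub> m = \<zero>\<^bsub>M\<^esub> \<longrightarrow> m = \<zero>\<^bsub>M\<^esub>)"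

text \<open>\<open>v\<^sub>0, \<dots>, v\<^sub>n\<^sub>-\<^sub>1\<close> is a basis of \<open>M\<close> as a vector space over the field of scalars of the
  skew group ring.\<close>
definition scalar_basis :: "('g, 'm) monoid_scheme \<Rightarrow>
    (nat \<times> nat \<times> 'g \<Rightarrow>\<^sub>0 'k::field, 'a, 'b) module_scheme \<Rightarrow> nat \<Rightarrow> (nat \<Rightarrow> 'a) \<Rightarrow> bool" where
  "scalar_basis G M n v \<longleftrightarrow>
     (\<forall>i<n. v i \<in> carrier M) \<and>
     (\<forall>m\<in>carrier M. \<exists>a. m = (\<Oplus>\<^bsub>M\<^esub>i\<in>{..<n}. scalar G (a i) \<odot>\<^bsub>M\<^esub> v i)) \<and>
     (\<forall>a. (\<Oplus>\<^bsub>M\<^esub>i\<in>{..<n}. scalar G (a i) \<odot>\<^bsub>M\<^esub> v i) = \<zero>\<^bsub>M\<^esub> \<longrightarrow> (\<forall>i<n. a i = 0))"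

abbreviation char_kernel :: "('g, 'm) monoid_scheme \<Rightarrow> ('g \<Rightarrow> 'k::field) \<Rightarrow> 'g set" where
  "char_kernel G \<chi> \<equiv> kernel G Kunits \<chi>"

text \<open>\<open>M\<close> is a (necessarily unique up to isomorphism) module \<open>V\<^sub>x(\<alpha>,\<mu>)\<close>, where
  \<open>(\<alpha>,\<mu>)\<close> is a nonzero scalar together with a character of \<open>N = ker \<chi>\<close>.
  Existence of such a module for every \<open>(\<alpha>,\<mu>)\<close> is lemma \<open>Vx_exists\<close>.\<close>
definition is_Vx :: "('g, 'm) monoid_scheme \<Rightarrow> ('g \<Rightarrow> 'k::field) \<Rightarrow> ('g \<Rightarrow> 'k) \<Rightarrow> 'g \<Rightarrow> nat \<Rightarrow>
    'k \<Rightarrow> ('g \<Rightarrow> 'k) \<Rightarrow> (nat \<times> nat \<times> 'g \<Rightarrow>\<^sub>0 'k, 'a, 'b) module_scheme \<Rightarrow> bool" where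
  "is_Vx G \<chi> \<eta> c n \<alpha> \<mu> M \<longleftrightarrow>
     left_module (skew_group_ring G \<chi> \<eta>) M \<and>
     (\<exists>v. scalar_basis G M n v \<and>
       (\<forall>i<n. gen_y G \<odot>\<^bsub>M\<^esub> v i = \<zero>\<^bsub>M\<^esub> \<and>
              gen_x G \<odot>\<^bsub>M\<^esub> v i = scalar G (\<chi> c ^ i * \<alpha>) \<odot>\<^bsub>M\<^esub> v i \<and>
              (\<forall>h\<in>char_kernel G \<chi>. gen_grp h \<odot>\<^bsub>M\<^esub> v i = scalar G (\<mu> h) \<odot>\<^bsub>M\<^esub> v i) \<and>
              gen_grp c \<odot>\<^bsub>M\<^esub> v i =
                (if i = n - 1 then scalar G (\<mu> (c [^]\<^bsub>G\<^esub> n)) \<odot>\<^bsub>M\<^esub> v 0 else v (i + 1))))"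

lemma skew_mult_superset:
  assumes "finite A" "finite B" "Poly_Mapping.keys p \<subseteq> A" "Poly_Mapping.keys r \<subseteq> B"
  shows "skew_mult G \<chi> \<eta> p r =
     (\<Sum>(i, j, g)\<in>A. \<Sum>(k, l, h)\<in>B.
        Poly_Mapping.single (i + k, j + l, g \<otimes>\<^bsub>G\<^esub> h)
          (Poly_Mapping.lookup p (i, j, g) * Poly_Mapping.lookup r (k, l, h)
             * inverse (\<chi> g) ^ k * inverse (\<eta> g) ^ l))"
proof -
  have "skew_mult G \<chi> \<eta> p r =
     (\<Sum>(i, j, g)\<in>Poly_Mapping.keys p. \<Sum>(k, l, h)\<in>B.
        Poly_Mapping.single (i + k, j + l, g \<otimes>\<^bsub>G\<^esub> h)
          (Poly_Mapping.lookup p (i, j, g) * Poly_Mapping.lookup r (k, l, h)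
             * inverse (\<chi> g) ^ k * inverse (\<eta> g) ^ l))"
    unfolding skew_mult_def
    by (intro sum.cong refl) (auto intro!: sum.mono_neutral_left assms simp: in_keys_iff)
  also have "\<dots> = (\<Sum>(i, j, g)\<in>A. \<Sum>(k, l, h)\<in>B.
        Poly_Mapping.single (i + k, j + l, g \<otimes>\<^bsub>G\<^esub> h)
          (Poly_Mapping.lookup p (i, j, g) * Poly_Mapping.lookup r (k, l, h)
             * inverse (\<chi> g) ^ k * inverse (\<eta> g) ^ l))"
    by (intro sum.mono_neutral_left assms) (auto simp: in_keys_iff intro!: sum.neutral)
  finally show ?thesis .
qed

lemma skew_mult_add_left:
  "skew_mult G \<chi> \<eta> (p + p') r = skew_mult G \<chi> \<eta> p r + skew_mult G \<chi> \<eta> p' r"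
proof -
  let ?A = "Poly_Mapping.keys p \<union> Poly_Mapping.keys p'"
  have "Poly_Mapping.keys (p + p') \<subseteq> ?A" by (rule Poly_Mapping.keys_add)
  then show ?thesis
    by (simp add: skew_mult_superset[of ?A "Poly_Mapping.keys r"] case_prod_unfold lookup_add
        distrib_right single_add sum.distrib)
qed

lemma skew_mult_add_right:
  "skew_mult G \<chi> \<eta> p (r + r') = skew_mult G \<chi> \<eta> p r + skew_mult G \<chi> \<eta> p r'"
proof -
  let ?B = "Poly_Mapping.keys r \<union> Poly_Mapping.keys r'"
  have "Poly_Mapping.keys (r + r') \<subseteq> ?B" by (rule Poly_Mapping.keys_add)
  then show ?thesis
    by (simp add: skew_mult_superset[of "Poly_Mapping.keys p" ?B] case_prod_unfold lookup_add
        distrib_right distrib_left single_add sum.distrib)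
qed

lemma skew_mult_zero [simp]: "skew_mult G \<chi> \<eta> 0 r = 0" "skew_mult G \<chi> \<eta> p 0 = 0"
  by (simp_all add: skew_mult_def case_prod_unfold)

lemma skew_mult_single:
  "skew_mult G \<chi> \<eta> (Poly_Mapping.single (i, j, g) a) (Poly_Mapping.single (k, l, h) d) =
     Poly_Mapping.single (i + k, j + l, g \<otimes>\<^bsub>G\<^esub> h) (a * d * inverse (\<chi> g) ^ k * inverse (\<eta> g) ^ l)"
  by (subst skew_mult_superset[of "{(i, j, g)}" "{(k, l, h)}"]) auto

lemma carrier_skew_group_ring_induct [consumes 1, case_names zero single add]:
  assumes p: "p \<in> carrier (skew_group_ring G \<chi> \<eta>)"
    and zero: "P 0"
    and single: "\<And>i j g a. g \<in> carrier G \<Longrightarrow> P (Poly_Mapping.single (i, j, g) a)"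
    and add: "\<And>p r. P p \<Longrightarrow> P r \<Longrightarrow> P (p + r)"
  shows "P p"
proof -
  have "P (\<Sum>t\<in>T. Poly_Mapping.single t (Poly_Mapping.lookup p t))"
    if "finite T" "T \<subseteq> Poly_Mapping.keys p" for T
    using that
  proof (induction T)
    case empty
    then show ?case by (simp add: zero)
  next
    case (insert t T)
    obtain i j g where t: "t = (i, j, g)" by (cases t) auto
    have "g \<in> carrier G" using insert.prems p t by (auto simp: skew_group_ring_def)
    then show ?case using insert by (auto simp: t intro!: add single)
  qed
  from this[of "Poly_Mapping.keys p"]
  have "P (\<Sum>t\<in>Poly_Mapping.keys p. Poly_Mapping.single t (Poly_Mapping.lookup p t))" by simp
  also have "(\<Sum>t\<in>Poly_Mapping.keys p. Poly_Mapping.single t (Poly_Mapping.lookup p t)) = p"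
    by (rule poly_mapping_eqI)
       (simp add: lookup_sum lookup_single when_def in_keys_iff sum.delta)
  finally show ?thesis .
qed

lemma char_groupD:
  assumes "\<phi> \<in> carrier (char_group G)"
  shows "\<And>g. g \<in> carrier G \<Longrightarrow> \<phi> g \<noteq> 0"
    and "\<And>g h. g \<in> carrier G \<Longrightarrow> h \<in> carrier G \<Longrightarrow> \<phi> (g \<otimes>\<^bsub>G\<^esub> h) = \<phi> g * \<phi> h"
  using assms by (auto simp: char_group_def hom_def Kunits_def)

lemma char_group_one:
  assumes "\<phi> \<in> carrier (char_group G)" "group G"
  shows "\<phi> \<one>\<^bsub>G\<^esub> = 1"
proof -
  interpret group G by fact
  have "\<phi> \<one>\<^bsub>G\<^esub> * \<phi> \<one>\<^bsub>G\<^esub> = \<phi> \<one>\<^bsub>G\<^esub>"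
    using char_groupD(2)[OF assms(1), of "\<one>\<^bsub>G\<^esub>" "\<one>\<^bsub>G\<^esub>"] by simp
  then show ?thesis using char_groupD(1)[OF assms(1), of "\<one>\<^bsub>G\<^esub>"] by simp
qed

lemma single_in_carrier [simp]:
  "g \<in> carrier G \<Longrightarrow> Poly_Mapping.single (i, j, g) a \<in> carrier (skew_group_ring G \<chi> \<eta>)"
  by (simp add: skew_group_ring_def)

lemma add_in_carrier:
  "\<lbrakk>p \<in> carrier (skew_group_ring G \<chi> \<eta>); r \<in> carrier (skew_group_ring G \<chi> \<eta>)\<rbrakk> \<Longrightarrow>
     p + r \<in> carrier (skew_group_ring G \<chi> \<eta>)"
  using Poly_Mapping.keys_add[of p r] by (auto simp: skew_group_ring_def)

lemma skew_mult_closed: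
  assumes "group G" "p \<in> carrier (skew_group_ring G \<chi> \<eta>)" "r \<in> carrier (skew_group_ring G \<chi> \<eta>)"
  shows "skew_mult G \<chi> \<eta> p r \<in> carrier (skew_group_ring G \<chi> \<eta>)"
proof -
  interpret group G by fact
  have z: "0 \<in> carrier (skew_group_ring G \<chi> \<eta>)" by (simp add: skew_group_ring_def)
  show ?thesis using assms(2)
  proof (induction rule: carrier_skew_group_ring_induct)
    case (single i j g a)
    show ?case using assms(3)
      by (induction rule: carrier_skew_group_ring_induct)
         (use single in \<open>auto simp: z skew_mult_single skew_mult_add_right intro: add_in_carrier\<close>)
  qed (auto simp: z skew_mult_add_left intro: add_in_carrier)
qed

lemma ring_skew_group_ring:
  assumes "comm_group G" "\<chi> \<in> carrier (char_group G)" "\<eta> \<in> carrier (char_group G)"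
  shows "ring (skew_group_ring G \<chi> \<eta>)"
proof (rule ringI)
  interpret comm_group G by fact
  let ?H = "skew_group_ring G \<chi> \<eta>"
  have z: "0 \<in> carrier ?H" by (simp add: skew_group_ring_def)
  have simps: "monoid.mult ?H = skew_mult G \<chi> \<eta>" "ring.add ?H = (+)" "ring.zero ?H = 0"
    "monoid.one ?H = Poly_Mapping.single (0, 0, \<one>\<^bsub>G\<^esub>) 1"
    by (simp_all add: skew_group_ring_def)
  note ch = char_groupD[OF assms(2)] char_groupD[OF assms(3)]
    char_group_one[OF assms(2)] char_group_one[OF assms(3)]
  have grp: "group G" ..
  show "abelian_group ?H"
  proof (rule abelian_groupI)
    fix p assume "p \<in> carrier ?H"
    then show "\<exists>r\<in>carrier ?H. r \<oplus>\<^bsub>?H\<^esub> p = \<zero>\<^bsub>?H\<^esub>"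
      by (intro bexI[of _ "- p"]) (auto simp: skew_group_ring_def in_keys_iff)
  qed (auto simp: simps z add_in_carrier add_ac)
  show "monoid ?H"
  proof (rule monoidI)
    fix p r s assume prs: "p \<in> carrier ?H" "r \<in> carrier ?H" "s \<in> carrier ?H"
    show "p \<otimes>\<^bsub>?H\<^esub> r \<otimes>\<^bsub>?H\<^esub> s = p \<otimes>\<^bsub>?H\<^esub> (r \<otimes>\<^bsub>?H\<^esub> s)"
      unfolding simps using prs(1)
    proof (induction rule: carrier_skew_group_ring_induct)
      case (single i j g a)
      note g = single
      show ?case using prs(2)
      proof (induction rule: carrier_skew_group_ring_induct)
        case (single i' j' g' a')
        note g' = single
        show ?case using prs(3)
          by (induction rule: carrier_skew_group_ring_induct)
             (use g g' in \<open>auto simp: skew_mult_single skew_mult_add_right m_assoc ch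
                power_add power_mult_distrib mult_ac add_ac\<close>)
      qed (auto simp: skew_mult_add_right skew_mult_add_left)
    qed (auto simp: skew_mult_add_left)
  next
    fix p assume p: "p \<in> carrier ?H"
    show "\<one>\<^bsub>?H\<^esub> \<otimes>\<^bsub>?H\<^esub> p = p" unfolding simps using p
      by (induction rule: carrier_skew_group_ring_induct)
         (auto simp: skew_mult_single skew_mult_add_right ch grp)
    show "p \<otimes>\<^bsub>?H\<^esub> \<one>\<^bsub>?H\<^esub> = p" unfolding simps using p
      by (induction rule: carrier_skew_group_ring_induct)
         (auto simp: skew_mult_single skew_mult_add_left ch)
  qed (auto simp: simps skew_mult_closed grp)
qed (auto simp: skew_group_ring_def skew_mult_add_left skew_mult_add_right)

lemma skew_group_ring_relations:
  assumes "comm_group G" "\<chi> \<in> carrier (char_group G)" "\<eta> \<in> carrier (char_group G)" "g \<in> carrier G"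
  shows "gen_x G \<otimes>\<^bsub>skew_group_ring G \<chi> \<eta>\<^esub> gen_y G = gen_y G \<otimes>\<^bsub>skew_group_ring G \<chi> \<eta>\<^esub> gen_x G"
    and "gen_x G \<otimes>\<^bsub>skew_group_ring G \<chi> \<eta>\<^esub> gen_grp g =
      scalar G (\<chi> g) \<otimes>\<^bsub>skew_group_ring G \<chi> \<eta>\<^esub> (gen_grp g \<otimes>\<^bsub>skew_group_ring G \<chi> \<eta>\<^esub> gen_x G)"
    and "gen_y G \<otimes>\<^bsub>skew_group_ring G \<chi> \<eta>\<^esub> gen_grp g =
      scalar G (\<eta> g) \<otimes>\<^bsub>skew_group_ring G \<chi> \<eta>\<^esub> (gen_grp g \<otimes>\<^bsub>skew_group_ring G \<chi> \<eta>\<^esub> gen_y G)"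
proof -
  interpret comm_group G by fact
  have grp: "group G" ..
  note ch = char_groupD[OF assms(2)] char_groupD[OF assms(3)]
    char_group_one[OF assms(2) grp] char_group_one[OF assms(3) grp]
  have m: "monoid.mult (skew_group_ring G \<chi> \<eta>) = skew_mult G \<chi> \<eta>" by (simp add: skew_group_ring_def)
  note defs = m gen_x_def gen_y_def gen_grp_def scalar_def skew_mult_single
  show "gen_x G \<otimes>\<^bsub>skew_group_ring G \<chi> \<eta>\<^esub> gen_y G = gen_y G \<otimes>\<^bsub>skew_group_ring G \<chi> \<eta>\<^esub> gen_x G"
    by (simp add: defs ch)
  show "gen_x G \<otimes>\<^bsub>skew_group_ring G \<chi> \<eta>\<^esub> gen_grp g =
      scalar G (\<chi> g) \<otimes>\<^bsub>skew_group_ring G \<chi> \<eta>\<^esub> (gen_grp g \<otimes>\<^bsub>skew_group_ring G \<chi> \<eta>\<^esub> gen_x G)"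
    using assms(4) by (simp add: defs ch)
  show "gen_y G \<otimes>\<^bsub>skew_group_ring G \<chi> \<eta>\<^esub> gen_grp g =
      scalar G (\<eta> g) \<otimes>\<^bsub>skew_group_ring G \<chi> \<eta>\<^esub> (gen_grp g \<otimes>\<^bsub>skew_group_ring G \<chi> \<eta>\<^esub> gen_y G)"
    using assms(4) by (simp add: defs ch)
qed

text \<open>A model of \<open>V\<^sub>x(\<alpha>,\<mu>)\<close>, induced from \<open>\<mu>\<close>: functions \<open>\<phi>\<close> on \<open>G\<close> with
  \<open>\<phi>(hu) = \<mu>(h) \<phi>(u)\<close> for \<open>h \<in> ker \<chi>\<close>, where \<open>(g\<phi>)(u) = \<phi>(ug)\<close>,
  \<open>(x\<phi>)(u) = \<alpha> \<chi>(u)\<inverse> \<phi>(u)\<close> and \<open>y\<phi> = 0\<close>.\<close>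
definition Vx_model :: "('g, 'm) monoid_scheme \<Rightarrow> ('g \<Rightarrow> 'k::field) \<Rightarrow> 'k \<Rightarrow> ('g \<Rightarrow> 'k) \<Rightarrow>
    (nat \<times> nat \<times> 'g \<Rightarrow>\<^sub>0 'k, 'g \<Rightarrow> 'k) module" where
  "Vx_model G \<chi> \<alpha> \<mu> =
     \<lparr>carrier = {\<phi>. (\<forall>u. u \<notin> carrier G \<longrightarrow> \<phi> u = 0) \<and>
        (\<forall>h\<in>char_kernel G \<chi>. \<forall>u\<in>carrier G. \<phi> (h \<otimes>\<^bsub>G\<^esub> u) = \<mu> h * \<phi> u)},
      monoid.mult = undefined, monoid.one = undefined,
      ring.zero = (\<lambda>u. 0), ring.add = (\<lambda>\<phi> \<psi> u. \<phi> u + \<psi> u),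
      module.smult = (\<lambda>r \<phi> u. if u \<in> carrier G then
        (\<Sum>(i, j, g)\<in>Poly_Mapping.keys r. Poly_Mapping.lookup r (i, j, g) *
           (if j = 0 then (\<alpha> / \<chi> u) ^ i * \<phi> (u \<otimes>\<^bsub>G\<^esub> g) else 0)) else 0)\<rparr>"

lemma Vx_model_smult_superset:
  assumes "finite A" "Poly_Mapping.keys r \<subseteq> A"
  shows "(r \<odot>\<^bsub>Vx_model G \<chi> \<alpha> \<mu>\<^esub> \<phi>) u = (if u \<in> carrier G then
        (\<Sum>(i, j, g)\<in>A. Poly_Mapping.lookup r (i, j, g) *
           (if j = 0 then (\<alpha> / \<chi> u) ^ i * \<phi> (u \<otimes>\<^bsub>G\<^esub> g) else 0)) else 0)"
  using assms
  by (auto simp: Vx_model_def in_keys_iff intro!: sum.mono_neutral_left)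

lemma Vx_model_smult_add:
  "(p + r) \<odot>\<^bsub>Vx_model G \<chi> \<alpha> \<mu>\<^esub> \<phi> =
     (\<lambda>u. (p \<odot>\<^bsub>Vx_model G \<chi> \<alpha> \<mu>\<^esub> \<phi>) u + (r \<odot>\<^bsub>Vx_model G \<chi> \<alpha> \<mu>\<^esub> \<phi>) u)"
proof
  fix u
  let ?A = "Poly_Mapping.keys p \<union> Poly_Mapping.keys r"
  have "Poly_Mapping.keys (p + r) \<subseteq> ?A" by (rule Poly_Mapping.keys_add)
  then show "((p + r) \<odot>\<^bsub>Vx_model G \<chi> \<alpha> \<mu>\<^esub> \<phi>) u =
      (p \<odot>\<^bsub>Vx_model G \<chi> \<alpha> \<mu>\<^esub> \<phi>) u + (r \<odot>\<^bsub>Vx_model G \<chi> \<alpha> \<mu>\<^esub> \<phi>) u"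
    by (simp add: Vx_model_smult_superset[of ?A] case_prod_unfold lookup_add
        distrib_right sum.distrib)
qed

lemma Vx_model_smult_single:
  "Poly_Mapping.single (i, j, g) a \<odot>\<^bsub>Vx_model G \<chi> \<alpha> \<mu>\<^esub> \<phi> = (\<lambda>u. if u \<in> carrier G \<and> j = 0
     then a * (\<alpha> / \<chi> u) ^ i * \<phi> (u \<otimes>\<^bsub>G\<^esub> g) else 0)"
  by (rule ext) (auto simp: Vx_model_smult_superset[of "{(i, j, g)}"])

lemma Vx_model_smult_zero: "0 \<odot>\<^bsub>Vx_model G \<chi> \<alpha> \<mu>\<^esub> \<phi> = (\<lambda>u. 0)"
  by (rule ext) (auto simp: Vx_model_def)

lemma Vx_model_smult_fun_add:
  "r \<odot>\<^bsub>Vx_model G \<chi> \<alpha> \<mu>\<^esub> (\<lambda>u. \<phi> u + \<psi> u) =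
     (\<lambda>u. (r \<odot>\<^bsub>Vx_model G \<chi> \<alpha> \<mu>\<^esub> \<phi>) u + (r \<odot>\<^bsub>Vx_model G \<chi> \<alpha> \<mu>\<^esub> \<psi>) u)"
  by (rule ext) (auto simp: Vx_model_def sum.distrib[symmetric] algebra_simps case_prod_unfold
      intro!: sum.cong)

lemma Vx_model_left_module:
  assumes "comm_group G" "\<chi> \<in> carrier (char_group G)" "\<eta> \<in> carrier (char_group G)"
  shows "left_module (skew_group_ring G \<chi> \<eta>) (Vx_model G \<chi> \<alpha> \<mu>)"
proof -
  interpret comm_group G by fact
  let ?H = "skew_group_ring G \<chi> \<eta>"
  let ?M = "Vx_model G \<chi> \<alpha> \<mu>"
  have grp: "group G" ..
  note ch = char_groupD[OF assms(2)] char_groupD[OF assms(3)]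
    char_group_one[OF assms(2) grp] char_group_one[OF assms(3) grp]
  have H: "monoid.mult ?H = skew_mult G \<chi> \<eta>" "ring.add ?H = (+)" "ring.zero ?H = 0"
    "monoid.one ?H = Poly_Mapping.single (0, 0, \<one>\<^bsub>G\<^esub>) 1"
    by (simp_all add: skew_group_ring_def)
  have M: "ring.zero ?M = (\<lambda>u. 0)" "ring.add ?M = (\<lambda>\<phi> \<psi> u. \<phi> u + \<psi> u)"
    by (simp_all add: Vx_model_def)
  have addM: "(\<lambda>u. \<phi> u + \<psi> u) \<in> carrier ?M" if "\<phi> \<in> carrier ?M" "\<psi> \<in> carrier ?M" for \<phi> \<psi>
    using that by (auto simp: Vx_model_def distrib_left)
  have zM: "(\<lambda>u. 0) \<in> carrier ?M" by (auto simp: Vx_model_def)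
  have ker: "h \<in> carrier G" "\<chi> h = 1" if "h \<in> char_kernel G \<chi>" for h
    using that by (auto simp: kernel_def Kunits_def)
  interpret H: ring ?H by (rule ring_skew_group_ring) fact+
  have ab: "abelian_group ?M"
  proof (rule abelian_groupI)
    fix \<phi> assume "\<phi> \<in> carrier ?M"
    then show "\<exists>\<psi>\<in>carrier ?M. \<psi> \<oplus>\<^bsub>?M\<^esub> \<phi> = \<zero>\<^bsub>?M\<^esub>"
      by (intro bexI[of _ "\<lambda>u. - \<phi> u"]) (auto simp: Vx_model_def)
  qed (auto simp: M addM zM add_ac)
  have closed: "r \<odot>\<^bsub>?M\<^esub> \<phi> \<in> carrier ?M" if "r \<in> carrier ?H" "\<phi> \<in> carrier ?M" for r \<phi>
    using that(1)
  proof (induction rule: carrier_skew_group_ring_induct)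
    case zero
    then show ?case by (simp add: Vx_model_smult_zero zM)
  next
    case (single i j g a)
    then show ?case using that(2) unfolding Vx_model_smult_single
      by (auto simp: Vx_model_def ker ch m_assoc)
  next
    case (add p r)
    then show ?case by (simp add: Vx_model_smult_add addM)
  qed
  have assoc: "skew_mult G \<chi> \<eta> p r \<odot>\<^bsub>?M\<^esub> \<phi> = p \<odot>\<^bsub>?M\<^esub> (r \<odot>\<^bsub>?M\<^esub> \<phi>)"
    if p: "p \<in> carrier ?H" and r: "r \<in> carrier ?H" for p r \<phi>
    using p
  proof (induction rule: carrier_skew_group_ring_induct)
    case zero
    then show ?case by (simp add: Vx_model_smult_zero)
  next
    case (single i j g a)
    note g = single
    show ?case using r
    proof (induction rule: carrier_skew_group_ring_induct)
      case zero
      then show ?case by (auto simp: Vx_model_smult_zero Vx_model_smult_single)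
    next
      case (single k l h d)
      show ?case
        unfolding skew_mult_single Vx_model_smult_single
        by (rule ext) (use g single in \<open>auto simp: ch m_assoc power_add field_simps\<close>)
    next
      case (add r r')
      then show ?case
        by (simp add: skew_mult_add_right Vx_model_smult_add Vx_model_smult_fun_add)
    qed
  next
    case (add p p')
    then show ?case by (simp add: skew_mult_add_left Vx_model_smult_add)
  qed
  show ?thesis
  proof (intro left_module.intro left_module_axioms.intro)
    fix \<phi> assume "\<phi> \<in> carrier ?M"
    then show "\<one>\<^bsub>?H\<^esub> \<odot>\<^bsub>?M\<^esub> \<phi> = \<phi>"
      by (intro ext) (auto simp: H Vx_model_smult_single Vx_model_def)
  qed (auto simp: H M closed assoc Vx_model_smult_add Vx_model_smult_fun_add ab
      H.ring_axioms)
qed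

lemma powers_of_root_of_unity:
  assumes "primitive_root_of_unity n q" "a \<in> generate Kunits {q}"
  shows "\<exists>i<n. a = q ^ i"
proof -
  have n: "n > 0" "q ^ n = 1" using assms(1) by (auto simp: primitive_root_of_unity_def)
  have q0: "q \<noteq> 0" using n by (metis power_eq_0_iff zero_neq_one)
  have mod: "q ^ k = q ^ (k mod n)" for k
  proof -
    have "q ^ k = q ^ (n * (k div n) + k mod n)" by simp
    also have "\<dots> = q ^ (k mod n)" by (simp only: power_add power_mult n) simp
    finally show ?thesis .
  qed
  have inv: "inv\<^bsub>Kunits\<^esub> q = q ^ (n - 1)"
    unfolding m_inv_def
  proof (rule the_equality)
    have "q * q ^ (n - 1) = 1" using n by (metis power_eq_if less_irrefl)
    then show "q ^ (n - 1) \<in> carrier Kunits \<and> q \<otimes>\<^bsub>Kunits\<^esub> q ^ (n - 1) = \<one>\<^bsub>Kunits\<^esub> \<and>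
        q ^ (n - 1) \<otimes>\<^bsub>Kunits\<^esub> q = \<one>\<^bsub>Kunits\<^esub>"
      using q0 by (auto simp: Kunits_def mult.commute)
    fix y assume "y \<in> carrier Kunits \<and> q \<otimes>\<^bsub>Kunits\<^esub> y = \<one>\<^bsub>Kunits\<^esub> \<and> y \<otimes>\<^bsub>Kunits\<^esub> q = \<one>\<^bsub>Kunits\<^esub>"
    then have "q * y = 1" by (auto simp: Kunits_def)
    with \<open>q * q ^ (n - 1) = 1\<close> q0 show "y = q ^ (n - 1)" by (metis mult_left_cancel)
  qed
  have "\<exists>k. a = q ^ k" using assms(2)
  proof induction
    case one
    show ?case by (rule exI[of _ 0]) (simp add: Kunits_def)
  next
    case (incl h)
    then show ?case by (intro exI[of _ 1]) simp
  next
    case (inv h)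
    then show ?case using \<open>inv\<^bsub>Kunits\<^esub> q = q ^ (n - 1)\<close> by auto
  next
    case (eng h1 h2)
    then show ?case by (auto simp: Kunits_def power_add[symmetric])
  qed
  then show ?thesis using mod n(1) by (metis mod_less_divisor)
qed

lemma Vx_exists:
  assumes "comm_group G" "c \<in> carrier G"
    and "\<chi> \<in> carrier (char_group G)" "\<eta> \<in> carrier (char_group G)"
    and prim: "primitive_root_of_unity n (\<chi> c)"
    and im: "\<chi> ` carrier G = generate Kunits {\<chi> c}"
    and "\<alpha> \<in> carrier Kunits"
    and \<mu>: "\<mu> \<in> carrier (char_group (G\<lparr>carrier := char_kernel G \<chi>\<rparr>))"
  shows "is_Vx G \<chi> \<eta> c n \<alpha> \<mu> (Vx_model G \<chi> \<alpha> \<mu>)"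
proof -
  interpret comm_group G by fact
  let ?N = "char_kernel G \<chi>"
  let ?M = "Vx_model G \<chi> \<alpha> \<mu>"
  interpret M: left_module "skew_group_ring G \<chi> \<eta>" ?M
    by (rule Vx_model_left_module) fact+
  have grp: "group G" ..
  note c = assms(2)
  note ch = char_groupD[OF assms(3)] char_group_one[OF assms(3) grp]
  have n: "n > 0" and qn: "\<chi> c ^ n = 1" and prim': "\<And>k. 0 < k \<Longrightarrow> k < n \<Longrightarrow> \<chi> c ^ k \<noteq> 1"
    using prim by (auto simp: primitive_root_of_unity_def)
  have chpow: "\<chi> (c [^]\<^bsub>G\<^esub> k) = \<chi> c ^ k" for k :: nat
    by (induction k) (auto simp: ch c mult.commute)
  have N: "h \<in> ?N \<longleftrightarrow> h \<in> carrier G \<and> \<chi> h = 1" for h by (auto simp: kernel_def Kunits_def)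
  have \<mu>m: "\<mu> (g \<otimes>\<^bsub>G\<^esub> h) = \<mu> g * \<mu> h" if "g \<in> ?N" "h \<in> ?N" for g h
    using char_groupD(2)[OF \<mu>, of g h] that by simp
  have oneN: "\<one>\<^bsub>G\<^esub> \<in> ?N" by (simp add: N ch)
  have \<mu>1: "\<mu> \<one>\<^bsub>G\<^esub> = 1"
    using char_groupD(1)[OF \<mu>, of "\<one>\<^bsub>G\<^esub>"] \<mu>m[OF oneN oneN] oneN by simp
  define v where "v i u = (if u \<in> carrier G \<and> u \<otimes>\<^bsub>G\<^esub> c [^]\<^bsub>G\<^esub> i \<in> ?N then \<mu> (u \<otimes>\<^bsub>G\<^esub> c [^]\<^bsub>G\<^esub> i) else 0)"
    for i :: nat and u
  have smultN: "h \<otimes>\<^bsub>G\<^esub> w \<in> ?N \<longleftrightarrow> w \<in> ?N" if "h \<in> ?N" "w \<in> carrier G" for h w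
    using that by (auto simp: N ch)
  have vM: "v i \<in> carrier ?M" for i
  proof -
    have "v i (h \<otimes>\<^bsub>G\<^esub> u) = \<mu> h * v i u" if h: "h \<in> ?N" and u: "u \<in> carrier G" for h u
    proof -
      have hG: "h \<in> carrier G" using h by (simp add: N)
      have "h \<otimes>\<^bsub>G\<^esub> u \<otimes>\<^bsub>G\<^esub> c [^]\<^bsub>G\<^esub> i = h \<otimes>\<^bsub>G\<^esub> (u \<otimes>\<^bsub>G\<^esub> c [^]\<^bsub>G\<^esub> i)"
        using hG u c by (simp add: m_assoc)
      moreover have "u \<otimes>\<^bsub>G\<^esub> c [^]\<^bsub>G\<^esub> i \<in> carrier G" using u c by simp
      ultimately show ?thesis using h u hG by (auto simp: v_def smultN \<mu>m)
    qed
    then show ?thesis by (auto simp: Vx_model_def v_def)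
  qed
  have sc: "scalar G a \<odot>\<^bsub>?M\<^esub> \<phi> = (\<lambda>u. a * \<phi> u)" if "\<phi> \<in> carrier ?M" for a \<phi>
    unfolding scalar_def Vx_model_smult_single using that by (auto simp: Vx_model_def)
  have scM: "scalar G a \<odot>\<^bsub>?M\<^esub> v i \<in> carrier ?M" for a i
    by (rule M.smult_closed) (auto simp: scalar_def vM)
  have fs: "(\<Oplus>\<^bsub>?M\<^esub>i\<in>A. scalar G (a i) \<odot>\<^bsub>?M\<^esub> v i) = (\<lambda>u. \<Sum>i\<in>A. a i * v i u)"
    if "finite A" for A a
    using that
  proof (induction A)
    case empty
    have "ring.zero ?M = (\<lambda>u. 0)" by (simp add: Vx_model_def)
    then show ?case by simp
  next
    case (insert i A)
    have "ring.add ?M \<phi> \<psi> = (\<lambda>u. \<phi> u + \<psi> u)" for \<phi> \<psi> by (simp add: Vx_model_def)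
    then show ?case using insert scM by (simp add: M.finsum_insert sc vM)
  qed
  have cinv: "inv\<^bsub>G\<^esub> (c [^]\<^bsub>G\<^esub> j) \<otimes>\<^bsub>G\<^esub> c [^]\<^bsub>G\<^esub> i \<in> ?N \<longleftrightarrow> i = j" if "i < n" "j < n" for i j
  proof
    assume "inv\<^bsub>G\<^esub> (c [^]\<^bsub>G\<^esub> j) \<otimes>\<^bsub>G\<^esub> c [^]\<^bsub>G\<^esub> i \<in> ?N"
    moreover have "c [^]\<^bsub>G\<^esub> i = c [^]\<^bsub>G\<^esub> j \<otimes>\<^bsub>G\<^esub> (inv\<^bsub>G\<^esub> (c [^]\<^bsub>G\<^esub> j) \<otimes>\<^bsub>G\<^esub> c [^]\<^bsub>G\<^esub> i)"
      using c by (simp add: m_assoc[symmetric])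
    ultimately have eq: "\<chi> c ^ i = \<chi> c ^ j" 
    proof -
      assume a: "inv\<^bsub>G\<^esub> (c [^]\<^bsub>G\<^esub> j) \<otimes>\<^bsub>G\<^esub> c [^]\<^bsub>G\<^esub> i \<in> ?N"
        and b: "c [^]\<^bsub>G\<^esub> i = c [^]\<^bsub>G\<^esub> j \<otimes>\<^bsub>G\<^esub> (inv\<^bsub>G\<^esub> (c [^]\<^bsub>G\<^esub> j) \<otimes>\<^bsub>G\<^esub> c [^]\<^bsub>G\<^esub> i)"
      have "\<chi> (c [^]\<^bsub>G\<^esub> i) = \<chi> (c [^]\<^bsub>G\<^esub> j) * \<chi> (inv\<^bsub>G\<^esub> (c [^]\<^bsub>G\<^esub> j) \<otimes>\<^bsub>G\<^esub> c [^]\<^bsub>G\<^esub> i)"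
        using c by (subst b, subst ch(2)) auto
      with a show ?thesis by (simp add: N chpow)
    qed
    show "i = j"
    proof (rule ccontr)
      assume "i \<noteq> j"
      define a b where "a = min i j" and "b = max i j"
      have ab: "a < b" "b < n" using \<open>i \<noteq> j\<close> that by (auto simp: a_def b_def)
      have "\<chi> c ^ b = \<chi> c ^ a" using eq by (auto simp: a_def b_def min_def max_def)
      also have "\<chi> c ^ b = \<chi> c ^ a * \<chi> c ^ (b - a)" using ab by (simp add: power_add[symmetric])
      finally have "\<chi> c ^ (b - a) = 1" using ch(1)[OF c] by simp
      then show False using prim'[of "b - a"] ab by auto
    qed
  qed (use c oneN in auto)
  have vj: "v i (inv\<^bsub>G\<^esub> (c [^]\<^bsub>G\<^esub> j)) = (if i = j then 1 else 0)" if "i < n" "j < n" for i j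
    using cinv[OF that] c \<mu>1 by (auto simp: v_def)
  have Mh: "\<phi> (h \<otimes>\<^bsub>G\<^esub> u) = \<mu> h * \<phi> u" if "\<phi> \<in> carrier ?M" "h \<in> ?N" "u \<in> carrier G" for \<phi> h u
    using that by (simp add: Vx_model_def)
  have M0: "\<phi> u = 0" if "\<phi> \<in> carrier ?M" "u \<notin> carrier G" for \<phi> u
    using that by (simp add: Vx_model_def)
  have basis: "scalar_basis G ?M n v"
    unfolding scalar_basis_def
  proof (intro conjI allI impI ballI)
    fix \<phi> assume phi: "\<phi> \<in> carrier ?M"
    have "\<phi> u = (\<Sum>i<n. \<phi> (inv\<^bsub>G\<^esub> (c [^]\<^bsub>G\<^esub> i)) * v i u)" for u
    proof (cases "u \<in> carrier G")
      case True
      then have "inv\<^bsub>G\<^esub> u \<in> carrier G" by simp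
      then have "\<chi> (inv\<^bsub>G\<^esub> u) \<in> generate Kunits {\<chi> c}" using im by blast
      then obtain j where j: "j < n" "\<chi> (inv\<^bsub>G\<^esub> u) = \<chi> c ^ j"
        using powers_of_root_of_unity[OF prim] by blast
      have "\<chi> u * \<chi> (inv\<^bsub>G\<^esub> u) = 1"
        using True ch(2)[of u "inv\<^bsub>G\<^esub> u"] ch(3) by (simp del: ch)
      moreover have "\<chi> (u \<otimes>\<^bsub>G\<^esub> c [^]\<^bsub>G\<^esub> j) = \<chi> u * \<chi> (c [^]\<^bsub>G\<^esub> j)" by (rule ch(2)) (use True c in auto)
      ultimately have uN: "u \<otimes>\<^bsub>G\<^esub> c [^]\<^bsub>G\<^esub> j \<in> ?N" using True c by (simp add: N chpow j(2))
      define h where "h = u \<otimes>\<^bsub>G\<^esub> c [^]\<^bsub>G\<^esub> j"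
      have u: "u = h \<otimes>\<^bsub>G\<^esub> inv\<^bsub>G\<^esub> (c [^]\<^bsub>G\<^esub> j)" using True c by (simp add: h_def m_assoc)
      have hN: "h \<in> ?N" and hG: "h \<in> carrier G" using uN by (auto simp: h_def N)
      have vu: "v i u = (if i = j then \<mu> h else 0)" if "i < n" for i
      proof -
        have "v i u = \<mu> h * v i (inv\<^bsub>G\<^esub> (c [^]\<^bsub>G\<^esub> j))"
          using Mh[OF vM[of i] hN, of "inv\<^bsub>G\<^esub> (c [^]\<^bsub>G\<^esub> j)"] c u by (metis inv_closed nat_pow_closed)
        then show ?thesis using vj[OF that j(1)] by simp
      qed
      have "(\<Sum>i<n. \<phi> (inv\<^bsub>G\<^esub> (c [^]\<^bsub>G\<^esub> i)) * v i u) = (\<Sum>i<n. if i = j then \<phi> (inv\<^bsub>G\<^esub> (c [^]\<^bsub>G\<^esub> i)) * \<mu> h else 0)"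
        by (intro sum.cong) (auto simp: vu)
      also have "\<dots> = \<phi> (inv\<^bsub>G\<^esub> (c [^]\<^bsub>G\<^esub> j)) * \<mu> h" using j by simp
      also have "\<dots> = \<mu> h * \<phi> (inv\<^bsub>G\<^esub> (c [^]\<^bsub>G\<^esub> j))" by simp
      also have "\<dots> = \<phi> u"
        using Mh[OF phi hN, of "inv\<^bsub>G\<^esub> (c [^]\<^bsub>G\<^esub> j)"] c u by (metis inv_closed nat_pow_closed)
      finally show ?thesis ..
    next
      case False
      then show ?thesis using M0[OF phi] by (simp add: v_def)
    qed
    then have "\<phi> = (\<lambda>u. \<Sum>i<n. \<phi> (inv\<^bsub>G\<^esub> (c [^]\<^bsub>G\<^esub> i)) * v i u)" by (rule ext)
    also have "\<dots> = (\<Oplus>\<^bsub>?M\<^esub>i\<in>{..<n}. scalar G (\<phi> (inv\<^bsub>G\<^esub> (c [^]\<^bsub>G\<^esub> i))) \<odot>\<^bsub>?M\<^esub> v i)"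
      by (rule fs[symmetric]) simp
    finally show "\<exists>a. \<phi> = (\<Oplus>\<^bsub>?M\<^esub>i\<in>{..<n}. scalar G (a i) \<odot>\<^bsub>?M\<^esub> v i)"
      by (rule exI[of _ "\<lambda>i. \<phi> (inv\<^bsub>G\<^esub> (c [^]\<^bsub>G\<^esub> i))"])
  next
    fix a j assume "(\<Oplus>\<^bsub>?M\<^esub>i\<in>{..<n}. scalar G (a i) \<odot>\<^bsub>?M\<^esub> v i) = \<zero>\<^bsub>?M\<^esub>" and j: "j < n"
    then have "(\<Sum>i<n. a i * v i (inv\<^bsub>G\<^esub> (c [^]\<^bsub>G\<^esub> j))) = 0"
      by (simp only: fs finite_lessThan) (simp add: Vx_model_def fun_eq_iff)
    moreover have "(\<Sum>i<n. a i * v i (inv\<^bsub>G\<^esub> (c [^]\<^bsub>G\<^esub> j))) = (\<Sum>i<n. if i = j then a i else 0)"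
      by (intro sum.cong) (auto simp: vj j)
    ultimately show "a j = 0" using j by simp
  qed (rule vM)
  have cnN: "c [^]\<^bsub>G\<^esub> n \<in> ?N" using c by (simp add: N chpow qn)
  show ?thesis
    unfolding is_Vx_def
  proof (intro conjI exI[of _ v] allI impI ballI)
    show "left_module (skew_group_ring G \<chi> \<eta>) ?M" by (rule M.left_module_axioms)
    show "scalar_basis G ?M n v" by (rule basis)
    fix i assume i: "i < n"
    show "gen_y G \<odot>\<^bsub>?M\<^esub> v i = \<zero>\<^bsub>?M\<^esub>"
      unfolding gen_y_def Vx_model_smult_single by (auto simp: Vx_model_def)
    show "gen_x G \<odot>\<^bsub>?M\<^esub> v i = scalar G (\<chi> c ^ i * \<alpha>) \<odot>\<^bsub>?M\<^esub> v i"
    proof -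
      have "\<alpha> / \<chi> u = \<chi> c ^ i * \<alpha>" if "u \<in> carrier G" "u \<otimes>\<^bsub>G\<^esub> c [^]\<^bsub>G\<^esub> i \<in> ?N" for u
      proof -
        have "\<chi> u * \<chi> c ^ i = 1" using that c by (simp add: N ch chpow)
        then show ?thesis using ch(1)[OF that(1)] by (simp add: field_simps)
      qed
      then have "\<alpha> / \<chi> u * v i u = \<chi> c ^ i * \<alpha> * v i u" if "u \<in> carrier G" for u
        using that by (simp only: v_def split: if_split) simp
      moreover have "v i u = 0" if "u \<notin> carrier G" for u using that by (simp add: v_def)
      moreover have "u \<otimes>\<^bsub>G\<^esub> \<one>\<^bsub>G\<^esub> = u" if "u \<in> carrier G" for u using that by simp
      ultimately show ?thesis unfolding sc[OF vM] unfolding gen_x_def Vx_model_smult_single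
        by (intro ext) auto
    qed
    show "gen_grp h \<odot>\<^bsub>?M\<^esub> v i = scalar G (\<mu> h) \<odot>\<^bsub>?M\<^esub> v i" if h: "h \<in> ?N" for h
    proof -
      have hG: "h \<in> carrier G" using h by (simp add: N)
      have "v i (u \<otimes>\<^bsub>G\<^esub> h) = \<mu> h * v i u" if "u \<in> carrier G" for u
        using vM[of i] h that hG by (auto simp: Vx_model_def m_comm[of u h])
      then show ?thesis unfolding sc[OF vM] unfolding gen_grp_def Vx_model_smult_single
        by (intro ext) (auto simp: v_def)
    qed
    have shift: "gen_grp c \<odot>\<^bsub>?M\<^esub> v i = v (Suc i)"
      unfolding gen_grp_def Vx_model_smult_single
      using c m_comm[of c "c [^]\<^bsub>G\<^esub> i"] by (intro ext) (auto simp: v_def m_assoc)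
    show "gen_grp c \<odot>\<^bsub>?M\<^esub> v i =
        (if i = n - 1 then scalar G (\<mu> (c [^]\<^bsub>G\<^esub> n)) \<odot>\<^bsub>?M\<^esub> v 0 else v (i + 1))"
    proof (cases "i = n - 1")
      case True
      then have "Suc i = n" using n by simp
      moreover have "v n = (\<lambda>u. \<mu> (c [^]\<^bsub>G\<^esub> n) * v 0 u)"
      proof
        fix u
        show "v n u = \<mu> (c [^]\<^bsub>G\<^esub> n) * v 0 u"
        proof (cases "u \<in> carrier G")
          case u: True
          have "u \<otimes>\<^bsub>G\<^esub> c [^]\<^bsub>G\<^esub> n = c [^]\<^bsub>G\<^esub> n \<otimes>\<^bsub>G\<^esub> u" using u c by (simp add: m_comm)
          then show ?thesis using u cnN by (auto simp: v_def smultN \<mu>m)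
        qed (simp add: v_def)
      qed
      ultimately show ?thesis by (simp only: True[symmetric] shift sc[OF vM] if_True refl)
    qed (simp add: shift)
  qed
qed

end

theory Submission
  imports Defs
begin

text \<open>Let \<open>N\<close> be the kernel of \<open>\<chi>\<close> and \<open>q = \<chi>(c)\<close>. The whole proof rests on finding enough operators on
  the simple module \<open>V\<close> that commute with everything.

  The vectors killed by \<open>y\<close> form a submodule, which is nonzero by torsion, so \<open>y\<close> acts as zero. Since
  every value of \<open>\<chi>\<close> is an \<open>n\<close>-th root of unity, \<open>x\<^sup>n\<close> commutes with \<open>G\<close>, and since \<open>\<chi>\<close> is trivial on
  \<open>N\<close>, the elements of \<open>N\<close> commute with \<open>x\<close>. Hence every polynomial in \<open>x\<^sup>n\<close> and elements of \<open>N\<close> has a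
  submodule as its image and acts as zero or surjectively. Every element of \<open>G\<close> has the form \<open>c\<^sup>i h\<close>
  with \<open>i < n\<close> and \<open>h \<in> N\<close>, so \<open>V\<close> is generated by the finitely many vectors \<open>x\<^sup>r c\<^sup>i w\<close> with \<open>r, i < n\<close>
  over the commutative algebra of these polynomials, and that algebra is finitely generated because
  \<open>N\<close> is. Over an algebraically closed field this forces the algebra to act by scalars
  (\<open>finitely_generated_acts_by_scalars\<close>, applied in \<open>central_scalars\<close>). No
  bound on the cardinality of the field is assumed, so a countability argument in the style of
  Schur's lemma does not suffice; the Nullstellensatz (\<open>dense_points_generated\<close>) and a form of
  Nakayama's lemma (\<open>nakayama\<close>) replace it.

  Once \<open>x\<^sup>n\<close> is a scalar, \<open>x\<close> is annihilated by a nonzero polynomial and has an eigenvector \<open>v\<^sub>0\<close>, say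
  with eigenvalue \<open>\<alpha>\<close>, which is nonzero because \<open>V\<close> is \<open>x\<close>-torsion-free. The vector \<open>c\<^sup>i v\<^sub>0\<close> has
  eigenvalue \<open>q\<^sup>i \<alpha>\<close>. For \<open>i < n\<close> these eigenvalues are distinct, so the vectors are independent, and
  they span \<open>V\<close> because \<open>V\<close> is generated by \<open>v\<^sub>0\<close> (\<open>exists_parameters\<close>).

  For the classification, replacing the basis \<open>v\<^sub>i\<close> by \<open>c v\<^sub>i\<close> turns the parameter \<open>\<alpha>\<close> into \<open>q \<alpha>\<close> and
  keeps the character, and two modules with equal parameters are identified basis vector by basis
  vector. Conversely an isomorphism carries \<open>v\<^sub>0\<close> to an eigenvector of \<open>x\<close>, and the only eigenvalues
  of \<open>x\<close> on the second module are the \<open>q\<^sup>i \<alpha>'\<close>; on the image of \<open>v\<^sub>0\<close> an element of \<open>N\<close> acts through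
  both characters, so they agree (\<open>isomorphic_iff\<close>).\<close>

section \<open>Polynomials over a subalgebra\<close>

definition polys_over :: "'r::comm_ring_1 set \<Rightarrow> 'r poly set" where
  "polys_over A = {p. \<forall>i. coeff p i \<in> A}"

definition adjoin :: "'r::comm_ring_1 set \<Rightarrow> 'r \<Rightarrow> 'r set" where
  "adjoin A t = (\<lambda>p. poly p t) ` polys_over A"

text \<open>The base field enters through an explicit ring homomorphism, and subalgebras are sets rather than
  types, because the proof of the Nullstellensatz adjoins the generators one at a time and therefore
  has to vary the subalgebra inside one induction.\<close>
locale scalar_embedding =
  fixes \<iota> :: "'k::field \<Rightarrow> 'r::comm_ring_1"
  assumes iota_add: "\<iota> (a + b) = \<iota> a + \<iota> b"
    and iota_mult: "\<iota> (a * b) = \<iota> a * \<iota> b"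
    and iota_one: "\<iota> 1 = 1"
begin

lemma iota_zero: "\<iota> 0 = 0"
  using iota_add[of 0 0] by simp

lemma iota_minus: "\<iota> (- a) = - \<iota> a"
  using iota_add[of "- a" a] iota_zero by (simp add: eq_neg_iff_add_eq_0)

definition subalgebra :: "'r set \<Rightarrow> bool" where
  "subalgebra A \<longleftrightarrow> range \<iota> \<subseteq> A \<and> (\<forall>a\<in>A. \<forall>b\<in>A. a + b \<in> A \<and> a * b \<in> A)"

fun generated_algebra :: "'r list \<Rightarrow> 'r set" where
  "generated_algebra [] = range \<iota>"
| "generated_algebra (t # ts) = adjoin (generated_algebra ts) t"

lemma subalgebraD:
  assumes "subalgebra A"
  shows "\<iota> k \<in> A" "0 \<in> A" "1 \<in> A"
    and "a \<in> A \<Longrightarrow> b \<in> A \<Longrightarrow> a + b \<in> A"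
    and "a \<in> A \<Longrightarrow> b \<in> A \<Longrightarrow> a * b \<in> A"
    and "a \<in> A \<Longrightarrow> - a \<in> A"
    and "a \<in> A \<Longrightarrow> b \<in> A \<Longrightarrow> a - b \<in> A"
    and "a \<in> A \<Longrightarrow> a ^ n \<in> A"
    and "(\<And>i. i \<in> I \<Longrightarrow> f i \<in> A) \<Longrightarrow> sum f I \<in> A"
proof -
  show k: "\<iota> k \<in> A" for k using assms by (auto simp: subalgebra_def)
  show z: "0 \<in> A" and one: "1 \<in> A" using k[of 0] k[of 1] by (simp_all add: iota_zero iota_one)
  show add: "a \<in> A \<Longrightarrow> b \<in> A \<Longrightarrow> a + b \<in> A" and mult: "a \<in> A \<Longrightarrow> b \<in> A \<Longrightarrow> a * b \<in> A" for a b
    using assms by (auto simp: subalgebra_def)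
  show minus: "a \<in> A \<Longrightarrow> - a \<in> A" for a
    using mult[OF k[of "-1"], of a] by (simp add: iota_minus iota_one)
  show "a \<in> A \<Longrightarrow> b \<in> A \<Longrightarrow> a - b \<in> A"
    using add[of a "- b"] minus[of b] by simp
  show "a \<in> A \<Longrightarrow> a ^ n \<in> A" by (induction n) (auto simp: one mult)
  show "(\<And>i. i \<in> I \<Longrightarrow> f i \<in> A) \<Longrightarrow> sum f I \<in> A"
    by (induction I rule: infinite_finite_induct) (auto simp: z add)
qed

lemma polys_over_closed:
  assumes A: "subalgebra A"
  shows "0 \<in> polys_over A" "1 \<in> polys_over A" "[:0, 1:] \<in> polys_over A"
    and "a \<in> A \<Longrightarrow> [:a:] \<in> polys_over A"
    and "a \<in> A \<Longrightarrow> monom a n \<in> polys_over A"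
    and "a \<in> A \<Longrightarrow> p \<in> polys_over A \<Longrightarrow> smult a p \<in> polys_over A"
    and "p \<in> polys_over A \<Longrightarrow> q \<in> polys_over A \<Longrightarrow> p + q \<in> polys_over A"
    and "p \<in> polys_over A \<Longrightarrow> q \<in> polys_over A \<Longrightarrow> p - q \<in> polys_over A"
    and "p \<in> polys_over A \<Longrightarrow> q \<in> polys_over A \<Longrightarrow> p * q \<in> polys_over A"
  using subalgebraD(1-8)[OF A]
  by (auto simp: polys_over_def coeff_pCons coeff_mult split: nat.split
      intro!: subalgebraD(9)[OF A])

lemma subalgebra_adjoin:
  assumes A: "subalgebra A"
  shows "subalgebra (adjoin A t)" "A \<subseteq> adjoin A t" "t \<in> adjoin A t"
proof -
  note pA = polys_over_closed[OF A]
  show sub: "A \<subseteq> adjoin A t"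
  proof
    fix a assume "a \<in> A"
    then show "a \<in> adjoin A t"
      unfolding adjoin_def by (intro image_eqI[of _ _ "[:a:]"]) (auto simp: pA)
  qed
  show "t \<in> adjoin A t"
    unfolding adjoin_def by (intro image_eqI[of _ _ "[:0, 1:]"]) (auto simp: pA)
  show "subalgebra (adjoin A t)"
    unfolding subalgebra_def
  proof (intro conjI ballI)
    show "range \<iota> \<subseteq> adjoin A t" using A sub by (auto simp: subalgebra_def)
    fix a b assume "a \<in> adjoin A t" "b \<in> adjoin A t"
    then obtain p q where pq: "p \<in> polys_over A" "q \<in> polys_over A" "a = poly p t" "b = poly q t"
      by (auto simp: adjoin_def)
    show "a + b \<in> adjoin A t"
      unfolding adjoin_def by (intro image_eqI[of _ _ "p + q"]) (auto simp: pA pq)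
    show "a * b \<in> adjoin A t"
      unfolding adjoin_def by (intro image_eqI[of _ _ "p * q"]) (auto simp: pA pq)
  qed
qed

lemma subalgebra_generated: "subalgebra (generated_algebra ts)"
proof (induction ts)
  case Nil
  show ?case
    unfolding subalgebra_def
    by (auto simp flip: iota_add iota_mult)
qed (auto intro: subalgebra_adjoin)

lemma generators_in_generated: "t \<in> set ts \<Longrightarrow> t \<in> generated_algebra ts"
  by (induction ts) (use subalgebra_adjoin(2,3)[OF subalgebra_generated] in auto)

text \<open>Multiplying by a power of the leading coefficient of the divisor replaces inverting it, so the
  quotient and the remainder keep their coefficients in the subalgebra. The bound on the degree of
  the quotient does not follow from the equation, since the ring may have zero divisors.\<close>
lemma pseudo_division_over:
  assumes A: "subalgebra A" and g: "g \<in> polys_over A" "degree g > 0"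
    and f: "f \<in> polys_over A"
  shows "\<exists>k. \<exists>q\<in>polys_over A. \<exists>r\<in>polys_over A.
    smult (lead_coeff g ^ k) f = g * q + r \<and> degree r < degree g \<and> degree q \<le> degree f - degree g"
  using f
proof (induction "degree f" arbitrary: f rule: less_induct)
  case less
  note pA = polys_over_closed[OF A]
  show ?case
  proof (cases "degree f < degree g")
    case True
    then show ?thesis
      by (intro exI[of _ 0] bexI[of _ 0] bexI[of _ f]) (auto simp: pA less.prems)
  next
    case False
    define l where "l = lead_coeff g"
    define m where "m = monom (lead_coeff f) (degree f - degree g)"
    define f' where "f' = smult l f - g * m"
    have lA: "l \<in> A" and "lead_coeff f \<in> A" using g less.prems by (auto simp: l_def polys_over_def)
    then have mA: "m \<in> polys_over A" by (simp add: m_def pA)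
    then have f'A: "f' \<in> polys_over A" by (auto simp: f'_def pA lA less.prems g)
    have dm: "degree m \<le> degree f - degree g" by (simp add: m_def degree_monom_le)
    have "degree (g * m) \<le> degree f"
      using degree_mult_le[of g m] dm False by linarith
    then have "degree f' \<le> degree f"
      unfolding f'_def by (intro degree_diff_le order.trans[OF degree_smult_le]) auto
    moreover have "coeff f' (degree f) = 0"
    proof -
      have "coeff (g * m) (degree f) = coeff (g * m) ((degree f - degree g) + degree g)"
        using False by simp
      also have "\<dots> = lead_coeff f * l"
        unfolding m_def l_def by (subst mult.commute, subst coeff_monom_mult) auto
      finally show ?thesis by (simp add: f'_def mult.commute)
    qed
    ultimately have "degree f' < degree f"
      using False g(2) by (metis eq_zero_or_degree_less leD leI le_neq_implies_less leading_coeff_0_iff degree_0)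
    then obtain k q r where IH: "q \<in> polys_over A" "r \<in> polys_over A"
      "smult (l ^ k) f' = g * q + r" "degree r < degree g" "degree q \<le> degree f' - degree g"
      using less.hyps[of f'] f'A unfolding l_def by blast
    show ?thesis
    proof (rule exI[of _ "Suc k"], rule bexI[of _ "q + smult (l ^ k) m"], rule bexI[of _ r], intro conjI)
      have "smult (l ^ Suc k) f = smult (l ^ k) f' + smult (l ^ k) (g * m)"
        by (simp add: f'_def smult_diff_right mult.commute)
      also have "\<dots> = g * (q + smult (l ^ k) m) + r"
        by (simp add: IH distrib_left)
      finally show "smult (lead_coeff g ^ Suc k) f = g * (q + smult (l ^ k) m) + r"
        by (simp add: l_def)
      show "degree (q + smult (l ^ k) m) \<le> degree f - degree g"
        using IH(5) \<open>degree f' < degree f\<close> dm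
        by (intro degree_add_le order.trans[OF degree_smult_le]) auto
    qed (use IH mA lA in \<open>auto simp: pA subalgebraD[OF A]\<close>)
  qed
qed

end

section \<open>The Nullstellensatz\<close>

text \<open>Working modulo a prime ideal \<open>P\<close> of the ambient ring takes the place of passing to the quotient
  domain. In the application \<open>P\<close> is the annihilator of a module, and the quotient is a ring of
  operators that depends on this module and so cannot be a type.\<close>
locale algebra_with_prime = scalar_embedding \<iota>
  for \<iota> :: "'k::alg_closed_field \<Rightarrow> 'r::comm_ring_1" +
  fixes P :: "'r set"
  assumes P_add: "a \<in> P \<Longrightarrow> b \<in> P \<Longrightarrow> a + b \<in> P"
    and P_mult: "a \<in> P \<Longrightarrow> r * a \<in> P"
    and P_prime: "a * b \<in> P \<Longrightarrow> a \<in> P \<or> b \<in> P"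
    and P_one: "1 \<notin> P"
    and P_zero: "0 \<in> P"
begin

text \<open>The \<open>K\<close>-valued points of the variety of \<open>A / (A \<inter> P)\<close>.\<close>
definition point :: "'r set \<Rightarrow> ('r \<Rightarrow> 'k) \<Rightarrow> bool" where
  "point A \<phi> \<longleftrightarrow> (\<forall>a\<in>A. \<forall>b\<in>A. \<phi> (a + b) = \<phi> a + \<phi> b \<and> \<phi> (a * b) = \<phi> a * \<phi> b) \<and>
     (\<forall>k. \<phi> (\<iota> k) = k) \<and> (\<forall>a\<in>A \<inter> P. \<phi> a = 0)"

text \<open>Density of the points in the Zariski topology. The bare existence of a point is too weak to
  survive the adjunction of a further element: to extend a point to \<open>t\<close>, it must avoid the zeros of
  finitely many elements such as the leading coefficient of an equation for \<open>t\<close>.\<close>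
definition dense_points :: "'r set \<Rightarrow> bool" where
  "dense_points A \<longleftrightarrow> (\<forall>r\<in>A - P. \<exists>\<phi>. point A \<phi> \<and> \<phi> r \<noteq> 0)"

lemma P_minus: "a \<in> P \<Longrightarrow> - a \<in> P"
  using P_mult[of a "-1"] by simp

lemma P_diff: "a \<in> P \<Longrightarrow> b \<in> P \<Longrightarrow> a - b \<in> P"
  using P_add[of a "- b"] P_minus[of b] by simp

lemma P_cong: "a - b \<in> P \<Longrightarrow> a \<in> P \<longleftrightarrow> b \<in> P"
  using P_add[of "a - b" b] P_diff[of a "a - b"] by auto

lemma P_sum: "(\<And>i. i \<in> I \<Longrightarrow> f i \<in> P) \<Longrightarrow> sum f I \<in> P"
  by (induction I rule: infinite_finite_induct) (auto intro: P_add P_zero)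

lemma P_mult_right: "a \<in> P \<Longrightarrow> a * r \<in> P"
  using P_mult[of a r] by (simp add: mult.commute)

lemma P_power: "a ^ n \<in> P \<Longrightarrow> a \<in> P"
  by (induction n) (use P_prime P_one in auto)

lemma P_poly: "(\<And>i. coeff p i \<in> P) \<Longrightarrow> poly p t \<in> P"
  unfolding poly_altdef by (intro P_sum P_mult_right)

lemma pointD:
  assumes "point A \<phi>" and A: "subalgebra A"
  shows "a \<in> A \<Longrightarrow> b \<in> A \<Longrightarrow> \<phi> (a + b) = \<phi> a + \<phi> b"
    and "a \<in> A \<Longrightarrow> b \<in> A \<Longrightarrow> \<phi> (a * b) = \<phi> a * \<phi> b"
    and "\<phi> (\<iota> k) = k" and "\<phi> 0 = 0" and "\<phi> 1 = 1"
    and "a \<in> A \<Longrightarrow> a \<in> P \<Longrightarrow> \<phi> a = 0"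
    and "a \<in> A \<Longrightarrow> b \<in> A \<Longrightarrow> \<phi> (a - b) = \<phi> a - \<phi> b"
    and "a \<in> A \<Longrightarrow> \<phi> (a ^ n) = \<phi> a ^ n"
    and "(\<And>i. i \<in> I \<Longrightarrow> f i \<in> A) \<Longrightarrow> \<phi> (sum f I) = (\<Sum>i\<in>I. \<phi> (f i))"
proof -
  note AD = subalgebraD[OF A]
  show add: "a \<in> A \<Longrightarrow> b \<in> A \<Longrightarrow> \<phi> (a + b) = \<phi> a + \<phi> b"
    and mult: "a \<in> A \<Longrightarrow> b \<in> A \<Longrightarrow> \<phi> (a * b) = \<phi> a * \<phi> b"
    and k: "\<phi> (\<iota> k) = k"
    and "a \<in> A \<Longrightarrow> a \<in> P \<Longrightarrow> \<phi> a = 0" for a b k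
    using assms(1) by (auto simp: point_def)
  show z: "\<phi> 0 = 0" and one: "\<phi> 1 = 1" using k[of 0] k[of 1] by (simp_all add: iota_zero iota_one)
  show "a \<in> A \<Longrightarrow> b \<in> A \<Longrightarrow> \<phi> (a - b) = \<phi> a - \<phi> b"
    using add[of "a - b" b] AD(7)[of a b] by (simp add: algebra_simps)
  show "a \<in> A \<Longrightarrow> \<phi> (a ^ n) = \<phi> a ^ n"
    by (induction n) (auto simp: one mult AD)
  show "(\<And>i. i \<in> I \<Longrightarrow> f i \<in> A) \<Longrightarrow> \<phi> (sum f I) = (\<Sum>i\<in>I. \<phi> (f i))"
    by (induction I rule: infinite_finite_induct) (auto simp: z add AD)
qed

lemma map_poly_point:
  assumes pt: "point A \<phi>" and A: "subalgebra A"
  shows "p \<in> polys_over A \<Longrightarrow> q \<in> polys_over A \<Longrightarrow> map_poly \<phi> (p + q) = map_poly \<phi> p + map_poly \<phi> q"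
    and "p \<in> polys_over A \<Longrightarrow> q \<in> polys_over A \<Longrightarrow> map_poly \<phi> (p - q) = map_poly \<phi> p - map_poly \<phi> q"
    and "p \<in> polys_over A \<Longrightarrow> q \<in> polys_over A \<Longrightarrow> map_poly \<phi> (p * q) = map_poly \<phi> p * map_poly \<phi> q"
    and "a \<in> A \<Longrightarrow> p \<in> polys_over A \<Longrightarrow> map_poly \<phi> (smult a p) = smult (\<phi> a) (map_poly \<phi> p)"
    and "map_poly \<phi> [:a:] = [:\<phi> a:]"
    and "p \<in> polys_over A \<Longrightarrow> (\<And>i. coeff p i \<in> P) \<Longrightarrow> map_poly \<phi> p = 0"
proof -
  note ptD = pointD[OF pt A] and AD = subalgebraD[OF A]
  note c = coeff_map_poly[of \<phi>, OF ptD(4)]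
  show "p \<in> polys_over A \<Longrightarrow> q \<in> polys_over A \<Longrightarrow> map_poly \<phi> (p + q) = map_poly \<phi> p + map_poly \<phi> q"
    "p \<in> polys_over A \<Longrightarrow> q \<in> polys_over A \<Longrightarrow> map_poly \<phi> (p - q) = map_poly \<phi> p - map_poly \<phi> q"
    "a \<in> A \<Longrightarrow> p \<in> polys_over A \<Longrightarrow> map_poly \<phi> (smult a p) = smult (\<phi> a) (map_poly \<phi> p)"
    "p \<in> polys_over A \<Longrightarrow> (\<And>i. coeff p i \<in> P) \<Longrightarrow> map_poly \<phi> p = 0"
    by (auto intro!: poly_eqI simp: c ptD polys_over_def)
  show "map_poly \<phi> [:a:] = [:\<phi> a:]"
    by (auto intro!: poly_eqI simp: c ptD coeff_pCons split: nat.split)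
  show "p \<in> polys_over A \<Longrightarrow> q \<in> polys_over A \<Longrightarrow> map_poly \<phi> (p * q) = map_poly \<phi> p * map_poly \<phi> q"
    by (rule poly_eqI) (auto simp: c coeff_mult ptD AD polys_over_def)
qed

text \<open>An element of \<open>A[t]\<close> has many expressions as a polynomial in \<open>t\<close>; the hypothesis on relations says
  exactly that sending \<open>t\<close> to \<open>\<tau>\<close> does not depend on the expression chosen.\<close>
lemma extend_point:
  assumes pt: "point A \<phi>" and A: "subalgebra A"
    and vanish: "\<And>p. p \<in> polys_over A \<Longrightarrow> poly p t \<in> P \<Longrightarrow> poly (map_poly \<phi> p) \<tau> = 0"
  obtains \<psi> where "point (adjoin A t) \<psi>"
    and "\<And>p. p \<in> polys_over A \<Longrightarrow> \<psi> (poly p t) = poly (map_poly \<phi> p) \<tau>"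
proof -
  note pA = polys_over_closed[OF A] and mp = map_poly_point[OF pt A]
  define \<psi> where "\<psi> y = poly (map_poly \<phi> (SOME p. p \<in> polys_over A \<and> poly p t = y)) \<tau>" for y
  have \<psi>: "\<psi> (poly p t) = poly (map_poly \<phi> p) \<tau>" if "p \<in> polys_over A" for p
  proof -
    define p' where "p' = (SOME q. q \<in> polys_over A \<and> poly q t = poly p t)"
    have p': "p' \<in> polys_over A" "poly p' t = poly p t"
      using someI[of "\<lambda>q. q \<in> polys_over A \<and> poly q t = poly p t" p] that by (auto simp: p'_def)
    then have "poly (map_poly \<phi> (p' - p)) \<tau> = 0"
      by (intro vanish) (auto simp: pA that P_zero)
    then show ?thesis by (simp add: \<psi>_def p'_def[symmetric] mp p' that)
  qed
  have "point (adjoin A t) \<psi>"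
    unfolding point_def
  proof (intro conjI ballI allI)
    fix a b assume "a \<in> adjoin A t" "b \<in> adjoin A t"
    then obtain p q where pq: "p \<in> polys_over A" "q \<in> polys_over A" "a = poly p t" "b = poly q t"
      by (auto simp: adjoin_def)
    show "\<psi> (a + b) = \<psi> a + \<psi> b" using \<psi>[of "p + q"] by (simp add: pq \<psi> pA mp)
    show "\<psi> (a * b) = \<psi> a * \<psi> b" using \<psi>[of "p * q"] by (simp add: pq \<psi> pA mp)
  next
    fix k
    show "\<psi> (\<iota> k) = k"
      using \<psi>[of "[:\<iota> k:]"] by (simp add: pA subalgebraD[OF A] mp pointD[OF pt A])
  next
    fix a assume "a \<in> adjoin A t \<inter> P"
    then show "\<psi> a = 0" using \<psi> vanish by (auto simp: adjoin_def)
  qed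
  with \<psi> show ?thesis using that by blast
qed

text \<open>For a nonconstant \<open>f\<close>, a root of \<open>f - 1\<close> is not a root of \<open>f\<close>.\<close>
lemma alg_closed_nonroot:
  fixes f :: "'k poly"
  assumes "f \<noteq> 0"
  obtains \<tau> where "poly f \<tau> \<noteq> 0"
proof (cases "degree f > 0")
  case True
  have "degree (f - 1) = degree f"
    using degree_add_eq_left[of "-1" f] True by simp
  then obtain \<tau> where "poly (f - 1) \<tau> = 0" using alg_closed_imp_poly_has_root[of "f - 1"] True by auto
  then show ?thesis using that[of \<tau>] by simp
next
  case False
  then obtain a where "f = [:a:]" by (metis degree_eq_zeroE gr0I)
  then show ?thesis using that[of 0] assms by auto
qed

text \<open>Let \<open>r = s\<^sub>0(t)\<close> be outside \<open>P\<close>. If \<open>t\<close> satisfies no relation over \<open>A\<close> modulo \<open>P\<close>, choose a point of \<open>A\<close>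
  at which some coefficient of \<open>s\<^sub>0\<close> does not vanish and send \<open>t\<close> to a value that is not a root.

  Otherwise take a relation \<open>p\<close> of least degree, with leading coefficient \<open>l\<close>. Reducing modulo \<open>p\<close>
  shows that at every point of \<open>A\<close> with \<open>l \<noteq> 0\<close>, any root \<open>\<tau>\<close> of the image of \<open>p\<close> is a legitimate value
  for \<open>t\<close>. To keep \<open>r\<close> nonzero as well, find a multiple of \<open>r\<close> that is congruent modulo \<open>P\<close> to an
  element \<open>a\<close> of \<open>A\<close> outside \<open>P\<close>, and choose the point so that \<open>a\<close> does not vanish either. Such a
  multiple exists since a polynomial \<open>s\<close> of least degree whose value at \<open>t\<close> is a nonzero multiple of \<open>r\<close>
  must be constant: otherwise dividing \<open>p\<close> by \<open>s\<close> would produce a relation of degree smaller than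
  that of \<open>p\<close>.\<close>
lemma dense_points_adjoin:
  assumes A: "subalgebra A" and dense: "dense_points A"
  shows "dense_points (adjoin A t)"
  unfolding dense_points_def
proof
  fix r assume r: "r \<in> adjoin A t - P"
  note pA = polys_over_closed[OF A] and AD = subalgebraD[OF A]
  from r obtain s0 where s0: "s0 \<in> polys_over A" "r = poly s0 t" by (auto simp: adjoin_def)
  define rel where "rel p \<longleftrightarrow> p \<in> polys_over A \<and> poly p t \<in> P \<and> (\<exists>i. coeff p i \<notin> P)" for p
  \<comment> \<open>Dropping a leading coefficient in \<open>P\<close> changes neither the value at \<open>t\<close> nor any coefficient
    modulo \<open>P\<close>, so the polynomials of least degree below have leading coefficients outside \<open>P\<close>.\<close>
  have strip: "\<exists>q\<in>polys_over A. degree q < degree p \<and> poly p t - poly q t \<in> P \<and>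
      (\<forall>i. coeff p i - coeff q i \<in> P)"
    if "p \<in> polys_over A" "lead_coeff p \<in> P" "degree p > 0" for p
  proof (intro bexI conjI allI)
    let ?m = "monom (lead_coeff p) (degree p)"
    show "p - ?m \<in> polys_over A" using that by (intro pA) (auto simp: polys_over_def)
    have "degree (p - ?m) \<le> degree p" by (intro degree_diff_le degree_monom_le) auto
    moreover have "coeff (p - ?m) (degree p) = 0" by simp
    ultimately show "degree (p - ?m) < degree p"
      using that(3) by (metis degree_0 le_neq_implies_less leading_coeff_0_iff)
    show "poly p t - poly (p - ?m) t \<in> P"
      using that(2) by (simp add: poly_monom P_mult_right)
    show "coeff p i - coeff (p - ?m) i \<in> P" for i
      using that(2) by (auto simp: P_zero)
  qed
  show "\<exists>\<phi>. point (adjoin A t) \<phi> \<and> \<phi> r \<noteq> 0"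
  proof (cases "\<exists>p. rel p")
    case False
    then have tr: "\<forall>i. coeff p i \<in> P" if "p \<in> polys_over A" "poly p t \<in> P" for p
      using that by (auto simp: rel_def)
    from r s0 P_poly obtain i where i: "coeff s0 i \<notin> P" by blast
    moreover have "coeff s0 i \<in> A" using s0 by (auto simp: polys_over_def)
    ultimately obtain \<phi> where \<phi>: "point A \<phi>" "\<phi> (coeff s0 i) \<noteq> 0"
      using dense by (auto simp: dense_points_def)
    have "coeff (map_poly \<phi> s0) i \<noteq> 0" using \<phi> by (simp add: coeff_map_poly pointD[OF \<phi>(1) A])
    then have "map_poly \<phi> s0 \<noteq> 0" by auto
    then obtain \<tau> where \<tau>: "poly (map_poly \<phi> s0) \<tau> \<noteq> 0" using alg_closed_nonroot by blast
    obtain \<psi> where "point (adjoin A t) \<psi>"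
      and "\<And>p. p \<in> polys_over A \<Longrightarrow> \<psi> (poly p t) = poly (map_poly \<phi> p) \<tau>"
      using extend_point[OF \<phi>(1) A, of t \<tau>] tr map_poly_point(6)[OF \<phi>(1) A] by (metis poly_0)
    then show ?thesis using \<tau> s0 by auto
  next
    case True
    then obtain p where p: "rel p" and p_min: "\<And>g. degree g < degree p \<Longrightarrow> \<not> rel g"
      using exists_least_iff[of "\<lambda>d. \<exists>p. rel p \<and> degree p = d"] by metis
    have small: "coeff g i \<in> P" if "g \<in> polys_over A" "poly g t \<in> P" "degree g < degree p" for g i
      using p_min[OF that(3)] that by (auto simp: rel_def)
    have pP: "p \<in> polys_over A" "poly p t \<in> P" using p by (auto simp: rel_def)
    define l where "l = lead_coeff p"
    have lA: "l \<in> A" using pP by (auto simp: l_def polys_over_def)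
    have dp: "degree p > 0"
    proof (rule ccontr)
      assume "\<not> degree p > 0"
      then obtain a where a: "p = [:a:]" by (metis degree_eq_zeroE gr0I)
      then have "coeff p i \<in> P" for i
        using pP P_zero by (cases i) auto
      then show False using p by (auto simp: rel_def)
    qed
    have lP: "l \<notin> P"
    proof
      assume "l \<in> P"
      then obtain q where q: "q \<in> polys_over A" "degree q < degree p" "poly p t - poly q t \<in> P"
        "\<And>i. coeff p i - coeff q i \<in> P"
        using strip[OF pP(1)] dp by (auto simp: l_def)
      then have "coeff q i \<in> P" for i using small P_cong pP by blast
      then show False using p q(4) P_cong by (auto simp: rel_def)
    qed
    \<comment> \<open>Value at \<open>t\<close> nonzero and a multiple of \<open>r\<close>, both modulo \<open>P\<close>.\<close>
    define mult where "mult s \<longleftrightarrow> s \<in> polys_over A \<and> poly s t \<notin> P \<and>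
      (\<exists>u\<in>polys_over A. poly s t - r * poly u t \<in> P)" for s
    have "mult s0" using s0 r pA(2) P_zero by (auto simp: mult_def intro!: bexI[of _ 1])
    then obtain s where s: "mult s" and s_min: "\<And>g. degree g < degree s \<Longrightarrow> \<not> mult g"
      using exists_least_iff[of "\<lambda>d. \<exists>p. mult p \<and> degree p = d"] by metis
    from s obtain u where sP: "s \<in> polys_over A" "poly s t \<notin> P"
      and u: "u \<in> polys_over A" "poly s t - r * poly u t \<in> P"
      by (auto simp: mult_def)
    have ds: "degree s = 0"
    proof (rule ccontr)
      assume "degree s \<noteq> 0"
      then have ds: "degree s > 0" by simp
      define l' where "l' = lead_coeff s"
      have le: "degree s \<le> degree p"
      proof (rule ccontr)
        assume *: "\<not> degree s \<le> degree p"
        obtain k q w where qw: "q \<in> polys_over A" "w \<in> polys_over A"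
            "smult (l ^ k) s = p * q + w" "degree w < degree p"
          using pseudo_division_over[OF A pP(1) dp sP(1)] by (auto simp: l_def)
        have "l ^ k * poly s t = poly p t * poly q t + poly w t"
          using arg_cong[OF qw(3), of "\<lambda>f. poly f t"] by simp
        then have w: "l ^ k * poly s t - poly w t \<in> P" using pP(2) by (simp add: P_mult_right)
        then have "poly w t \<notin> P" using P_cong P_prime P_power lP sP(2) by blast
        moreover have "poly w t - r * poly (smult (l ^ k) u) t \<in> P"
        proof -
          have "poly w t - r * poly (smult (l ^ k) u) t =
              l ^ k * (poly s t - r * poly u t) - (l ^ k * poly s t - poly w t)"
            by (simp add: algebra_simps)
          then show ?thesis by (metis P_diff[OF P_mult[OF u(2)] w])
        qed
        ultimately have "mult w" using qw u by (auto simp: mult_def pA AD lA intro!: bexI[of _ "smult (l ^ k) u"])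
        then show False using s_min[of w] qw(4) * by simp
      qed
      obtain k q w where qw: "q \<in> polys_over A" "w \<in> polys_over A"
          "smult (l' ^ k) p = s * q + w" "degree w < degree s" "degree q \<le> degree p - degree s"
        using pseudo_division_over[OF A sP(1) ds pP(1)] by (auto simp: l'_def)
      have e: "l' ^ k * poly p t = poly s t * poly q t + poly w t"
        using arg_cong[OF qw(3), of "\<lambda>f. poly f t"] by simp
      have "poly w t - r * poly (- (u * q)) t \<in> P"
      proof -
        have "poly w t - r * poly (- (u * q)) t =
            l' ^ k * poly p t - (poly s t - r * poly u t) * poly q t"
          unfolding e by (simp add: algebra_simps)
        then show ?thesis by (metis P_diff[OF P_mult[OF pP(2)] P_mult_right[OF u(2)]])
      qed
      moreover have "- (u * q) \<in> polys_over A" using pA(8)[OF pA(1) pA(9)[OF u(1) qw(1)]] by simp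
      ultimately have wP: "poly w t \<in> P" using s_min[OF qw(4)] qw(2) unfolding mult_def by blast
      have "poly s t * poly q t \<in> P"
        using P_diff[OF P_mult[OF pP(2), of "l' ^ k"] wP] e by simp
      then have "poly q t \<in> P" using P_prime sP(2) by blast
      then have q: "coeff q i \<in> P" for i
        using small[OF qw(1)] qw(5) ds dp by simp
      have w: "coeff w i \<in> P" for i using small[OF qw(2) wP] qw(4) le by simp
      have "coeff (s * q + w) i \<in> P" for i
        by (auto simp: coeff_mult intro!: P_add P_sum P_mult q w)
      then have "l' ^ k * l \<in> P" unfolding qw(3)[symmetric] by (simp add: l_def)
      then have "l' \<in> P" using P_prime P_power lP by blast
      then obtain s' where s': "s' \<in> polys_over A" "degree s' < degree s" "poly s t - poly s' t \<in> P"
        using strip[OF sP(1)] ds by (auto simp: l'_def)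
      have "poly s' t - r * poly u t = (poly s t - r * poly u t) - (poly s t - poly s' t)" by simp
      then have "poly s' t - r * poly u t \<in> P" using P_diff[OF u(2) s'(3)] by simp
      then have "mult s'" using s' sP(2) P_cong u(1) by (auto simp: mult_def)
      then show False using s_min[OF s'(2)] by simp
    qed
    then obtain a where a: "s = [:a:]" by (metis degree_eq_zeroE)
    have aA: "a \<in> A" using sP(1) spec[of "\<lambda>i. coeff s i \<in> A" 0] by (simp add: polys_over_def a)
    have aP: "a \<notin> P" using sP(2) by (simp add: a)
    have "l * a \<in> A - P" using lA aA lP aP P_prime AD by blast
    then obtain \<phi> where \<phi>: "point A \<phi>" "\<phi> (l * a) \<noteq> 0"
      using dense by (auto simp: dense_points_def)
    note ptD = pointD[OF \<phi>(1) A] and mp = map_poly_point[OF \<phi>(1) A]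
    have \<phi>l: "\<phi> l \<noteq> 0" "\<phi> a \<noteq> 0" using \<phi>(2) by (auto simp: ptD lA aA)
    have "coeff (map_poly \<phi> p) (degree p) \<noteq> 0"
      using \<phi>l by (simp add: coeff_map_poly ptD l_def)
    then have "degree (map_poly \<phi> p) > 0" using dp le_degree by fastforce
    then obtain \<tau> where \<tau>: "poly (map_poly \<phi> p) \<tau> = 0" using alg_closed_imp_poly_has_root by blast
    have vanish: "poly (map_poly \<phi> g) \<tau> = 0" if g: "g \<in> polys_over A" "poly g t \<in> P" for g
    proof -
      obtain k q w where qw: "q \<in> polys_over A" "w \<in> polys_over A"
          "smult (l ^ k) g = p * q + w" "degree w < degree p"
        using pseudo_division_over[OF A pP(1) dp g(1)] by (auto simp: l_def)
      have e: "l ^ k * poly g t = poly p t * poly q t + poly w t"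
        using arg_cong[OF qw(3), of "\<lambda>f. poly f t"] by simp
      have "poly w t \<in> P"
        using P_diff[OF P_mult[OF g(2), of "l ^ k"] P_mult_right[OF pP(2), of "poly q t"]] e by simp
      then have "map_poly \<phi> w = 0" using small[OF qw(2) _ qw(4)] by (intro mp(6) qw(2)) auto
      then have "smult (\<phi> (l ^ k)) (map_poly \<phi> g) = map_poly \<phi> p * map_poly \<phi> q"
        using arg_cong[OF qw(3), of "map_poly \<phi>"] by (simp add: mp pA AD lA g pP qw(1,2))
      from arg_cong[OF this, of "\<lambda>f. poly f \<tau>"] show ?thesis
        using \<phi>l \<tau> by (simp add: ptD lA)
    qed
    obtain \<psi> where \<psi>: "point (adjoin A t) \<psi>"
      "\<And>p. p \<in> polys_over A \<Longrightarrow> \<psi> (poly p t) = poly (map_poly \<phi> p) \<tau>"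
      using extend_point[OF \<phi>(1) A vanish] by blast
    have "poly (map_poly \<phi> (s - s0 * u)) \<tau> = 0"
      by (rule vanish) (use u sP s0 in \<open>auto simp: pA\<close>)
    then have "\<phi> a = poly (map_poly \<phi> s0) \<tau> * poly (map_poly \<phi> u) \<tau>"
      using sP(1) by (simp add: mp pA u s0 a)
    then have "\<psi> r \<noteq> 0" using \<phi>l(2) by (auto simp: s0 \<psi>(2))
    then show ?thesis using \<psi>(1) by blast
  qed
qed

text \<open>Hilbert's Nullstellensatz in the form that is used here: on a finitely generated algebra modulo a
  prime ideal, an element that vanishes at every point is zero.\<close>
theorem dense_points_generated: "dense_points (generated_algebra ts)"
proof (induction ts)
  case Nil
  have inj: "k = k'" if "\<iota> k = \<iota> k'" for k k'
  proof (rule ccontr)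
    assume "k \<noteq> k'"
    then have "1 = \<iota> (inverse (k - k')) * \<iota> (k - k')" by (simp add: iota_one flip: iota_mult)
    also have "\<iota> (k - k') = 0"
      using iota_add[of k "- k'"] iota_minus[of k'] that by simp
    finally show False using P_one P_zero by simp
  qed
  have P0: "k = 0" if "\<iota> k \<in> P" for k
  proof (rule ccontr)
    assume "k \<noteq> 0"
    then have "1 = \<iota> (inverse k) * \<iota> k" by (simp add: iota_one flip: iota_mult)
    then show False using P_mult[OF that] P_one by metis
  qed
  have \<phi>: "inv_into UNIV \<iota> (\<iota> k) = k" for k using inj by (intro inv_into_f_f injI) auto
  have "point (range \<iota>) (inv_into UNIV \<iota>)"
    unfolding point_def using P0 by (auto simp: \<phi> simp flip: iota_add iota_mult)
  then show ?case
    unfolding dense_points_def generated_algebra.simps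
    by (intro ballI exI[of _ "inv_into UNIV \<iota>"]) (use P_zero iota_zero in \<open>auto simp: \<phi>\<close>)
next
  case (Cons t ts)
  then show ?case by (simp add: dense_points_adjoin subalgebra_generated)
qed

end

section \<open>Finitely generated modules over a commutative algebra\<close>

text \<open>A module over a commutative ring that is given as a type, on an abelian group that is given by a
  carrier set. This mixture lets type-class polynomials act on the modules of the theorem.\<close>
locale ring_action = scalar_embedding \<iota> + abelian_group V
  for \<iota> :: "'k::alg_closed_field \<Rightarrow> 'r::comm_ring_1" and V :: "('v, 'z) ring_scheme" (structure) +
  fixes act :: "'r \<Rightarrow> 'v \<Rightarrow> 'v"
  assumes act_closed [simp, intro]: "v \<in> carrier V \<Longrightarrow> act r v \<in> carrier V"
    and act_add_left: "v \<in> carrier V \<Longrightarrow> act (r + s) v = act r v \<oplus> act s v"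
    and act_add_right: "v \<in> carrier V \<Longrightarrow> w \<in> carrier V \<Longrightarrow> act r (v \<oplus> w) = act r v \<oplus> act r w"
    and act_mult: "v \<in> carrier V \<Longrightarrow> act (r * s) v = act r (act s v)"
    and act_one: "v \<in> carrier V \<Longrightarrow> act 1 v = v"
begin

lemma act_zero_left: "v \<in> carrier V \<Longrightarrow> act 0 v = \<zero>"
  using act_add_left[of v 0 0] by simp

lemma act_zero_right: "act r \<zero> = \<zero>"
  using act_add_right[of \<zero> \<zero> r] by simp

lemma act_diff: "v \<in> carrier V \<Longrightarrow> act (r - s) v = act r v \<ominus> act s v"
  using act_add_left[of v "r - s" s] by (simp add: a_minus_def add.m_assoc r_neg)

definition lin_span :: "'r set \<Rightarrow> ('i \<Rightarrow> 'v) \<Rightarrow> 'i set \<Rightarrow> 'v set" where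
  "lin_span C w I = {(\<Oplus>i\<in>I. act (r i) (w i)) | r. \<forall>i\<in>I. r i \<in> C}"

lemma lin_spanI: "(\<And>i. i \<in> I \<Longrightarrow> r i \<in> C) \<Longrightarrow> (\<Oplus>i\<in>I. act (r i) (w i)) \<in> lin_span C w I"
  by (auto simp: lin_span_def)

context
  fixes C :: "'r set" and w :: "'i \<Rightarrow> 'v" and I :: "'i set"
  assumes C: "subalgebra C" and w: "\<And>i. i \<in> I \<Longrightarrow> w i \<in> carrier V" and I: "finite I"
begin

lemma lin_span_closed: "lin_span C w I \<subseteq> carrier V"
  using w by (auto simp: lin_span_def intro!: finsum_closed)

lemma lin_span_zero: "\<zero> \<in> lin_span C w I"
proof -
  have "(\<Oplus>i\<in>I. act 0 (w i)) \<in> lin_span C w I"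
    by (rule lin_spanI) (simp add: subalgebraD[OF C])
  also have "(\<Oplus>i\<in>I. act 0 (w i)) = (\<Oplus>i\<in>I. \<zero>)"
    by (rule finsum_cong') (auto simp: act_zero_left w)
  finally show ?thesis by simp
qed

lemma lin_span_add:
  assumes "x \<in> lin_span C w I" "y \<in> lin_span C w I"
  shows "x \<oplus> y \<in> lin_span C w I"
proof -
  obtain r s where rs: "\<And>i. i \<in> I \<Longrightarrow> r i \<in> C" "\<And>i. i \<in> I \<Longrightarrow> s i \<in> C"
    "x = (\<Oplus>i\<in>I. act (r i) (w i))" "y = (\<Oplus>i\<in>I. act (s i) (w i))"
    using assms by (auto simp: lin_span_def)
  have "x \<oplus> y = (\<Oplus>i\<in>I. act (r i) (w i) \<oplus> act (s i) (w i))"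
    unfolding rs by (rule finsum_addf[symmetric]) (auto simp: w)
  also have "\<dots> = (\<Oplus>i\<in>I. act (r i + s i) (w i))"
    by (rule finsum_cong') (auto simp: act_add_left w)
  finally show ?thesis by (auto intro!: lin_spanI subalgebraD[OF C] rs)
qed

lemma lin_span_generator:
  assumes "i \<in> I"
  shows "w i \<in> lin_span C w I"
proof -
  have "(\<Oplus>j\<in>I. act (if i = j then 1 else 0) (w j)) \<in> lin_span C w I"
    by (rule lin_spanI) (simp add: subalgebraD[OF C])
  also have "(\<Oplus>j\<in>I. act (if i = j then 1 else 0) (w j)) = (\<Oplus>j\<in>I. if i = j then w j else \<zero>)"
    by (rule finsum_cong') (auto simp: act_zero_left act_one w)
  also have "\<dots> = w i" by (rule finsum_singleton) (use assms I w in auto)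
  finally show ?thesis .
qed

end

lemma additive_finsum:
  assumes "\<And>v. v \<in> carrier V \<Longrightarrow> F v \<in> carrier V"
    and "\<And>v v'. v \<in> carrier V \<Longrightarrow> v' \<in> carrier V \<Longrightarrow> F (v \<oplus> v') = F v \<oplus> F v'"
    and "finite I" and "\<And>i. i \<in> I \<Longrightarrow> w i \<in> carrier V"
  shows "F (\<Oplus>i\<in>I. w i) = (\<Oplus>i\<in>I. F (w i))"
  using assms(3,4)
proof (induction I)
  case empty
  show ?case using assms(1)[of \<zero>] assms(2)[of \<zero> \<zero>] by simp
qed (simp add: assms Pi_def)

lemma lin_span_act:
  assumes C: "subalgebra C" and w: "\<And>i. i \<in> I \<Longrightarrow> w i \<in> carrier V" and I: "finite I"
    and c: "c \<in> C" and x: "x \<in> lin_span C w I"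
  shows "act c x \<in> lin_span C w I"
proof -
  obtain r where r: "\<And>i. i \<in> I \<Longrightarrow> r i \<in> C" "x = (\<Oplus>i\<in>I. act (r i) (w i))"
    using x by (auto simp: lin_span_def)
  have "act c x = (\<Oplus>i\<in>I. act c (act (r i) (w i)))"
    unfolding r by (rule additive_finsum) (auto simp: I w act_add_right)
  also have "\<dots> = (\<Oplus>i\<in>I. act (c * r i) (w i))"
    by (rule finsum_cong') (auto simp: act_mult w)
  finally show ?thesis by (auto intro!: lin_spanI subalgebraD[OF C] r c)
qed

lemma lin_span_insertE:
  assumes "x \<in> lin_span C w (insert i I)" "finite I" "i \<notin> I" "\<And>j. j \<in> insert i I \<Longrightarrow> w j \<in> carrier V"
  obtains a y where "a \<in> C" "y \<in> lin_span C w I" "x = act a (w i) \<oplus> y"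
proof -
  obtain r where r: "\<And>j. j \<in> insert i I \<Longrightarrow> r j \<in> C" "x = (\<Oplus>j\<in>insert i I. act (r j) (w j))"
    using assms(1) by (auto simp: lin_span_def)
  have "x = act (r i) (w i) \<oplus> (\<Oplus>j\<in>I. act (r j) (w j))"
    unfolding r using assms by (intro finsum_insert) auto
  moreover have "(\<Oplus>j\<in>I. act (r j) (w j)) \<in> lin_span C w I" using r(1) by (intro lin_spanI) auto
  ultimately show ?thesis using r(1) that by blast
qed

text \<open>If \<open>f\<close> lies in the kernel of \<open>\<phi>\<close> and maps \<open>V\<close> onto itself, then an element outside the kernel
  annihilates \<open>V\<close>. The generators are removed one at a time: writing \<open>w i = f u\<close> and expanding \<open>s u\<close> in the
  generators gives \<open>(s - f a) w i\<close> as a combination of the others, and \<open>s - f a\<close> has the same value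
  under \<open>\<phi>\<close> as \<open>s\<close>. The multiplier \<open>s\<close> takes the place of localisation at the kernel of \<open>\<phi>\<close>.\<close>
lemma nakayama:
  assumes A: "subalgebra A"
    and \<phi>: "\<And>a b. a \<in> A \<Longrightarrow> b \<in> A \<Longrightarrow> \<phi> (a - b) = \<phi> a - \<phi> b"
      "\<And>a b. a \<in> A \<Longrightarrow> b \<in> A \<Longrightarrow> \<phi> (a * b) = \<phi> a * (\<phi> b :: 'k)"
    and f: "f \<in> A" "\<phi> f = 0" "carrier V \<subseteq> act f ` carrier V"
    and I: "finite I" and w: "\<And>i. i \<in> I \<Longrightarrow> w i \<in> carrier V"
    and s: "s \<in> A" "\<phi> s \<noteq> 0" "\<And>v. v \<in> carrier V \<Longrightarrow> act s v \<in> lin_span A w I"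
  shows "\<exists>s\<in>A. \<phi> s \<noteq> 0 \<and> (\<forall>v\<in>carrier V. act s v = \<zero>)"
  using I w s
proof (induction I arbitrary: s)
  case empty
  then show ?case by (auto simp: lin_span_def)
next
  case (insert i I)
  note AD = subalgebraD[OF A]
  have wi: "w i \<in> carrier V" and wI: "\<And>j. j \<in> I \<Longrightarrow> w j \<in> carrier V" using insert.prems by auto
  have cl: "lin_span A w I \<subseteq> carrier V" by (rule lin_span_closed[OF A wI insert.hyps(1)])
  obtain u where u: "u \<in> carrier V" "w i = act f u" using f(3) wi by auto
  obtain a y where ay: "a \<in> A" "y \<in> lin_span A w I" "act s u = act a (w i) \<oplus> y"
    using lin_span_insertE[OF insert.prems(4)[OF u(1)] insert.hyps] insert.prems(1) by metis
  have yV: "y \<in> carrier V" using ay cl by auto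
  define s' where "s' = s - f * a"
  have s'A: "s' \<in> A" using insert.prems f ay by (auto simp: s'_def AD)
  have \<phi>s': "\<phi> s' = \<phi> s" using insert.prems f ay by (simp add: s'_def AD \<phi>)
  have "act s (w i) = act f (act s u)" using u by (simp add: act_mult[symmetric] mult.commute)
  also have "\<dots> = act (f * a) (w i) \<oplus> act f y"
    by (simp add: ay(3) act_add_right act_mult wi yV)
  finally have "act s' (w i) = act f y"
    using wi yV by (simp add: s'_def act_diff a_minus_def a_ac r_neg)
  then have s'w: "act s' (w i) \<in> lin_span A w I"
    using lin_span_act[OF A wI insert.hyps(1) f(1) ay(2)] by simp
  have "act (s' * s) v \<in> lin_span A w I" if v: "v \<in> carrier V" for v
  proof -
    obtain b z where bz: "b \<in> A" "z \<in> lin_span A w I" "act s v = act b (w i) \<oplus> z"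
      using lin_span_insertE[OF insert.prems(4)[OF v] insert.hyps] insert.prems(1) by metis
    have zV: "z \<in> carrier V" using bz cl by auto
    have "act (s' * s) v = act (s' * b) (w i) \<oplus> act s' z"
      using wi zV v by (simp add: act_mult bz(3) act_add_right)
    also have "act (s' * b) (w i) = act b (act s' (w i))"
      using wi by (simp add: act_mult[symmetric] mult.commute)
    finally show ?thesis
      using lin_span_act[OF A wI insert.hyps(1)] s'w bz s'A
      by (auto intro!: lin_span_add[OF A wI insert.hyps(1)])
  qed
  then show ?case
    using insert.IH[of "s' * s"] wI s'A insert.prems \<phi>s' by (simp add: AD \<phi>)
qed

text \<open>Because each element acts as zero or surjectively, the annihilator of \<open>V\<close> is prime, so it has a
  point \<open>\<phi>\<close>. For \<open>a\<close> in the algebra, \<open>a - \<phi>(a)\<close> lies in the kernel of \<open>\<phi>\<close>. Were it surjective on \<open>V\<close>, some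
  element with a nonzero value would annihilate \<open>V\<close>, although \<open>\<phi>\<close> vanishes on the annihilator.
  Hence \<open>a - \<phi>(a)\<close> acts as zero.\<close>
theorem finitely_generated_acts_by_scalars:
  assumes nonzero: "carrier V \<noteq> {\<zero>}"
    and zero_or_onto: "\<And>r. (\<forall>v\<in>carrier V. act r v = \<zero>) \<or> carrier V \<subseteq> act r ` carrier V"
    and I: "finite I" and w: "\<And>i. i \<in> I \<Longrightarrow> w i \<in> carrier V"
    and span: "carrier V \<subseteq> lin_span (generated_algebra ts) w I"
  obtains \<phi> where "\<And>a v. a \<in> generated_algebra ts \<Longrightarrow> v \<in> carrier V \<Longrightarrow> act a v = act (\<iota> (\<phi> a)) v"
proof -
  define P where "P = {r. \<forall>v\<in>carrier V. act r v = \<zero>}"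
  interpret algebra_with_prime \<iota> P
  proof
    fix a b assume ab: "a * b \<in> P"
    show "a \<in> P \<or> b \<in> P"
    proof (rule disjCI)
      assume "b \<notin> P"
      then have b: "carrier V \<subseteq> act b ` carrier V" using zero_or_onto[of b] by (auto simp: P_def)
      have "act a v = \<zero>" if v: "v \<in> carrier V" for v
      proof -
        obtain u where "u \<in> carrier V" "v = act b u" using b v by auto
        then show ?thesis using ab by (simp add: P_def flip: act_mult)
      qed
      then show "a \<in> P" by (simp add: P_def)
    qed
  next
    show "1 \<notin> P" using nonzero by (auto simp: P_def act_one)
  qed (auto simp: P_def act_add_left act_mult act_zero_right act_zero_left)
  let ?A = "generated_algebra ts"
  note A = subalgebra_generated[of ts]
  note AD = subalgebraD[OF A]
  obtain \<phi> where \<phi>: "point ?A \<phi>"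
    using dense_points_generated[of ts] AD(3) P_one by (auto simp: dense_points_def)
  note ptD = pointD[OF \<phi> A]
  have "act a v = act (\<iota> (\<phi> a)) v" if a: "a \<in> ?A" and v: "v \<in> carrier V" for a v
  proof -
    define f where "f = a - \<iota> (\<phi> a)"
    have f: "f \<in> ?A" "\<phi> f = 0" using a by (auto simp: f_def AD ptD)
    have "\<not> carrier V \<subseteq> act f ` carrier V"
    proof
      assume onto: "carrier V \<subseteq> act f ` carrier V"
      have one: "act 1 u \<in> lin_span ?A w I" if "u \<in> carrier V" for u
        using span that by (auto simp: act_one)
      have "\<exists>s\<in>?A. \<phi> s \<noteq> 0 \<and> (\<forall>v\<in>carrier V. act s v = \<zero>)"
        by (rule nakayama[OF A ptD(7,2) f onto I w AD(3) _ one]) (simp_all add: ptD)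
      then obtain s where "s \<in> ?A" "\<phi> s \<noteq> 0" "s \<in> P" by (auto simp: P_def)
      then show False using ptD(6) by blast
    qed
    then have "act f v = \<zero>" using zero_or_onto[of f] v by blast
    then show ?thesis using act_add_left[OF v, of f "\<iota> (\<phi> a)"] v by (simp add: f_def)
  qed
  then show ?thesis using that by blast
qed

end

section \<open>Left modules\<close>

context left_module
begin

lemma smult_zero_left [simp]: "m \<in> carrier M \<Longrightarrow> \<zero>\<^bsub>R\<^esub> \<odot>\<^bsub>M\<^esub> m = \<zero>\<^bsub>M\<^esub>"
  using smult_l_distr[of "\<zero>\<^bsub>R\<^esub>" "\<zero>\<^bsub>R\<^esub>" m] by simp

lemma smult_zero_right [simp]: "r \<in> carrier R \<Longrightarrow> r \<odot>\<^bsub>M\<^esub> \<zero>\<^bsub>M\<^esub> = \<zero>\<^bsub>M\<^esub>"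
  using smult_r_distr[of r "\<zero>\<^bsub>M\<^esub>" "\<zero>\<^bsub>M\<^esub>"] by simp

lemma smult_minus_one: "m \<in> carrier M \<Longrightarrow> (\<ominus>\<^bsub>R\<^esub> \<one>\<^bsub>R\<^esub>) \<odot>\<^bsub>M\<^esub> m = \<ominus>\<^bsub>M\<^esub> m"
  using smult_l_distr[of "\<ominus>\<^bsub>R\<^esub> \<one>\<^bsub>R\<^esub>" "\<one>\<^bsub>R\<^esub>" m] M.minus_equality[of "(\<ominus>\<^bsub>R\<^esub> \<one>\<^bsub>R\<^esub>) \<odot>\<^bsub>M\<^esub> m" m]
  by (simp add: R.l_neg)

lemma submoduleI:
  assumes "W \<subseteq> carrier M" "\<zero>\<^bsub>M\<^esub> \<in> W"
    and "\<And>v w. v \<in> W \<Longrightarrow> w \<in> W \<Longrightarrow> v \<oplus>\<^bsub>M\<^esub> w \<in> W"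
    and smult: "\<And>r w. r \<in> carrier R \<Longrightarrow> w \<in> W \<Longrightarrow> r \<odot>\<^bsub>M\<^esub> w \<in> W"
  shows "submodule W R M"
proof (intro submodule.intro subgroup.intro submodule_axioms.intro)
  fix w assume w: "w \<in> W"
  have "\<ominus>\<^bsub>M\<^esub> w \<in> W" using smult[of "\<ominus>\<^bsub>R\<^esub> \<one>\<^bsub>R\<^esub>" w] w assms(1) smult_minus_one[of w] by auto
  then show "inv\<^bsub>add_monoid M\<^esub> w \<in> W" by (simp add: a_inv_def)
qed (use assms in auto)

lemma cyclic_submodule:
  assumes w: "w \<in> carrier M"
  shows "submodule ((\<lambda>r. r \<odot>\<^bsub>M\<^esub> w) ` carrier R) R M"
proof (rule submoduleI)
  show "\<zero>\<^bsub>M\<^esub> \<in> (\<lambda>r. r \<odot>\<^bsub>M\<^esub> w) ` carrier R"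
    using w by (intro image_eqI[of _ _ "\<zero>\<^bsub>R\<^esub>"]) auto
  show "u \<oplus>\<^bsub>M\<^esub> v \<in> (\<lambda>r. r \<odot>\<^bsub>M\<^esub> w) ` carrier R"
    if "u \<in> (\<lambda>r. r \<odot>\<^bsub>M\<^esub> w) ` carrier R" "v \<in> (\<lambda>r. r \<odot>\<^bsub>M\<^esub> w) ` carrier R" for u v
    using that w by (auto simp flip: smult_l_distr)
  show "r \<odot>\<^bsub>M\<^esub> v \<in> (\<lambda>r. r \<odot>\<^bsub>M\<^esub> w) ` carrier R"
    if "r \<in> carrier R" "v \<in> (\<lambda>r. r \<odot>\<^bsub>M\<^esub> w) ` carrier R" for r v
    using that w by (auto simp flip: smult_assoc1)
qed (use w in auto)

lemma smult_finsum:
  assumes "r \<in> carrier R" "finite I" "\<And>i. i \<in> I \<Longrightarrow> f i \<in> carrier M"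
  shows "r \<odot>\<^bsub>M\<^esub> (\<Oplus>\<^bsub>M\<^esub>i\<in>I. f i) = (\<Oplus>\<^bsub>M\<^esub>i\<in>I. r \<odot>\<^bsub>M\<^esub> f i)"
  using assms(2,3)
  by (induction I) (use assms(1) in \<open>simp_all add: M.finsum_insert Pi_def smult_r_distr\<close>)

lemma simple_generated:
  assumes "simple_module R M" "w \<in> carrier M" "w \<noteq> \<zero>\<^bsub>M\<^esub>" "v \<in> carrier M"
  obtains r where "r \<in> carrier R" "v = r \<odot>\<^bsub>M\<^esub> w"
proof -
  have "w \<in> (\<lambda>r. r \<odot>\<^bsub>M\<^esub> w) ` carrier R"
    using assms(2) by (intro image_eqI[of _ _ "\<one>\<^bsub>R\<^esub>"]) auto
  then have "(\<lambda>r. r \<odot>\<^bsub>M\<^esub> w) ` carrier R = carrier M"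
    using assms(1,3) cyclic_submodule[OF assms(2)] by (auto simp: simple_module_def)
  then show ?thesis using that assms(4) by blast
qed

end

section \<open>The group and the kernel of the character\<close>

locale skew_setup =
  fixes G :: "('g, 'm) monoid_scheme" and \<chi> \<eta> :: "'g \<Rightarrow> 'k::alg_closed_field"
    and c :: 'g and n :: nat
  assumes comm_group: "comm_group G"
    and c [simp]: "c \<in> carrier G"
    and \<chi>: "\<chi> \<in> carrier (char_group G)" and \<eta>: "\<eta> \<in> carrier (char_group G)"
    and prim: "primitive_root_of_unity n (\<chi> c)"
    and image: "\<chi> ` carrier G = generate Kunits {\<chi> c}"
begin

sublocale G: comm_group G by (rule comm_group)

abbreviation "H \<equiv> skew_group_ring G \<chi> \<eta>"
abbreviation "N \<equiv> char_kernel G \<chi>"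

lemma chi: "g \<in> carrier G \<Longrightarrow> \<chi> g \<noteq> 0"
    "g \<in> carrier G \<Longrightarrow> h \<in> carrier G \<Longrightarrow> \<chi> (g \<otimes>\<^bsub>G\<^esub> h) = \<chi> g * \<chi> h" "\<chi> \<one>\<^bsub>G\<^esub> = 1"
  and eta: "g \<in> carrier G \<Longrightarrow> \<eta> g \<noteq> 0"
    "g \<in> carrier G \<Longrightarrow> h \<in> carrier G \<Longrightarrow> \<eta> (g \<otimes>\<^bsub>G\<^esub> h) = \<eta> g * \<eta> h" "\<eta> \<one>\<^bsub>G\<^esub> = 1"
  using char_groupD[OF \<chi>] char_groupD[OF \<eta>] char_group_one[OF \<chi>] char_group_one[OF \<eta>]
  by (auto intro: G.group_axioms)

lemma n_pos: "n > 0" and q_pow_n: "\<chi> c ^ n = 1"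
  using prim by (auto simp: primitive_root_of_unity_def)

lemma chi_pow: "\<chi> (c [^]\<^bsub>G\<^esub> (k::nat)) = \<chi> c ^ k"
  by (induction k) (auto simp: chi)

lemma q_pow_eq_1: "\<chi> c ^ k = 1 \<longleftrightarrow> n dvd k"
proof
  assume "\<chi> c ^ k = 1"
  moreover have "\<chi> c ^ k = (\<chi> c ^ n) ^ (k div n) * \<chi> c ^ (k mod n)"
    by (simp flip: power_mult power_add)
  ultimately have "\<chi> c ^ (k mod n) = 1" by (simp add: q_pow_n)
  then have "k mod n = 0"
    using prim n_pos unfolding primitive_root_of_unity_def by (metis mod_less_divisor gr0I)
  then show "n dvd k" by auto
qed (auto simp: power_mult q_pow_n)

lemma q_pow_inj:
  assumes "i < n" "j < n" "\<chi> c ^ i = \<chi> c ^ j"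
  shows "i = j"
proof -
  have *: "a = b" if "a \<le> b" "b < n" "\<chi> c ^ a = \<chi> c ^ b" for a b
  proof -
    have "\<chi> c ^ b = \<chi> c ^ a * \<chi> c ^ (b - a)" using that(1) by (simp flip: power_add)
    then have "\<chi> c ^ (b - a) = 1" using that chi(1)[OF c] by simp
    then have "n dvd b - a" by (simp add: q_pow_eq_1)
    then show ?thesis using that by (auto dest: dvd_imp_le)
  qed
  show ?thesis using *[of i j] *[of j i] assms by (cases "i \<le> j") auto
qed

lemma N_iff: "h \<in> N \<longleftrightarrow> h \<in> carrier G \<and> \<chi> h = 1"
  by (auto simp: kernel_def Kunits_def)

lemma N_carrier: "h \<in> N \<Longrightarrow> h \<in> carrier G" and N_chi: "h \<in> N \<Longrightarrow> \<chi> h = 1"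
  by (simp_all add: N_iff)

lemma c_pow_n_in_N: "c [^]\<^bsub>G\<^esub> n \<in> N"
  by (simp add: N_iff chi_pow q_pow_n)

lemma subgroup_N: "subgroup N G"
proof (rule G.subgroupI)
  fix h assume h: "h \<in> N"
  then have "\<chi> (inv\<^bsub>G\<^esub> h) * \<chi> h = 1" by (simp add: N_carrier chi flip: chi(2))
  then show "inv\<^bsub>G\<^esub> h \<in> N" using h by (simp add: N_iff)
next
  have "\<one>\<^bsub>G\<^esub> \<in> N" by (simp add: N_iff chi)
  then show "N \<noteq> {}" by auto
qed (auto simp: N_iff chi)

text \<open>The value of \<open>\<chi>\<close> at \<open>g\<close> is a power \<open>q\<^sup>i\<close> because \<open>q = \<chi>(c)\<close> generates the image of \<open>\<chi>\<close>; dividing \<open>g\<close> by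
  \<open>c\<^sup>i\<close> leaves an element of the kernel.\<close>
lemma coset_decomposition:
  assumes g: "g \<in> carrier G"
  obtains i h where "i < n" "h \<in> N" "g = c [^]\<^bsub>G\<^esub> i \<otimes>\<^bsub>G\<^esub> h"
proof -
  have "\<chi> g \<in> generate Kunits {\<chi> c}" using image g by blast
  then obtain i where i: "i < n" "\<chi> g = \<chi> c ^ i"
    using powers_of_root_of_unity[OF prim] by blast
  define h where "h = inv\<^bsub>G\<^esub> (c [^]\<^bsub>G\<^esub> i) \<otimes>\<^bsub>G\<^esub> g"
  have g_eq: "g = c [^]\<^bsub>G\<^esub> i \<otimes>\<^bsub>G\<^esub> h" using g by (simp add: h_def G.m_assoc[symmetric])
  have hG: "h \<in> carrier G" using g by (simp add: h_def)
  have "\<chi> g = \<chi> c ^ i * \<chi> h" using g_eq hG by (metis G.nat_pow_closed c chi(2) chi_pow)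
  then have "h \<in> N" using i hG chi(1)[OF c] by (simp add: N_iff)
  then show ?thesis using that i g_eq by blast
qed

lemma chi_pow_n: "g \<in> carrier G \<Longrightarrow> \<chi> g ^ n = 1"
  by (erule coset_decomposition)
    (simp add: chi chi_pow N_iff flip: power_mult, simp add: power_mult mult.commute[of _ n] q_pow_n)

text \<open>Each generator of \<open>G\<close> is \<open>c\<^sup>i h\<close> with \<open>h \<in> N\<close>. The elements \<open>h\<close> obtained in this way, together with \<open>c\<^sup>n\<close>,
  generate \<open>N\<close>: modulo the subgroup they generate, every element of \<open>G\<close> is a power \<open>c\<^sup>k\<close>, and it lies
  in \<open>N\<close> only if \<open>n\<close> divides \<open>k\<close>.\<close>
lemma N_finitely_generated:
  assumes fg: "finitely_generated G"
  obtains T where "finite T" "T \<subseteq> N" "N \<subseteq> generate G T"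
proof -
  obtain S where S: "finite S" "S \<subseteq> carrier G" "generate G S = carrier G"
    using fg by (auto simp: finitely_generated_def)
  have "\<exists>h\<in>N. \<exists>i. s = c [^]\<^bsub>G\<^esub> (i::nat) \<otimes>\<^bsub>G\<^esub> h" if "s \<in> S" for s
    using coset_decomposition[of s] that S(2) by (metis subsetD)
  then obtain t where t: "\<And>s. s \<in> S \<Longrightarrow> t s \<in> N \<and> (\<exists>i. s = c [^]\<^bsub>G\<^esub> (i::nat) \<otimes>\<^bsub>G\<^esub> t s)"
    by metis
  define T where "T = insert (c [^]\<^bsub>G\<^esub> n) (t ` S)"
  have T: "finite T" "T \<subseteq> N" using S t by (auto simp: T_def c_pow_n_in_N)
  have TG: "T \<subseteq> carrier G" using T(2) N_carrier by auto
  interpret T: subgroup "generate G T" G by (rule G.generate_is_subgroup[OF TG])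
  have TiG: "u \<in> generate G T \<Longrightarrow> u \<in> carrier G" for u by (rule T.mem_carrier)
  have pow: "(c [^]\<^bsub>G\<^esub> n) [^]\<^bsub>G\<^esub> (k::nat) \<in> generate G T" for k
  proof (induction k)
    case (Suc k)
    then show ?case using generate.incl[of "c [^]\<^bsub>G\<^esub> n" T G] by (simp add: T_def generate.eng)
  qed (simp add: generate.one)
  have tT: "t s \<in> generate G T" if "s \<in> S" for s using that by (auto simp: T_def intro: generate.incl)
  have inv_dec: "\<exists>k::nat. \<exists>u\<in>generate G T. inv\<^bsub>G\<^esub> (c [^]\<^bsub>G\<^esub> i \<otimes>\<^bsub>G\<^esub> v) = c [^]\<^bsub>G\<^esub> k \<otimes>\<^bsub>G\<^esub> u"
    if v: "v \<in> generate G T" for i :: nat and v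
  proof -
    let ?d = "(c [^]\<^bsub>G\<^esub> n) [^]\<^bsub>G\<^esub> i"
    \<comment> \<open>The inverse of \<open>c\<^sup>i\<close> is a nonnegative power of \<open>c\<close> up to a power of \<open>c\<^sup>n\<close>, so natural
      exponents suffice.\<close>
    have le: "i \<le> n * i" using n_pos by simp
    have "c [^]\<^bsub>G\<^esub> (n * i - i) \<otimes>\<^bsub>G\<^esub> c [^]\<^bsub>G\<^esub> i = ?d"
      by (simp add: G.nat_pow_mult G.nat_pow_pow le)
    then have "c [^]\<^bsub>G\<^esub> (n * i - i) = ?d \<otimes>\<^bsub>G\<^esub> inv\<^bsub>G\<^esub> (c [^]\<^bsub>G\<^esub> i)"
      by (simp add: G.inv_solve_right)
    then have "inv\<^bsub>G\<^esub> (c [^]\<^bsub>G\<^esub> i) = c [^]\<^bsub>G\<^esub> (n * i - i) \<otimes>\<^bsub>G\<^esub> inv\<^bsub>G\<^esub> ?d"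
      by (simp add: G.m_ac)
    then have "inv\<^bsub>G\<^esub> (c [^]\<^bsub>G\<^esub> i \<otimes>\<^bsub>G\<^esub> v) = c [^]\<^bsub>G\<^esub> (n * i - i) \<otimes>\<^bsub>G\<^esub> (inv\<^bsub>G\<^esub> ?d \<otimes>\<^bsub>G\<^esub> inv\<^bsub>G\<^esub> v)"
      using TiG[OF v] by (simp add: G.inv_mult G.m_assoc)
    moreover have "inv\<^bsub>G\<^esub> ?d \<otimes>\<^bsub>G\<^esub> inv\<^bsub>G\<^esub> v \<in> generate G T" using pow v by simp
    ultimately show ?thesis by blast
  qed
  have dec: "\<exists>k::nat. \<exists>u\<in>generate G T. g = c [^]\<^bsub>G\<^esub> k \<otimes>\<^bsub>G\<^esub> u" if "g \<in> generate G S" for g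
    using that
  proof induction
    case one
    show ?case by (intro exI[of _ 0] bexI[of _ "\<one>\<^bsub>G\<^esub>"]) auto
  next
    case (incl s)
    then show ?case using t tT by blast
  next
    case (inv s)
    then show ?case using t tT inv_dec by metis
  next
    case (eng g g')
    then obtain k k' :: nat and u u' where
      "u \<in> generate G T" "g = c [^]\<^bsub>G\<^esub> k \<otimes>\<^bsub>G\<^esub> u" "u' \<in> generate G T" "g' = c [^]\<^bsub>G\<^esub> k' \<otimes>\<^bsub>G\<^esub> u'"
      by blast
    moreover from this have "g \<otimes>\<^bsub>G\<^esub> g' = c [^]\<^bsub>G\<^esub> (k + k') \<otimes>\<^bsub>G\<^esub> (u \<otimes>\<^bsub>G\<^esub> u')"
      using TiG by (simp add: G.nat_pow_mult[symmetric] G.m_ac)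
    ultimately show ?case by blast
  qed
  have "N \<subseteq> generate G T"
  proof
    fix h assume h: "h \<in> N"
    then obtain k :: nat and u where ku: "u \<in> generate G T" "h = c [^]\<^bsub>G\<^esub> k \<otimes>\<^bsub>G\<^esub> u"
      using dec[of h] S(3) N_carrier by auto
    have "generate G T \<subseteq> N" by (rule G.generate_subgroup_incl[OF T(2) subgroup_N])
    then have "\<chi> c ^ k = 1" using ku h by (auto simp: N_iff chi chi_pow)
    then obtain j where "k = n * j" by (auto simp: q_pow_eq_1)
    then have "c [^]\<^bsub>G\<^esub> k = (c [^]\<^bsub>G\<^esub> n) [^]\<^bsub>G\<^esub> j" by (simp add: G.nat_pow_pow)
    then show "h \<in> generate G T" using pow ku by simp
  qed
  then show ?thesis using that T by blast
qed

lemma H_simps: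
  "monoid.mult H = skew_mult G \<chi> \<eta>" "ring.add H = (+)" "ring.zero H = 0"
  "monoid.one H = Poly_Mapping.single (0, 0, \<one>\<^bsub>G\<^esub>) 1"
  by (simp_all add: skew_group_ring_def)

lemma generators_carrier [simp, intro]:
  "gen_x G \<in> carrier H" "gen_y G \<in> carrier H" "scalar G a \<in> carrier H"
  "g \<in> carrier G \<Longrightarrow> gen_grp g \<in> carrier H"
  by (simp_all add: gen_x_def gen_y_def scalar_def gen_grp_def)

text \<open>By the coset decomposition, \<open>c\<close> and the elements of \<open>N\<close> account for all of \<open>G\<close>. This is the natural
  generating set here since these are the elements whose action on a basis of \<open>V\<^sub>x(\<alpha>,\<mu>)\<close> is prescribed.\<close>
lemma generators_induct [consumes 1, case_names scalar x y c N add mult]: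
  assumes r: "r \<in> carrier H"
    and scalar: "\<And>a. Q (scalar G a)"
    and x: "Q (gen_x G)" and y: "Q (gen_y G)" and gen_c: "Q (gen_grp c)"
    and gen_N: "\<And>h. h \<in> N \<Longrightarrow> Q (gen_grp h)"
    and add: "\<And>p r. p \<in> carrier H \<Longrightarrow> r \<in> carrier H \<Longrightarrow> Q p \<Longrightarrow> Q r \<Longrightarrow> Q (p + r)"
    and mult: "\<And>p r. p \<in> carrier H \<Longrightarrow> r \<in> carrier H \<Longrightarrow> Q p \<Longrightarrow> Q r \<Longrightarrow> Q (skew_mult G \<chi> \<eta> p r)"
  shows "Q r"
proof -
  have cpow: "Q (gen_grp (c [^]\<^bsub>G\<^esub> (i::nat)))" for i
  proof (induction i)
    case 0
    then show ?case using scalar[of 1] by (simp add: gen_grp_def scalar_def)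
  next
    case (Suc i)
    then show ?case using mult[of "gen_grp (c [^]\<^bsub>G\<^esub> i)" "gen_grp c"] gen_c
      by (simp add: gen_grp_def skew_mult_single)
  qed
  have grp: "Q (gen_grp g)" if g: "g \<in> carrier G" for g
  proof -
    obtain i h where ih: "h \<in> N" "g = c [^]\<^bsub>G\<^esub> (i::nat) \<otimes>\<^bsub>G\<^esub> h"
      using coset_decomposition[OF g] by metis
    then show ?thesis using mult[of "gen_grp (c [^]\<^bsub>G\<^esub> i)" "gen_grp h"] cpow gen_N N_carrier
      by (simp add: gen_grp_def skew_mult_single)
  qed
  have y_pow: "Q (Poly_Mapping.single (0, j, g) a)" if g: "g \<in> carrier G" for j g a
  proof (induction j)
    case 0
    then show ?case using mult[of "scalar G a" "gen_grp g"] grp scalar g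
      by (simp add: gen_grp_def scalar_def skew_mult_single)
  next
    case (Suc j)
    then show ?case using mult[of "gen_y G" "Poly_Mapping.single (0, j, g) a"] y g
      by (simp add: gen_y_def skew_mult_single eta)
  qed
  have "Q (Poly_Mapping.single (i, j, g) a)" if g: "g \<in> carrier G" for i j g a
  proof (induction i)
    case 0
    then show ?case using y_pow g by simp
  next
    case (Suc i)
    then show ?case using mult[of "gen_x G" "Poly_Mapping.single (i, j, g) a"] x g
      by (simp add: gen_x_def skew_mult_single eta chi)
  qed
  moreover have "Q 0" using scalar[of 0] by (simp add: scalar_def)
  moreover have "p + r \<in> carrier H" if "p \<in> carrier H" "r \<in> carrier H" for p r
    using that by (rule add_in_carrier)
  moreover have "0 \<in> carrier H" by (simp add: skew_group_ring_def)
  ultimately have "r \<in> carrier H \<and> Q r"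
    by (intro carrier_skew_group_ring_induct[OF r, of "\<lambda>r. r \<in> carrier H \<and> Q r"]) (auto intro: add)
  then show ?thesis ..
qed

end

section \<open>Modules over the skew group ring\<close>

locale skew_module = skew_setup G \<chi> \<eta> c n
  for G :: "('g, 'm) monoid_scheme" and \<chi> \<eta> :: "'g \<Rightarrow> 'k::alg_closed_field" and c n +
  fixes V :: "(nat \<times> nat \<times> 'g \<Rightarrow>\<^sub>0 'k, 'v, 'z) module_scheme"
  assumes left_module: "left_module (skew_group_ring G \<chi> \<eta>) V"
begin

sublocale V: left_module "skew_group_ring G \<chi> \<eta>" V by (rule left_module)

lemma single_single:
  assumes "g \<in> carrier G" "h \<in> carrier G" "v \<in> carrier V"
  shows "Poly_Mapping.single (i, j, g) a \<odot>\<^bsub>V\<^esub> (Poly_Mapping.single (k, l, h) d \<odot>\<^bsub>V\<^esub> v) =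
    Poly_Mapping.single (i + k, j + l, g \<otimes>\<^bsub>G\<^esub> h)
      (a * d * inverse (\<chi> g) ^ k * inverse (\<eta> g) ^ l) \<odot>\<^bsub>V\<^esub> v"
  using V.smult_assoc1[of "Poly_Mapping.single (i, j, g) a" "Poly_Mapping.single (k, l, h) d" v] assms
  by (simp add: H_simps skew_mult_single)

lemma add_smult:
  "r \<in> carrier H \<Longrightarrow> s \<in> carrier H \<Longrightarrow> v \<in> carrier V \<Longrightarrow>
    (r + s) \<odot>\<^bsub>V\<^esub> v = r \<odot>\<^bsub>V\<^esub> v \<oplus>\<^bsub>V\<^esub> s \<odot>\<^bsub>V\<^esub> v"
  using V.smult_l_distr[of r s v] by (simp add: H_simps)

lemma zero_smult: "v \<in> carrier V \<Longrightarrow> 0 \<odot>\<^bsub>V\<^esub> v = \<zero>\<^bsub>V\<^esub>"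
  using V.smult_zero_left by (simp add: H_simps)

lemma scalar_smult:
  "v \<in> carrier V \<Longrightarrow> scalar G 1 \<odot>\<^bsub>V\<^esub> v = v"
  "v \<in> carrier V \<Longrightarrow> scalar G 0 \<odot>\<^bsub>V\<^esub> v = \<zero>\<^bsub>V\<^esub>"
  "v \<in> carrier V \<Longrightarrow> scalar G (a + d) \<odot>\<^bsub>V\<^esub> v = scalar G a \<odot>\<^bsub>V\<^esub> v \<oplus>\<^bsub>V\<^esub> scalar G d \<odot>\<^bsub>V\<^esub> v"
  "v \<in> carrier V \<Longrightarrow> scalar G a \<odot>\<^bsub>V\<^esub> (scalar G d \<odot>\<^bsub>V\<^esub> v) = scalar G (a * d) \<odot>\<^bsub>V\<^esub> v"
  "v \<in> carrier V \<Longrightarrow> g \<in> carrier G \<Longrightarrow> scalar G a \<odot>\<^bsub>V\<^esub> (Poly_Mapping.single (i, j, g) d \<odot>\<^bsub>V\<^esub> v) =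
     Poly_Mapping.single (i, j, g) (a * d) \<odot>\<^bsub>V\<^esub> v"
  using V.smult_one[of v] zero_smult[of v]
    add_smult[of "scalar G a" "scalar G d" v]
  by (simp_all add: scalar_def H_simps single_single chi eta single_add)

lemma smult_scalar:
  assumes "r \<in> carrier H" "v \<in> carrier V"
  shows "r \<odot>\<^bsub>V\<^esub> (scalar G a \<odot>\<^bsub>V\<^esub> v) = scalar G a \<odot>\<^bsub>V\<^esub> (r \<odot>\<^bsub>V\<^esub> v)"
proof -
  have "r \<in> carrier H \<and> ?thesis" using assms(1)
  proof (induction rule: carrier_skew_group_ring_induct)
    case zero
    have "0 \<in> carrier H" by (simp add: skew_group_ring_def)
    then show ?case using assms(2) by (simp add: zero_smult)
  next
    case (single i j g d)
    then show ?case using assms(2) by (simp add: scalar_def single_single chi eta mult.commute)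
  next
    case (add p r)
    then show ?case using assms(2) by (simp add: add_smult V.smult_r_distr add_in_carrier)
  qed
  then show ?thesis ..
qed

text \<open>As a rewrite rule, the preceding lemma would swap two scalars forever; these instances terminate.\<close>
lemma generator_scalar:
  assumes "v \<in> carrier V"
  shows "gen_x G \<odot>\<^bsub>V\<^esub> (scalar G a \<odot>\<^bsub>V\<^esub> v) = scalar G a \<odot>\<^bsub>V\<^esub> (gen_x G \<odot>\<^bsub>V\<^esub> v)"
    and "g \<in> carrier G \<Longrightarrow>
      gen_grp g \<odot>\<^bsub>V\<^esub> (scalar G a \<odot>\<^bsub>V\<^esub> v) = scalar G a \<odot>\<^bsub>V\<^esub> (gen_grp g \<odot>\<^bsub>V\<^esub> v)"
  using assms by (auto intro: smult_scalar)

lemma scalar_smult_eq_zero: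
  assumes "v \<in> carrier V" "scalar G a \<odot>\<^bsub>V\<^esub> v = \<zero>\<^bsub>V\<^esub>" "v \<noteq> \<zero>\<^bsub>V\<^esub>"
  shows "a = 0"
proof (rule ccontr)
  assume "a \<noteq> 0"
  then have "v = scalar G (inverse a) \<odot>\<^bsub>V\<^esub> (scalar G a \<odot>\<^bsub>V\<^esub> v)"
    using assms(1) by (simp add: scalar_smult)
  also have "\<dots> = \<zero>\<^bsub>V\<^esub>" by (simp add: assms(2))
  finally show False using assms(3) by simp
qed

lemma scalar_smult_inj:
  assumes "v \<in> carrier V" "v \<noteq> \<zero>\<^bsub>V\<^esub>" "scalar G a \<odot>\<^bsub>V\<^esub> v = scalar G d \<odot>\<^bsub>V\<^esub> v"
  shows "a = d"
proof -
  have "scalar G (a - d) \<odot>\<^bsub>V\<^esub> v \<oplus>\<^bsub>V\<^esub> scalar G d \<odot>\<^bsub>V\<^esub> v = \<zero>\<^bsub>V\<^esub> \<oplus>\<^bsub>V\<^esub> scalar G d \<odot>\<^bsub>V\<^esub> v"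
    using assms scalar_smult(3)[of v "a - d" d] by simp
  then have "scalar G (a - d) \<odot>\<^bsub>V\<^esub> v = \<zero>\<^bsub>V\<^esub>"
    using assms(1) by (simp del: V.M.l_zero V.M.r_zero)
  then show ?thesis using scalar_smult_eq_zero[OF assms(1) _ assms(2)] by fastforce
qed

lemma generator_grp:
  assumes "g \<in> carrier G" "v \<in> carrier V"
  shows "gen_x G \<odot>\<^bsub>V\<^esub> (gen_grp g \<odot>\<^bsub>V\<^esub> v) = scalar G (\<chi> g) \<odot>\<^bsub>V\<^esub> (gen_grp g \<odot>\<^bsub>V\<^esub> (gen_x G \<odot>\<^bsub>V\<^esub> v))"
    and "gen_y G \<odot>\<^bsub>V\<^esub> (gen_grp g \<odot>\<^bsub>V\<^esub> v) = scalar G (\<eta> g) \<odot>\<^bsub>V\<^esub> (gen_grp g \<odot>\<^bsub>V\<^esub> (gen_y G \<odot>\<^bsub>V\<^esub> v))"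
  using assms by (simp_all add: gen_x_def gen_y_def gen_grp_def scalar_def single_single chi eta)

lemma grp_grp:
  assumes "g \<in> carrier G" "h \<in> carrier G" "v \<in> carrier V"
  shows "gen_grp g \<odot>\<^bsub>V\<^esub> (gen_grp h \<odot>\<^bsub>V\<^esub> v) = gen_grp (g \<otimes>\<^bsub>G\<^esub> h) \<odot>\<^bsub>V\<^esub> v"
  using assms by (simp add: gen_grp_def single_single)

lemma grp_one: "v \<in> carrier V \<Longrightarrow> gen_grp \<one>\<^bsub>G\<^esub> \<odot>\<^bsub>V\<^esub> v = v"
  using scalar_smult(1)[of v] by (simp add: gen_grp_def scalar_def)

text \<open>Applying \<open>x - \<kappa> j\<close> to a vanishing combination removes the \<open>j\<close>-th term and multiplies the coefficient of
  every other term by a nonzero number.\<close>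
lemma eigenvectors_independent:
  assumes "finite I" and u: "\<And>i. i \<in> I \<Longrightarrow> u i \<in> carrier V" "\<And>i. i \<in> I \<Longrightarrow> u i \<noteq> \<zero>\<^bsub>V\<^esub>"
    and eig: "\<And>i. i \<in> I \<Longrightarrow> gen_x G \<odot>\<^bsub>V\<^esub> u i = scalar G (\<kappa> i) \<odot>\<^bsub>V\<^esub> u i"
    and inj: "inj_on \<kappa> I"
    and sum: "(\<Oplus>\<^bsub>V\<^esub>i\<in>I. scalar G (a i) \<odot>\<^bsub>V\<^esub> u i) = \<zero>\<^bsub>V\<^esub>"
  shows "\<forall>i\<in>I. a i = 0"
  using assms
proof (induction I arbitrary: a)
  case (insert j I)
  have uI: "\<And>i. i \<in> I \<Longrightarrow> u i \<in> carrier V" and uj: "u j \<in> carrier V" using insert.prems by auto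
  define s where "s = (\<Oplus>\<^bsub>V\<^esub>i\<in>I. scalar G (a i) \<odot>\<^bsub>V\<^esub> u i)"
  have sV: "s \<in> carrier V" using uI by (auto simp: s_def intro!: V.M.finsum_closed)
  have sum0: "scalar G (a j) \<odot>\<^bsub>V\<^esub> u j \<oplus>\<^bsub>V\<^esub> s = \<zero>\<^bsub>V\<^esub>"
    using insert.prems(5) insert.hyps uI uj by (simp add: s_def Pi_def)
  have "gen_x G \<odot>\<^bsub>V\<^esub> (scalar G (a j) \<odot>\<^bsub>V\<^esub> u j \<oplus>\<^bsub>V\<^esub> s) =
      scalar G (\<kappa> j) \<odot>\<^bsub>V\<^esub> (scalar G (a j) \<odot>\<^bsub>V\<^esub> u j) \<oplus>\<^bsub>V\<^esub> gen_x G \<odot>\<^bsub>V\<^esub> s"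
    using uj sV insert.prems(3)[of j]
    by (simp add: V.smult_r_distr smult_scalar[of "gen_x G"] scalar_smult mult.commute)
  then have 1: "scalar G (\<kappa> j) \<odot>\<^bsub>V\<^esub> (scalar G (a j) \<odot>\<^bsub>V\<^esub> u j) \<oplus>\<^bsub>V\<^esub> gen_x G \<odot>\<^bsub>V\<^esub> s = \<zero>\<^bsub>V\<^esub>"
    using sum0 by simp
  have 2: "scalar G (\<kappa> j) \<odot>\<^bsub>V\<^esub> (scalar G (a j) \<odot>\<^bsub>V\<^esub> u j) \<oplus>\<^bsub>V\<^esub> scalar G (\<kappa> j) \<odot>\<^bsub>V\<^esub> s = \<zero>\<^bsub>V\<^esub>"
    using arg_cong[OF sum0, of "\<lambda>v. scalar G (\<kappa> j) \<odot>\<^bsub>V\<^esub> v"] uj sV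
    by (simp add: V.smult_r_distr)
  have "\<ominus>\<^bsub>V\<^esub> (gen_x G \<odot>\<^bsub>V\<^esub> s) = \<ominus>\<^bsub>V\<^esub> (scalar G (\<kappa> j) \<odot>\<^bsub>V\<^esub> s)"
    by (rule trans[OF V.M.minus_equality[OF 1] V.M.minus_equality[OF 2, symmetric]])
      (use uj sV in auto)
  then have xs: "gen_x G \<odot>\<^bsub>V\<^esub> s = scalar G (\<kappa> j) \<odot>\<^bsub>V\<^esub> s"
    using sV by (metis V.M.minus_minus V.smult_closed generators_carrier(1,3))
  have term_x: "gen_x G \<odot>\<^bsub>V\<^esub> (scalar G (a i) \<odot>\<^bsub>V\<^esub> u i) = scalar G (\<kappa> i * a i) \<odot>\<^bsub>V\<^esub> u i"
    if "i \<in> I" for i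
    using insert.prems(3)[of i] uI[OF that] that
    by (simp add: smult_scalar[of "gen_x G"] scalar_smult(4) mult.commute)
  have "gen_x G \<odot>\<^bsub>V\<^esub> s = (\<Oplus>\<^bsub>V\<^esub>i\<in>I. gen_x G \<odot>\<^bsub>V\<^esub> (scalar G (a i) \<odot>\<^bsub>V\<^esub> u i))"
    unfolding s_def using uI insert.hyps by (intro V.smult_finsum) auto
  also have "\<dots> = (\<Oplus>\<^bsub>V\<^esub>i\<in>I. scalar G (\<kappa> i * a i) \<odot>\<^bsub>V\<^esub> u i)"
    using uI by (intro V.M.finsum_cong') (auto simp: term_x)
  finally have sum1: "gen_x G \<odot>\<^bsub>V\<^esub> s = (\<Oplus>\<^bsub>V\<^esub>i\<in>I. scalar G (\<kappa> i * a i) \<odot>\<^bsub>V\<^esub> u i)" .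
  have "scalar G (- \<kappa> j) \<odot>\<^bsub>V\<^esub> s = (\<Oplus>\<^bsub>V\<^esub>i\<in>I. scalar G (- \<kappa> j) \<odot>\<^bsub>V\<^esub> (scalar G (a i) \<odot>\<^bsub>V\<^esub> u i))"
    unfolding s_def using uI insert.hyps by (intro V.smult_finsum) auto
  also have "\<dots> = (\<Oplus>\<^bsub>V\<^esub>i\<in>I. scalar G (- \<kappa> j * a i) \<odot>\<^bsub>V\<^esub> u i)"
    using uI by (intro V.M.finsum_cong') (auto simp: scalar_smult(4))
  finally have sum2: "scalar G (- \<kappa> j) \<odot>\<^bsub>V\<^esub> s = (\<Oplus>\<^bsub>V\<^esub>i\<in>I. scalar G (- \<kappa> j * a i) \<odot>\<^bsub>V\<^esub> u i)" .
  have "gen_x G \<odot>\<^bsub>V\<^esub> s \<oplus>\<^bsub>V\<^esub> scalar G (- \<kappa> j) \<odot>\<^bsub>V\<^esub> s =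
      (\<Oplus>\<^bsub>V\<^esub>i\<in>I. scalar G (\<kappa> i * a i) \<odot>\<^bsub>V\<^esub> u i \<oplus>\<^bsub>V\<^esub> scalar G (- \<kappa> j * a i) \<odot>\<^bsub>V\<^esub> u i)"
    unfolding sum1 sum2 using uI by (intro V.M.finsum_addf[symmetric]) auto
  also have "\<dots> = (\<Oplus>\<^bsub>V\<^esub>i\<in>I. scalar G ((\<kappa> i - \<kappa> j) * a i) \<odot>\<^bsub>V\<^esub> u i)"
    using uI by (intro V.M.finsum_cong') (auto simp: scalar_smult(3)[symmetric] left_diff_distrib)
  finally have "(\<Oplus>\<^bsub>V\<^esub>i\<in>I. scalar G ((\<kappa> i - \<kappa> j) * a i) \<odot>\<^bsub>V\<^esub> u i) = \<zero>\<^bsub>V\<^esub>"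
    using sV scalar_smult(3)[of s "\<kappa> j" "- \<kappa> j"] by (simp add: xs scalar_smult(2))
  moreover have "inj_on \<kappa> I" using insert.prems by simp
  ultimately have "\<forall>i\<in>I. (\<kappa> i - \<kappa> j) * a i = 0"
    using insert.prems by (intro insert.IH) auto
  moreover have "\<kappa> i \<noteq> \<kappa> j" if "i \<in> I" for i using that insert by (auto simp: inj_on_def)
  ultimately have aI: "\<forall>i\<in>I. a i = 0" by auto
  then have "s = (\<Oplus>\<^bsub>V\<^esub>i\<in>I. \<zero>\<^bsub>V\<^esub>)"
    unfolding s_def using uI by (intro V.M.finsum_cong') (auto simp: scalar_smult)
  then have "s = \<zero>\<^bsub>V\<^esub>" by simp
  then have "scalar G (a j) \<odot>\<^bsub>V\<^esub> u j = \<zero>\<^bsub>V\<^esub>" using sum0 uj by simp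
  then have "a j = 0" using scalar_smult_eq_zero[OF uj] insert.prems by auto
  then show ?case using aI by simp
qed simp

end

section \<open>Polynomials in the commuting operators\<close>

lemma poly_mapping_induct_single [case_names zero single add]:
  fixes f :: "'a \<Rightarrow>\<^sub>0 'b::comm_monoid_add"
  assumes "P 0" and "\<And>t a. P (Poly_Mapping.single t a)" and "\<And>f g. P f \<Longrightarrow> P g \<Longrightarrow> P (f + g)"
  shows "P f"
proof -
  have "P (\<Sum>t\<in>T. Poly_Mapping.single t (Poly_Mapping.lookup f t))" if "finite T" for T
    using that by (induction T) (auto intro: assms)
  then have "P (\<Sum>t\<in>Poly_Mapping.keys f. Poly_Mapping.single t (Poly_Mapping.lookup f t))" by simp
  also have "(\<Sum>t\<in>Poly_Mapping.keys f. Poly_Mapping.single t (Poly_Mapping.lookup f t)) = f"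
    by (rule poly_mapping_eqI)
       (simp add: lookup_sum lookup_single when_def in_keys_iff sum.delta)
  finally show ?thesis .
qed

type_synonym 'k mpoly = "(nat \<Rightarrow>\<^sub>0 nat) \<Rightarrow>\<^sub>0 'k"

definition mvar :: "nat \<Rightarrow> 'k::field mpoly" where
  "mvar i = Poly_Mapping.single (Poly_Mapping.single i 1) 1"

context skew_setup
begin

text \<open>Variable \<open>0\<close> stands for \<open>x\<^sup>n\<close>, variable \<open>i + 1\<close> with \<open>i < m\<close> for the group element \<open>hs i\<close>, and every
  further variable for \<open>1\<close>. The operators by which \<open>x\<^sup>n\<close> and the \<open>hs i\<close> act thus come from a polynomial
  ring, which does not depend on the module and is a commutative ring as a type.\<close>
definition mono_index :: "(nat \<Rightarrow> 'g) \<Rightarrow> nat \<Rightarrow> (nat \<Rightarrow>\<^sub>0 nat) \<Rightarrow> nat \<times> nat \<times> 'g" where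
  "mono_index hs m M = (n * Poly_Mapping.lookup M 0, 0,
     \<Otimes>\<^bsub>G\<^esub>i\<in>{..<m}. hs i [^]\<^bsub>G\<^esub> Poly_Mapping.lookup M (Suc i))"

definition mpoly_to_H :: "(nat \<Rightarrow> 'g) \<Rightarrow> nat \<Rightarrow> 'k mpoly \<Rightarrow> (nat \<times> nat \<times> 'g \<Rightarrow>\<^sub>0 'k)" where
  "mpoly_to_H hs m f =
     (\<Sum>M\<in>Poly_Mapping.keys f. Poly_Mapping.single (mono_index hs m M) (Poly_Mapping.lookup f M))"

lemma mpoly_to_H_superset:
  assumes "finite A" "Poly_Mapping.keys f \<subseteq> A"
  shows "mpoly_to_H hs m f =
    (\<Sum>M\<in>A. Poly_Mapping.single (mono_index hs m M) (Poly_Mapping.lookup f M))"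
  unfolding mpoly_to_H_def
  by (rule sum.mono_neutral_left) (use assms in \<open>auto simp: in_keys_iff\<close>)

lemma mpoly_to_H_zero: "mpoly_to_H hs m 0 = 0"
  by (simp add: mpoly_to_H_def)

lemma mpoly_to_H_add: "mpoly_to_H hs m (f + g) = mpoly_to_H hs m f + mpoly_to_H hs m g"
proof -
  let ?A = "Poly_Mapping.keys f \<union> Poly_Mapping.keys g"
  have "Poly_Mapping.keys (f + g) \<subseteq> ?A" by (rule Poly_Mapping.keys_add)
  then show ?thesis
    by (simp add: mpoly_to_H_superset[of ?A] lookup_add single_add sum.distrib)
qed

lemma mpoly_to_H_single:
  "mpoly_to_H hs m (Poly_Mapping.single M a) = Poly_Mapping.single (mono_index hs m M) a"
  by (subst mpoly_to_H_superset[of "{M}"]) auto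

lemma mpoly_to_H_scalar: "mpoly_to_H hs m (Poly_Mapping.single 0 a) = scalar G a"
  by (simp add: mpoly_to_H_single scalar_def mono_index_def)

lemma mpoly_to_H_var_0: "mpoly_to_H hs m (mvar 0) = Poly_Mapping.single (n, 0, \<one>\<^bsub>G\<^esub>) 1"
  by (simp add: mpoly_to_H_single mvar_def mono_index_def lookup_single when_def)

context
  fixes hs :: "nat \<Rightarrow> 'g" and m :: nat
  assumes hs_image: "hs ` {..<m} \<subseteq> N"
begin

lemma hs: "i < m \<Longrightarrow> hs i \<in> N"
  using hs_image by auto

lemma mono_index_cases:
  obtains k h where "mono_index hs m M = (n * k, 0, h)" "h \<in> N"
proof -
  interpret N: subgroup N G by (rule subgroup_N)
  have "finprod G (\<lambda>i. hs i [^]\<^bsub>G\<^esub> Poly_Mapping.lookup M (Suc i)) I \<in> N" if "I \<subseteq> {..<m}" for I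
    using finite_subset[OF that finite_lessThan] that
  proof (induction I)
    case (insert i I)
    have "hs j [^]\<^bsub>G\<^esub> k \<in> N" if "j < m" for j and k :: nat
      using hs[OF that] by (induction k) auto
    then show ?case using insert by (subst G.finprod_insert) (auto simp: N_carrier)
  qed simp
  then show ?thesis using that by (auto simp: mono_index_def)
qed

lemma mono_index_add:
  assumes "mono_index hs m M = (k, 0, g)" "mono_index hs m M' = (k', 0, g')"
  shows "mono_index hs m (M + M') = (k + k', 0, g \<otimes>\<^bsub>G\<^esub> g')"
proof -
  have "(\<Otimes>\<^bsub>G\<^esub>i\<in>{..<m}. hs i [^]\<^bsub>G\<^esub> (Poly_Mapping.lookup M (Suc i) + Poly_Mapping.lookup M' (Suc i))) =
      (\<Otimes>\<^bsub>G\<^esub>i\<in>{..<m}. hs i [^]\<^bsub>G\<^esub> Poly_Mapping.lookup M (Suc i) \<otimes>\<^bsub>G\<^esub>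
        hs i [^]\<^bsub>G\<^esub> Poly_Mapping.lookup M' (Suc i))"
    using hs by (intro G.finprod_cong') (auto simp: G.nat_pow_mult N_carrier)
  also have "\<dots> = g \<otimes>\<^bsub>G\<^esub> g'"
    using assms hs by (subst G.finprod_multf) (auto simp: mono_index_def N_carrier)
  finally show ?thesis using assms by (auto simp: mono_index_def lookup_add distrib_left)
qed

lemma mpoly_to_H_closed: "mpoly_to_H hs m f \<in> carrier H"
proof (induction f rule: poly_mapping_induct_single)
  case zero
  show ?case by (simp add: mpoly_to_H_zero skew_group_ring_def)
next
  case (single M a)
  obtain k h where "mono_index hs m M = (n * k, 0, h)" "h \<in> N" by (rule mono_index_cases)
  then show ?case by (simp add: mpoly_to_H_single N_carrier)
qed (simp add: mpoly_to_H_add add_in_carrier)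

lemma mpoly_to_H_mult:
  "mpoly_to_H hs m (f * g) = skew_mult G \<chi> \<eta> (mpoly_to_H hs m f) (mpoly_to_H hs m g)"
proof (induction f rule: poly_mapping_induct_single)
  case (single M a)
  show ?case
  proof (induction g rule: poly_mapping_induct_single)
    case (single M' a')
    obtain k h where 1: "mono_index hs m M = (n * k, 0, h)" "h \<in> N" by (rule mono_index_cases)
    obtain k' h' where 2: "mono_index hs m M' = (n * k', 0, h')" "h' \<in> N" by (rule mono_index_cases)
    show ?case
      using 1(2) 2(2)
      by (simp add: mult_single mpoly_to_H_single mono_index_add[OF 1(1) 2(1)] 1(1) 2(1)
          skew_mult_single N_chi)
  qed (simp_all add: mpoly_to_H_zero mpoly_to_H_add distrib_left skew_mult_add_right)
qed (simp_all add: mpoly_to_H_zero mpoly_to_H_add distrib_right skew_mult_add_left)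

lemma mpoly_to_H_var_Suc:
  assumes "i < m"
  shows "mpoly_to_H hs m (mvar (Suc i)) = gen_grp (hs i)"
proof -
  have "(\<Otimes>\<^bsub>G\<^esub>j\<in>{..<m}. hs j [^]\<^bsub>G\<^esub> (if i = j then Suc 0 else 0)) =
      (\<Otimes>\<^bsub>G\<^esub>j\<in>{..<m}. if i = j then hs j else \<one>\<^bsub>G\<^esub>)"
    using hs by (intro G.finprod_cong') (auto simp: N_carrier)
  also have "\<dots> = hs i" using assms hs by (intro G.finprod_singleton) (auto simp: N_carrier)
  finally show ?thesis
    by (simp add: mpoly_to_H_single mvar_def mono_index_def lookup_single when_def gen_grp_def)
qed

end

end

section \<open>Simple modules on which \<open>y\<close> is torsion\<close>

locale simple_torsion_module = skew_module G \<chi> \<eta> c n V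
  for G :: "('g, 'm) monoid_scheme" and \<chi> \<eta> :: "'g \<Rightarrow> 'k::alg_closed_field" and c n
    and V :: "(nat \<times> nat \<times> 'g \<Rightarrow>\<^sub>0 'k, 'v, 'z) module_scheme" +
  assumes fg: "finitely_generated G"
    and simple: "simple_module (skew_group_ring G \<chi> \<eta>) V"
    and x_torsion_free: "torsion_free_wrt (skew_group_ring G \<chi> \<eta>) V (gen_x G)"
    and y_torsion: "torsion_wrt (skew_group_ring G \<chi> \<eta>) V (gen_y G)"
begin

lemma submodule_cases: "submodule W H V \<Longrightarrow> W = {\<zero>\<^bsub>V\<^esub>} \<or> W = carrier V"
  using simple by (simp add: simple_module_def)

lemma y_pow: "gen_y G [^]\<^bsub>H\<^esub> (k::nat) = Poly_Mapping.single (0, k, \<one>\<^bsub>G\<^esub>) 1"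
  by (induction k) (simp_all add: H_simps skew_mult_single gen_y_def eta)

lemma nonzero_vector: obtains w where "w \<in> carrier V" "w \<noteq> \<zero>\<^bsub>V\<^esub>"
  using simple V.M.zero_closed unfolding simple_module_def by blast

text \<open>The next two lemmas move \<open>y\<close> to the right and to the left of a basis element; together they make the
  vectors killed by \<open>y\<close> a submodule.\<close>
lemma single_Suc_y:
  assumes "v \<in> carrier V" "g \<in> carrier G"
  shows "Poly_Mapping.single (i, Suc j, g) a \<odot>\<^bsub>V\<^esub> v =
    Poly_Mapping.single (i, j, g) (a * \<eta> g) \<odot>\<^bsub>V\<^esub> (gen_y G \<odot>\<^bsub>V\<^esub> v)"
  using assms by (simp add: gen_y_def single_single eta mult.assoc)

lemma y_single:
  assumes "v \<in> carrier V" "g \<in> carrier G"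
  shows "gen_y G \<odot>\<^bsub>V\<^esub> (Poly_Mapping.single (i, j, g) a \<odot>\<^bsub>V\<^esub> v) =
    Poly_Mapping.single (i, Suc j, g) a \<odot>\<^bsub>V\<^esub> v"
  using assms by (simp add: gen_y_def single_single chi eta)

lemma y_zero:
  assumes "v \<in> carrier V"
  shows "gen_y G \<odot>\<^bsub>V\<^esub> v = \<zero>\<^bsub>V\<^esub>"
proof -
  define W where "W = {v \<in> carrier V. gen_y G \<odot>\<^bsub>V\<^esub> v = \<zero>\<^bsub>V\<^esub>}"
  have smult: "r \<odot>\<^bsub>V\<^esub> v \<in> W" if "r \<in> carrier H" and v: "v \<in> W" for r v
  proof -
    have "r \<in> carrier H \<and> gen_y G \<odot>\<^bsub>V\<^esub> (r \<odot>\<^bsub>V\<^esub> v) = \<zero>\<^bsub>V\<^esub>"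
      using that(1)
    proof (induction rule: carrier_skew_group_ring_induct)
      case zero
      have "0 \<in> carrier H" by (simp add: skew_group_ring_def)
      then show ?case using v by (simp add: zero_smult W_def)
    next
      case (single i j g a)
      then show ?case using v by (simp add: y_single single_Suc_y W_def)
    next
      case (add p r)
      then show ?case using v by (simp add: add_smult V.smult_r_distr add_in_carrier W_def)
    qed
    then show ?thesis using v by (simp add: W_def)
  qed
  have "submodule W H V"
    by (rule V.submoduleI) (auto intro: smult, auto simp: W_def V.smult_r_distr)
  moreover have "W \<noteq> {\<zero>\<^bsub>V\<^esub>}"
  proof -
    obtain w where w: "w \<in> carrier V" "w \<noteq> \<zero>\<^bsub>V\<^esub>" by (rule nonzero_vector)
    let ?Z = "\<lambda>k. (Poly_Mapping.single (0, k, \<one>\<^bsub>G\<^esub>) 1) \<odot>\<^bsub>V\<^esub> w = \<zero>\<^bsub>V\<^esub>"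
    have "\<exists>k. ?Z k" using y_torsion w(1) by (auto simp: torsion_wrt_def y_pow)
    then obtain k where k: "?Z k" "\<And>j. j < k \<Longrightarrow> \<not> ?Z j"
      using exists_least_iff[of ?Z] by blast
    obtain j where j: "k = Suc j"
      using k(1) w scalar_smult(1)[of w] by (cases k) (auto simp: scalar_def)
    let ?u = "Poly_Mapping.single (0, j, \<one>\<^bsub>G\<^esub>) 1 \<odot>\<^bsub>V\<^esub> w"
    have "gen_y G \<odot>\<^bsub>V\<^esub> ?u = \<zero>\<^bsub>V\<^esub>"
      using k(1) w(1) by (simp add: j gen_y_def single_single eta)
    then have "?u \<in> W" using w by (simp add: W_def)
    moreover have "?u \<noteq> \<zero>\<^bsub>V\<^esub>" using k(2)[of j] j by simp
    ultimately show ?thesis by auto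
  qed
  ultimately have "W = carrier V" using submodule_cases by blast
  then show ?thesis using assms by (auto simp: W_def)
qed

lemma single_y_zero:
  assumes "v \<in> carrier V" "g \<in> carrier G"
  shows "Poly_Mapping.single (i, Suc j, g) a \<odot>\<^bsub>V\<^esub> v = \<zero>\<^bsub>V\<^esub>"
  using assms by (simp add: single_Suc_y y_zero)

text \<open>Moving \<open>x\<^sup>n\<^sup>k\<close> past \<open>g\<close> costs the factor \<open>\<chi>(g)\<^sup>n\<^sup>k = 1\<close>, and moving \<open>h \<in> N\<close> past \<open>x\<close> costs \<open>\<chi>(h) = 1\<close>. An
  element \<open>h\<close> need not commute with \<open>y\<close> in the algebra, but \<open>y\<close> acts as zero.\<close>
lemma central_commute:
  assumes hs: "hs ` {..<m} \<subseteq> N" and r: "r \<in> carrier H" and v: "v \<in> carrier V"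
  shows "r \<odot>\<^bsub>V\<^esub> (mpoly_to_H hs m f \<odot>\<^bsub>V\<^esub> v) = mpoly_to_H hs m f \<odot>\<^bsub>V\<^esub> (r \<odot>\<^bsub>V\<^esub> v)"
proof (induction f rule: poly_mapping_induct_single)
  case zero
  then show ?case using r v by (simp add: mpoly_to_H_zero zero_smult)
next
  case (single M a)
  obtain k h where M: "mono_index hs m M = (n * k, 0, h)" and h: "h \<in> N"
    using mono_index_cases[OF hs] by metis
  have "r \<in> carrier H \<and> ?case" using r
  proof (induction rule: carrier_skew_group_ring_induct)
    case zero
    have "0 \<in> carrier H" by (simp add: skew_group_ring_def)
    then show ?case using v h by (simp add: zero_smult mpoly_to_H_single M N_carrier)
  next
    case (single i j g d)
    show ?case
    proof (cases j)
      case 0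
      have "\<chi> g ^ (n * k) = 1" using chi_pow_n[OF single] by (simp add: power_mult)
      then show ?thesis
        using single v h
        by (simp add: mpoly_to_H_single M single_single N_carrier N_chi 0 power_inverse
            mult.commute add.commute G.m_comm)
    next
      case (Suc j)
      then show ?thesis
        using single v h by (simp add: mpoly_to_H_single M single_y_zero N_carrier)
    qed
  next
    case (add p r)
    then show ?case
      using v h by (simp add: add_smult V.smult_r_distr add_in_carrier mpoly_to_H_single M N_carrier)
  qed
  then show ?case ..
next
  case (add f g)
  then show ?case
    using r v by (simp add: mpoly_to_H_add add_smult V.smult_r_distr mpoly_to_H_closed[OF hs])
qed

text \<open>The image of an operator that commutes with the action is a submodule.\<close>
lemma central_zero_or_onto:
  assumes hs: "hs ` {..<m} \<subseteq> N"
  shows "(\<forall>v\<in>carrier V. mpoly_to_H hs m f \<odot>\<^bsub>V\<^esub> v = \<zero>\<^bsub>V\<^esub>) \<or>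
    carrier V \<subseteq> (\<lambda>v. mpoly_to_H hs m f \<odot>\<^bsub>V\<^esub> v) ` carrier V"
proof -
  let ?f = "mpoly_to_H hs m f"
  let ?W = "(\<lambda>v. ?f \<odot>\<^bsub>V\<^esub> v) ` carrier V"
  note f = mpoly_to_H_closed[OF hs]
  have "submodule ?W H V"
  proof (rule V.submoduleI)
    show "\<zero>\<^bsub>V\<^esub> \<in> ?W" by (rule image_eqI[of _ _ "\<zero>\<^bsub>V\<^esub>"]) (auto simp: f)
    show "u \<oplus>\<^bsub>V\<^esub> v \<in> ?W" if "u \<in> ?W" "v \<in> ?W" for u v
      using that f by (auto simp flip: V.smult_r_distr)
    show "r \<odot>\<^bsub>V\<^esub> v \<in> ?W" if r: "r \<in> carrier H" and v: "v \<in> ?W" for r v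
    proof -
      obtain u where u: "u \<in> carrier V" "v = ?f \<odot>\<^bsub>V\<^esub> u" using v by blast
      have "r \<odot>\<^bsub>V\<^esub> v = ?f \<odot>\<^bsub>V\<^esub> (r \<odot>\<^bsub>V\<^esub> u)"
        unfolding u(2) by (rule central_commute[OF hs r u(1)])
      then show ?thesis using r u(1) by blast
    qed
  qed (auto simp: f)
  then show ?thesis using submodule_cases by blast
qed

text \<open>These operators meet the hypotheses of \<open>finitely_generated_acts_by_scalars\<close>. The generators of \<open>N\<close>
  are listed together with their inverses, since a polynomial ring offers only nonnegative
  exponents. Dividing \<open>k\<close> by \<open>n\<close> and decomposing \<open>g\<close> into a power of \<open>c\<close> and an element of \<open>N\<close> writes \<open>x\<^sup>k g\<close> as a
  product of such an operator and one of the \<open>n\<^sup>2\<close> monomials \<open>x\<^sup>r c\<^sup>i\<close> with \<open>r, i < n\<close>.\<close>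
lemma central_scalars:
  obtains \<beta> \<mu> where "\<And>v. v \<in> carrier V \<Longrightarrow> Poly_Mapping.single (n, 0, \<one>\<^bsub>G\<^esub>) 1 \<odot>\<^bsub>V\<^esub> v = scalar G \<beta> \<odot>\<^bsub>V\<^esub> v"
    and "\<And>h v. h \<in> N \<Longrightarrow> v \<in> carrier V \<Longrightarrow> gen_grp h \<odot>\<^bsub>V\<^esub> v = scalar G (\<mu> h) \<odot>\<^bsub>V\<^esub> v"
proof -
  obtain T where T: "finite T" "T \<subseteq> N" "N \<subseteq> generate G T"
    by (rule N_finitely_generated[OF fg])
  define T' where "T' = T \<union> (\<lambda>h. inv\<^bsub>G\<^esub> h) ` T"
  have "finite T'" using T by (simp add: T'_def)
  then obtain gs where gs: "set gs = T'" using finite_list by blast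
  have T'N: "T' \<subseteq> N" using T subgroup.m_inv_closed[OF subgroup_N] by (auto simp: T'_def)
  define hs where "hs i = gs ! i" for i
  define m where "m = length gs"
  have hs: "hs ` {..<m} \<subseteq> N" using gs T'N by (auto simp: hs_def m_def)
  have hs_T': "\<exists>i<m. h = hs i" if "h \<in> T'" for h
    using that gs by (metis hs_def in_set_conv_nth m_def)
  define act where "act f v = mpoly_to_H hs m f \<odot>\<^bsub>V\<^esub> v" for f v
  note psi_closed = mpoly_to_H_closed[OF hs]
  interpret ring_action "Poly_Mapping.single 0 :: 'k \<Rightarrow> 'k mpoly" V act
  proof
    show "act (r * s) v = act r (act s v)" if "v \<in> carrier V" for r s v
      using that V.smult_assoc1[OF psi_closed psi_closed, of v]
      by (simp add: act_def mpoly_to_H_mult[OF hs] H_simps)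
    show "act 1 v = v" if "v \<in> carrier V" for v
      using mpoly_to_H_scalar[of hs m 1] that by (simp add: act_def scalar_smult)
  qed (auto simp: act_def psi_closed mpoly_to_H_add add_smult V.smult_r_distr single_add mult_single)
  define ts where "ts = (map mvar [0..<Suc m] :: 'k mpoly list)"
  define A where "A = generated_algebra ts"
  have subA: "subalgebra A" by (simp add: A_def subalgebra_generated)
  note AD = subalgebraD[OF subA]
  have varA: "mvar i \<in> A" if "i \<le> m" for i
    unfolding A_def by (rule generators_in_generated) (use that in \<open>auto simp: ts_def simp del: upt_Suc\<close>)
  have act_scalar: "act (Poly_Mapping.single 0 a) v = scalar G a \<odot>\<^bsub>V\<^esub> v" for a v
    by (simp add: act_def mpoly_to_H_scalar)
  have act_x: "act (mvar 0) v = Poly_Mapping.single (n, 0, \<one>\<^bsub>G\<^esub>) 1 \<odot>\<^bsub>V\<^esub> v" for v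
    by (simp add: act_def mpoly_to_H_var_0)
  have act_x_pow: "act (mvar 0 ^ k) v = Poly_Mapping.single (n * k, 0, \<one>\<^bsub>G\<^esub>) 1 \<odot>\<^bsub>V\<^esub> v"
    if "v \<in> carrier V" for k v
  proof (induction k)
    case 0
    then show ?case using that by (simp add: act_one scalar_smult flip: scalar_def)
  next
    case (Suc k)
    then show ?case using that by (simp add: act_mult act_x single_single chi)
  qed
  have N_act: "\<exists>a\<in>A. \<forall>v\<in>carrier V. gen_grp h \<odot>\<^bsub>V\<^esub> v = act a v" if "h \<in> generate G T" for h
    using that
  proof induction
    case one
    then show ?case by (intro bexI[of _ 1]) (auto simp: AD grp_one act_one)
  next
    case (incl h)
    then obtain i where "i < m" "h = hs i" using hs_T' by (auto simp: T'_def)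
    then show ?case
      by (intro bexI[of _ "mvar (Suc i)"]) (auto simp: varA act_def mpoly_to_H_var_Suc[OF hs])
  next
    case (inv h)
    then obtain i where "i < m" "inv\<^bsub>G\<^esub> h = hs i" using hs_T' by (auto simp: T'_def)
    then show ?case
      by (intro bexI[of _ "mvar (Suc i)"]) (auto simp: varA act_def mpoly_to_H_var_Suc[OF hs])
  next
    case (eng g h)
    then obtain a d where "a \<in> A" "\<forall>v\<in>carrier V. gen_grp g \<odot>\<^bsub>V\<^esub> v = act a v"
      "d \<in> A" "\<forall>v\<in>carrier V. gen_grp h \<odot>\<^bsub>V\<^esub> v = act d v" by blast
    moreover have "g \<in> carrier G" "h \<in> carrier G"
      using eng G.generate_in_carrier[of T] T(2) N_carrier by auto
    ultimately show ?case
      by (intro bexI[of _ "a * d"]) (auto simp: AD act_mult simp flip: grp_grp)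
  qed
  obtain w where w: "w \<in> carrier V" "w \<noteq> \<zero>\<^bsub>V\<^esub>" by (rule nonzero_vector)
  define I where "I = {..<n} \<times> {..<n}"
  define u where "u = (\<lambda>(r, i). Poly_Mapping.single (r, 0, c [^]\<^bsub>G\<^esub> (i::nat)) 1 \<odot>\<^bsub>V\<^esub> w)"
  have finI: "finite I" by (simp add: I_def)
  have uV: "u p \<in> carrier V" for p using w by (auto simp: u_def split: prod.split)
  have span: "carrier V \<subseteq> lin_span A u I"
  proof
    fix v assume "v \<in> carrier V"
    then obtain r where r: "r \<in> carrier H" "v = r \<odot>\<^bsub>V\<^esub> w"
      using V.simple_generated[OF simple w] by blast
    have "r \<in> carrier H \<and> r \<odot>\<^bsub>V\<^esub> w \<in> lin_span A u I" using r(1)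
    proof (induction rule: carrier_skew_group_ring_induct)
      case zero
      have "0 \<in> carrier H" by (simp add: skew_group_ring_def)
      then show ?case using w lin_span_zero[OF subA uV finI] by (simp add: zero_smult)
    next
      case (single k j g a)
      show ?case
      proof (cases j)
        case 0
        obtain i h where ih: "i < n" "h \<in> N" "g = c [^]\<^bsub>G\<^esub> i \<otimes>\<^bsub>G\<^esub> h"
          using coset_decomposition[OF single] by blast
        obtain d where d: "d \<in> A" "\<forall>v\<in>carrier V. gen_grp h \<odot>\<^bsub>V\<^esub> v = act d v"
          using N_act[of h] ih(2) T(3) by blast
        let ?d = "mvar 0 ^ (k div n) * (Poly_Mapping.single 0 a * d)"
        have "act ?d (u (k mod n, i)) =
            Poly_Mapping.single (n * (k div n), 0, \<one>\<^bsub>G\<^esub>) 1 \<odot>\<^bsub>V\<^esub>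
              (scalar G a \<odot>\<^bsub>V\<^esub> (gen_grp h \<odot>\<^bsub>V\<^esub> u (k mod n, i)))"
          using d(2) uV by (simp add: act_mult act_x_pow act_scalar)
        also have "\<dots> = Poly_Mapping.single (k, 0, h \<otimes>\<^bsub>G\<^esub> c [^]\<^bsub>G\<^esub> i) a \<odot>\<^bsub>V\<^esub> w"
          using w ih(2)
          by (simp add: u_def gen_grp_def scalar_def single_single N_carrier N_chi chi)
        finally have "Poly_Mapping.single (k, j, g) a \<odot>\<^bsub>V\<^esub> w = act ?d (u (k mod n, i))"
          using ih by (simp add: 0 G.m_comm N_carrier)
        moreover have "u (k mod n, i) \<in> lin_span A u I"
          by (rule lin_span_generator[OF subA uV finI]) (use ih n_pos in \<open>auto simp: I_def\<close>)
        moreover have "?d \<in> A" using d(1) varA[of 0] by (simp add: AD)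
        ultimately show ?thesis
          using lin_span_act[OF subA uV finI] single by simp
      next
        case (Suc j)
        then show ?thesis
          using single w lin_span_zero[OF subA uV finI] by (simp add: single_y_zero)
      qed
    next
      case (add p r)
      then show ?case
        using w lin_span_add[OF subA uV finI] by (simp add: add_smult add_in_carrier)
    qed
    then show "v \<in> lin_span A u I" using r(2) by simp
  qed
  have nonzero: "carrier V \<noteq> {\<zero>\<^bsub>V\<^esub>}" using w by auto
  have zero_or_onto: "(\<forall>v\<in>carrier V. act f v = \<zero>\<^bsub>V\<^esub>) \<or> carrier V \<subseteq> act f ` carrier V" for f
    unfolding act_def by (rule central_zero_or_onto[OF hs])
  obtain \<phi> where \<phi>: "\<And>a v. a \<in> A \<Longrightarrow> v \<in> carrier V \<Longrightarrow>
      act a v = act (Poly_Mapping.single 0 (\<phi> a)) v"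
    using finitely_generated_acts_by_scalars[OF nonzero zero_or_onto finI uV span[unfolded A_def]]
    unfolding A_def by blast
  have "\<exists>s. \<forall>v\<in>carrier V. gen_grp h \<odot>\<^bsub>V\<^esub> v = scalar G s \<odot>\<^bsub>V\<^esub> v" if h: "h \<in> N" for h
  proof -
    obtain a where "a \<in> A" "\<forall>v\<in>carrier V. gen_grp h \<odot>\<^bsub>V\<^esub> v = act a v"
      using N_act[of h] h T(3) by blast
    then show ?thesis using \<phi> act_scalar by metis
  qed
  then obtain \<mu> where "\<And>h. h \<in> N \<Longrightarrow> \<forall>v\<in>carrier V. gen_grp h \<odot>\<^bsub>V\<^esub> v = scalar G (\<mu> h) \<odot>\<^bsub>V\<^esub> v"
    by metis
  moreover have "Poly_Mapping.single (n, 0, \<one>\<^bsub>G\<^esub>) 1 \<odot>\<^bsub>V\<^esub> v = scalar G (\<phi> (mvar 0)) \<odot>\<^bsub>V\<^esub> v"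
    if "v \<in> carrier V" for v
    using \<phi>[OF varA[of 0] that] by (simp add: act_x act_scalar)
  ultimately show ?thesis using that by blast
qed

end

section \<open>Linear combinations and eigenvectors\<close>

context skew_module
begin

definition lincomb :: "(nat \<Rightarrow> 'k) \<Rightarrow> (nat \<Rightarrow> 'v) \<Rightarrow> 'v" where
  "lincomb a u = (\<Oplus>\<^bsub>V\<^esub>i\<in>{..<n}. scalar G (a i) \<odot>\<^bsub>V\<^esub> u i)"

lemma lincomb_cong:
  assumes "\<And>i. i < n \<Longrightarrow> u' i \<in> carrier V"
    and "\<And>i. i < n \<Longrightarrow> scalar G (a i) \<odot>\<^bsub>V\<^esub> u i = scalar G (a' i) \<odot>\<^bsub>V\<^esub> u' i"
  shows "lincomb a u = lincomb a' u'"
  unfolding lincomb_def by (rule V.M.finsum_cong') (use assms in auto)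

context
  fixes u :: "nat \<Rightarrow> 'v"
  assumes u: "\<And>i. i < n \<Longrightarrow> u i \<in> carrier V"
begin

lemma lincomb_closed: "lincomb a u \<in> carrier V"
  unfolding lincomb_def by (rule V.M.finsum_closed) (use u in auto)

lemma lincomb_add: "lincomb (\<lambda>i. a i + d i) u = lincomb a u \<oplus>\<^bsub>V\<^esub> lincomb d u"
proof -
  have "lincomb (\<lambda>i. a i + d i) u =
      (\<Oplus>\<^bsub>V\<^esub>i\<in>{..<n}. scalar G (a i) \<odot>\<^bsub>V\<^esub> u i \<oplus>\<^bsub>V\<^esub> scalar G (d i) \<odot>\<^bsub>V\<^esub> u i)"
    unfolding lincomb_def using u by (intro V.M.finsum_cong') (auto simp: scalar_smult)
  also have "\<dots> = lincomb a u \<oplus>\<^bsub>V\<^esub> lincomb d u"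
    unfolding lincomb_def using u by (intro V.M.finsum_addf) auto
  finally show ?thesis .
qed

lemma smult_lincomb:
  assumes "r \<in> carrier H"
  shows "r \<odot>\<^bsub>V\<^esub> lincomb a u = lincomb a (\<lambda>i. r \<odot>\<^bsub>V\<^esub> u i)"
proof -
  have "r \<odot>\<^bsub>V\<^esub> lincomb a u = (\<Oplus>\<^bsub>V\<^esub>i\<in>{..<n}. r \<odot>\<^bsub>V\<^esub> (scalar G (a i) \<odot>\<^bsub>V\<^esub> u i))"
    unfolding lincomb_def using assms u by (intro V.smult_finsum) auto
  also have "\<dots> = lincomb a (\<lambda>i. r \<odot>\<^bsub>V\<^esub> u i)"
    unfolding lincomb_def using assms u
    by (intro V.M.finsum_cong') (auto intro: smult_scalar)
  finally show ?thesis .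
qed

lemma lincomb_scalars: "lincomb a (\<lambda>i. scalar G (d i) \<odot>\<^bsub>V\<^esub> u i) = lincomb (\<lambda>i. a i * d i) u"
  by (rule lincomb_cong) (use u in \<open>auto simp: scalar_smult\<close>)

lemma lincomb_unit:
  assumes "i < n"
  shows "lincomb (\<lambda>j. if i = j then s else 0) u = scalar G s \<odot>\<^bsub>V\<^esub> u i"
proof -
  have "lincomb (\<lambda>j. if i = j then s else 0) u =
      (\<Oplus>\<^bsub>V\<^esub>j\<in>{..<n}. if i = j then scalar G s \<odot>\<^bsub>V\<^esub> u j else \<zero>\<^bsub>V\<^esub>)"
    unfolding lincomb_def using u by (intro V.M.finsum_cong') (auto simp: scalar_smult)
  also have "\<dots> = scalar G s \<odot>\<^bsub>V\<^esub> u i"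
    using assms u by (intro V.M.finsum_singleton) auto
  finally show ?thesis .
qed

end

lemma scalar_basis_iff:
  "scalar_basis G V n v \<longleftrightarrow> (\<forall>i<n. v i \<in> carrier V) \<and> (\<forall>u\<in>carrier V. \<exists>a. u = lincomb a v) \<and>
     (\<forall>a. lincomb a v = \<zero>\<^bsub>V\<^esub> \<longrightarrow> (\<forall>i<n. a i = 0))"
  by (simp add: scalar_basis_def lincomb_def)

text \<open>The action of \<open>p(x)\<close> by Horner's scheme.\<close>
definition poly_act :: "'k poly \<Rightarrow> 'v \<Rightarrow> 'v" where
  "poly_act p v = fold_coeffs (\<lambda>a u. scalar G a \<odot>\<^bsub>V\<^esub> v \<oplus>\<^bsub>V\<^esub> gen_x G \<odot>\<^bsub>V\<^esub> u) p \<zero>\<^bsub>V\<^esub>"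

context
  fixes v assumes v: "v \<in> carrier V"
begin

lemma poly_act_0: "poly_act 0 v = \<zero>\<^bsub>V\<^esub>"
  by (simp add: poly_act_def)

lemma poly_act_pCons:
  "poly_act (pCons a p) v = scalar G a \<odot>\<^bsub>V\<^esub> v \<oplus>\<^bsub>V\<^esub> gen_x G \<odot>\<^bsub>V\<^esub> poly_act p v"
proof (cases "a = 0 \<and> p = 0")
  case True
  then show ?thesis using v by (simp add: poly_act_def scalar_smult)
qed (auto simp: poly_act_def)

lemma poly_act_closed: "poly_act p v \<in> carrier V"
  by (induction p rule: pCons_induct) (use v in \<open>auto simp: poly_act_0 poly_act_pCons\<close>)

lemma poly_act_smult: "poly_act (Polynomial.smult a p) v = scalar G a \<odot>\<^bsub>V\<^esub> poly_act p v"
  by (induction p rule: pCons_induct)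
    (use v in \<open>simp_all add: poly_act_0 poly_act_pCons poly_act_closed V.smult_r_distr
      scalar_smult generator_scalar\<close>)

lemma poly_act_add: "poly_act (p + q) v = poly_act p v \<oplus>\<^bsub>V\<^esub> poly_act q v"
proof (induction p arbitrary: q rule: pCons_induct)
  case (pCons a p)
  obtain d r where q: "q = pCons d r" by (cases q)
  show ?case
    using v by (simp add: q poly_act_pCons pCons.IH scalar_smult V.smult_r_distr poly_act_closed V.M.a_ac)
qed (simp add: poly_act_0 poly_act_closed)

lemma poly_act_linear_factor:
  "poly_act ([:- a, 1:] * p) v = gen_x G \<odot>\<^bsub>V\<^esub> poly_act p v \<oplus>\<^bsub>V\<^esub> scalar G (- a) \<odot>\<^bsub>V\<^esub> poly_act p v"
proof -
  have "[:- a, 1:] * p = pCons 0 p + Polynomial.smult (- a) p" by simp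
  then have "poly_act ([:- a, 1:] * p) v = poly_act (pCons 0 p) v \<oplus>\<^bsub>V\<^esub> poly_act (Polynomial.smult (- a) p) v"
    by (simp only: poly_act_add)
  also have "poly_act (pCons 0 p) v = gen_x G \<odot>\<^bsub>V\<^esub> poly_act p v"
    unfolding poly_act_pCons scalar_smult(2)[OF v] using poly_act_closed[of p] by simp
  also have "poly_act (Polynomial.smult (- a) p) v = scalar G (- a) \<odot>\<^bsub>V\<^esub> poly_act p v"
    by (rule poly_act_smult)
  finally show ?thesis .
qed

lemma poly_act_monom: "poly_act (monom a k) v = Poly_Mapping.single (k, 0, \<one>\<^bsub>G\<^esub>) a \<odot>\<^bsub>V\<^esub> v"
proof (induction k)
  case 0
  then show ?case using v by (simp add: monom_0 poly_act_pCons poly_act_0 scalar_def)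
next
  case (Suc k)
  then show ?case
    using v by (simp add: monom_Suc poly_act_pCons scalar_smult gen_x_def single_single chi)
qed

text \<open>Split off linear factors of \<open>p\<close> one after the other. The last nonzero vector before the product
  annihilates \<open>v\<close> is killed by a factor \<open>x - a\<close>.\<close>
lemma eigenvector_exists:
  assumes "p \<noteq> 0" "poly_act p v = \<zero>\<^bsub>V\<^esub>" "v \<noteq> \<zero>\<^bsub>V\<^esub>"
  shows "\<exists>\<alpha>. \<exists>u\<in>carrier V. u \<noteq> \<zero>\<^bsub>V\<^esub> \<and> gen_x G \<odot>\<^bsub>V\<^esub> u = scalar G \<alpha> \<odot>\<^bsub>V\<^esub> u"
  using assms
proof (induction "degree p" arbitrary: p rule: less_induct)
  case less
  show ?case
  proof (cases "degree p = 0")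
    case True
    then obtain a where "p = [:a:]" by (metis degree_eq_zeroE)
    then have "scalar G a \<odot>\<^bsub>V\<^esub> v = \<zero>\<^bsub>V\<^esub>" "a \<noteq> 0"
      using less.prems v by (simp_all add: poly_act_pCons poly_act_0)
    then show ?thesis using scalar_smult_eq_zero[OF v] less.prems by blast
  next
    case False
    then obtain a where "poly p a = 0" using alg_closed_imp_poly_has_root[of p] by auto
    then obtain s where s: "p = [:- a, 1:] * s" by (auto simp: poly_eq_0_iff_dvd)
    then have s0: "s \<noteq> 0" using less.prems by auto
    show ?thesis
    proof (cases "poly_act s v = \<zero>\<^bsub>V\<^esub>")
      case True
      have "degree p = Suc (degree s)" using degree_mult_eq[of "[:- a, 1:]" s] s0 by (simp only: s) simp
      then show ?thesis using less.hyps[of s] s0 True less.prems by simp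
    next
      case False
      let ?u = "poly_act s v"
      have u: "?u \<in> carrier V" by (rule poly_act_closed)
      have "gen_x G \<odot>\<^bsub>V\<^esub> ?u = gen_x G \<odot>\<^bsub>V\<^esub> ?u \<oplus>\<^bsub>V\<^esub> scalar G (- a + a) \<odot>\<^bsub>V\<^esub> ?u"
        using u by (simp add: scalar_smult)
      also have "\<dots> = (gen_x G \<odot>\<^bsub>V\<^esub> ?u \<oplus>\<^bsub>V\<^esub> scalar G (- a) \<odot>\<^bsub>V\<^esub> ?u) \<oplus>\<^bsub>V\<^esub> scalar G a \<odot>\<^bsub>V\<^esub> ?u"
        unfolding scalar_smult(3)[OF u] using u by (simp add: V.M.a_assoc)
      also have "\<dots> = scalar G a \<odot>\<^bsub>V\<^esub> ?u"
        using less.prems(2) u unfolding s poly_act_linear_factor by simp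
      finally show ?thesis using u False by blast
    qed
  qed
qed

end

end

section \<open>Existence of the parameters\<close>

context simple_torsion_module
begin

text \<open>The eigenvector of \<open>x\<close> comes from the polynomial \<open>X\<^sup>n - \<beta>\<close>, where \<open>\<beta>\<close> is the scalar by which \<open>x\<^sup>n\<close> acts;
  its translates by \<open>c\<close> then form the required basis.\<close>
theorem exists_parameters:
  "\<exists>\<alpha>\<in>carrier Kunits. \<exists>\<mu>\<in>carrier (char_group (G\<lparr>carrier := N\<rparr>)). is_Vx G \<chi> \<eta> c n \<alpha> \<mu> V"
proof -
  obtain \<beta> \<mu>' where \<beta>: "\<And>v. v \<in> carrier V \<Longrightarrow>
      Poly_Mapping.single (n, 0, \<one>\<^bsub>G\<^esub>) 1 \<odot>\<^bsub>V\<^esub> v = scalar G \<beta> \<odot>\<^bsub>V\<^esub> v"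
    and \<mu>': "\<And>h v. h \<in> N \<Longrightarrow> v \<in> carrier V \<Longrightarrow> gen_grp h \<odot>\<^bsub>V\<^esub> v = scalar G (\<mu>' h) \<odot>\<^bsub>V\<^esub> v"
    using central_scalars by blast
  obtain w where w: "w \<in> carrier V" "w \<noteq> \<zero>\<^bsub>V\<^esub>" by (rule nonzero_vector)
  define \<mu> where "\<mu> = restrict \<mu>' N"
  have \<mu>: "gen_grp h \<odot>\<^bsub>V\<^esub> v = scalar G (\<mu> h) \<odot>\<^bsub>V\<^esub> v" if "h \<in> N" "v \<in> carrier V" for h v
    using \<mu>'[OF that] that by (simp add: \<mu>_def)
  interpret N: subgroup N G by (rule subgroup_N)
  have \<mu>_mult: "\<mu> (g \<otimes>\<^bsub>G\<^esub> h) = \<mu> g * \<mu> h" if "g \<in> N" "h \<in> N" for g h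
  proof (rule scalar_smult_inj[OF w])
    have "scalar G (\<mu> (g \<otimes>\<^bsub>G\<^esub> h)) \<odot>\<^bsub>V\<^esub> w = gen_grp g \<odot>\<^bsub>V\<^esub> (gen_grp h \<odot>\<^bsub>V\<^esub> w)"
      using that w by (simp add: \<mu>[symmetric] grp_grp N_carrier)
    also have "\<dots> = scalar G (\<mu> g * \<mu> h) \<odot>\<^bsub>V\<^esub> w"
      using that w by (simp add: \<mu> scalar_smult)
    finally show "scalar G (\<mu> (g \<otimes>\<^bsub>G\<^esub> h)) \<odot>\<^bsub>V\<^esub> w = scalar G (\<mu> g * \<mu> h) \<odot>\<^bsub>V\<^esub> w" .
  qed
  have \<mu>_one: "\<mu> \<one>\<^bsub>G\<^esub> = 1"
    by (rule scalar_smult_inj[OF w]) (use w in \<open>simp add: \<mu>[symmetric] grp_one scalar_smult\<close>)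
  then have \<mu>_nonzero: "\<mu> h \<noteq> 0" if "h \<in> N" for h
    using \<mu>_mult[of h "inv\<^bsub>G\<^esub> h"] that by (auto simp: N_carrier)
  have \<mu>_char: "\<mu> \<in> carrier (char_group (G\<lparr>carrier := N\<rparr>))"
    using \<mu>_mult \<mu>_nonzero by (auto simp: char_group_def hom_def Kunits_def \<mu>_def)
  let ?p = "monom 1 n + [:- \<beta>:]"
  have "coeff ?p n = 1" using n_pos by (cases n) auto
  then have p_nonzero: "?p \<noteq> 0" by (metis coeff_0 zero_neq_one)
  have p_w: "poly_act ?p w = \<zero>\<^bsub>V\<^esub>"
  proof -
    have "poly_act ?p w = scalar G \<beta> \<odot>\<^bsub>V\<^esub> w \<oplus>\<^bsub>V\<^esub> scalar G (- \<beta>) \<odot>\<^bsub>V\<^esub> w"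
      using w by (simp add: poly_act_add poly_act_monom poly_act_pCons poly_act_0 \<beta>)
    also have "\<dots> = \<zero>\<^bsub>V\<^esub>" using w(1) by (simp add: scalar_smult(2) flip: scalar_smult(3))
    finally show ?thesis .
  qed
  obtain \<alpha> v0 where v0: "v0 \<in> carrier V" "v0 \<noteq> \<zero>\<^bsub>V\<^esub>"
    and \<alpha>: "gen_x G \<odot>\<^bsub>V\<^esub> v0 = scalar G \<alpha> \<odot>\<^bsub>V\<^esub> v0"
    using eigenvector_exists[OF w(1) p_nonzero p_w w(2)] by blast
  have \<alpha>0: "\<alpha> \<noteq> 0"
  proof
    assume "\<alpha> = 0"
    then have "(gen_x G [^]\<^bsub>H\<^esub> (1::nat)) \<odot>\<^bsub>V\<^esub> v0 = \<zero>\<^bsub>V\<^esub>"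
      using \<alpha> v0 by (simp add: scalar_smult)
    then show False using x_torsion_free v0 unfolding torsion_free_wrt_def by blast
  qed
  define v where "v i = gen_grp (c [^]\<^bsub>G\<^esub> i) \<odot>\<^bsub>V\<^esub> v0" for i :: nat
  have vV: "v i \<in> carrier V" for i using v0 by (simp add: v_def)
  have v_nonzero: "v i \<noteq> \<zero>\<^bsub>V\<^esub>" for i
  proof
    assume "v i = \<zero>\<^bsub>V\<^esub>"
    then have "gen_grp (inv\<^bsub>G\<^esub> (c [^]\<^bsub>G\<^esub> i)) \<odot>\<^bsub>V\<^esub> v i = \<zero>\<^bsub>V\<^esub>" by simp
    then show False using v0 by (simp add: v_def grp_grp grp_one)
  qed
  have x_v: "gen_x G \<odot>\<^bsub>V\<^esub> v i = scalar G (\<chi> c ^ i * \<alpha>) \<odot>\<^bsub>V\<^esub> v i" for i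
    using v0 by (simp add: v_def generator_grp \<alpha> generator_scalar chi_pow scalar_smult)
  have h_v: "gen_grp h \<odot>\<^bsub>V\<^esub> v i = scalar G (\<mu> h) \<odot>\<^bsub>V\<^esub> v i" if "h \<in> N" for h i
    using that vV by (rule \<mu>)
  have c_v: "gen_grp c \<odot>\<^bsub>V\<^esub> v i = v (Suc i)" for i
    using v0 by (simp add: v_def grp_grp G.m_comm)
  have v_n: "v n = scalar G (\<mu> (c [^]\<^bsub>G\<^esub> n)) \<odot>\<^bsub>V\<^esub> v 0"
    using v0 c_pow_n_in_N by (simp add: v_def \<mu> \<mu>_one scalar_smult)
  have indep: "\<forall>i\<in>{..<n}. a i = 0"
    if "lincomb a v = \<zero>\<^bsub>V\<^esub>" for a
  proof (rule eigenvectors_independent[OF _ _ _ _ _ that[unfolded lincomb_def]])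
    show "inj_on (\<lambda>i. \<chi> c ^ i * \<alpha>) {..<n}"
      using \<alpha>0 q_pow_inj by (auto simp: inj_on_def)
  qed (auto simp: vV v_nonzero x_v)
  define L where "L = range (\<lambda>a. lincomb a v)"
  have L_add: "u \<oplus>\<^bsub>V\<^esub> u' \<in> L" if "u \<in> L" "u' \<in> L" for u u'
    using that by (auto simp: L_def vV simp flip: lincomb_add)
  have L_scalar: "scalar G s \<odot>\<^bsub>V\<^esub> v i \<in> L" if "i < n" for s i
    using lincomb_unit[of v i s] that vV by (metis L_def rangeI)
  have L_zero: "\<zero>\<^bsub>V\<^esub> \<in> L" using L_scalar[OF n_pos, of 0] vV by (simp add: scalar_smult)
  have spanning: "u \<in> L" if u: "u \<in> carrier V" for u
  proof -
    obtain r where r: "r \<in> carrier H" "u = r \<odot>\<^bsub>V\<^esub> v0"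
      by (rule V.simple_generated[OF simple v0 u])
    have x_power: "Poly_Mapping.single (k, 0, \<one>\<^bsub>G\<^esub>) 1 \<odot>\<^bsub>V\<^esub> v0 = scalar G (\<alpha> ^ k) \<odot>\<^bsub>V\<^esub> v0" for k
    proof (induction k)
      case 0
      then show ?case by (simp add: scalar_def)
    next
      case (Suc k)
      have "Poly_Mapping.single (Suc k, 0, \<one>\<^bsub>G\<^esub>) 1 \<odot>\<^bsub>V\<^esub> v0 =
          gen_x G \<odot>\<^bsub>V\<^esub> (Poly_Mapping.single (k, 0, \<one>\<^bsub>G\<^esub>) 1 \<odot>\<^bsub>V\<^esub> v0)"
        using v0 by (simp add: gen_x_def single_single chi)
      then show ?case using v0 by (simp add: Suc generator_scalar \<alpha> scalar_smult mult.commute)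
    qed
    have "r \<in> carrier H \<and> r \<odot>\<^bsub>V\<^esub> v0 \<in> L" using r(1)
    proof (induction rule: carrier_skew_group_ring_induct)
      case zero
      have "0 \<in> carrier H" by (simp add: skew_group_ring_def)
      then show ?case using v0 L_zero by (simp add: zero_smult)
    next
      case (single k j g a)
      show ?case
      proof (cases j)
        case 0
        obtain i h where ih: "i < n" "h \<in> N" "g = c [^]\<^bsub>G\<^esub> i \<otimes>\<^bsub>G\<^esub> h"
          using coset_decomposition[OF single] by blast
        have "Poly_Mapping.single (k, 0, g) a \<odot>\<^bsub>V\<^esub> v0 = scalar G (a * \<chi> g ^ k) \<odot>\<^bsub>V\<^esub>
            (gen_grp g \<odot>\<^bsub>V\<^esub> (Poly_Mapping.single (k, 0, \<one>\<^bsub>G\<^esub>) 1 \<odot>\<^bsub>V\<^esub> v0))"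
          using v0 single
          by (simp add: scalar_def gen_grp_def single_single chi eta power_inverse mult.assoc)
        also have "\<dots> = scalar G (a * \<chi> g ^ k * \<alpha> ^ k) \<odot>\<^bsub>V\<^esub> (gen_grp g \<odot>\<^bsub>V\<^esub> v0)"
          using v0 single by (simp add: x_power generator_scalar scalar_smult)
        also have "gen_grp g \<odot>\<^bsub>V\<^esub> v0 = gen_grp (c [^]\<^bsub>G\<^esub> i) \<odot>\<^bsub>V\<^esub> (gen_grp h \<odot>\<^bsub>V\<^esub> v0)"
          using v0 ih by (simp add: grp_grp N_carrier)
        also have "\<dots> = scalar G (\<mu> h) \<odot>\<^bsub>V\<^esub> v i"
          using v0 ih by (simp add: \<mu> generator_scalar v_def)
        finally show ?thesis
          using vV L_scalar[OF ih(1)] single 0 by (simp add: scalar_smult)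
      next
        case (Suc j)
        then show ?thesis using single v0 L_zero by (simp add: single_y_zero)
      qed
    next
      case (add p r)
      then show ?case using v0 L_add by (simp add: add_smult add_in_carrier)
    qed
    then show ?thesis using r(2) by simp
  qed
  have "scalar_basis G V n v"
    unfolding scalar_basis_iff
  proof (intro conjI allI impI ballI)
    show "a i = 0" if "lincomb a v = \<zero>\<^bsub>V\<^esub>" "i < n" for a i
      using indep[OF that(1)] that(2) by simp
    show "\<exists>a. m = lincomb a v" if "m \<in> carrier V" for m
      using spanning[OF that] by (auto simp: L_def)
  qed (rule vV)
  then have "is_Vx G \<chi> \<eta> c n \<alpha> \<mu> V"
    unfolding is_Vx_def
    by (intro conjI exI[of _ v] allI impI)
      (auto simp: left_module y_zero vV x_v h_v c_v v_n[symmetric] n_pos)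
  then show ?thesis using \<mu>_char \<alpha>0 by (auto simp: Kunits_def)
qed

end

section \<open>Isomorphism classes\<close>

context skew_module
begin

text \<open>The condition that \<open>is_Vx\<close> imposes on a basis, named so that the basis can be varied.\<close>
definition Vx_basis :: "'k \<Rightarrow> ('g \<Rightarrow> 'k) \<Rightarrow> (nat \<Rightarrow> 'v) \<Rightarrow> bool" where
  "Vx_basis \<alpha> \<mu> v \<longleftrightarrow> scalar_basis G V n v \<and>
    (\<forall>i<n. gen_y G \<odot>\<^bsub>V\<^esub> v i = \<zero>\<^bsub>V\<^esub> \<and>
       gen_x G \<odot>\<^bsub>V\<^esub> v i = scalar G (\<chi> c ^ i * \<alpha>) \<odot>\<^bsub>V\<^esub> v i \<and>
       (\<forall>h\<in>N. gen_grp h \<odot>\<^bsub>V\<^esub> v i = scalar G (\<mu> h) \<odot>\<^bsub>V\<^esub> v i) \<and>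
       gen_grp c \<odot>\<^bsub>V\<^esub> v i =
         (if i = n - 1 then scalar G (\<mu> (c [^]\<^bsub>G\<^esub> n)) \<odot>\<^bsub>V\<^esub> v 0 else v (i + 1)))"

lemma is_Vx_iff: "is_Vx G \<chi> \<eta> c n \<alpha> \<mu> V \<longleftrightarrow> (\<exists>v. Vx_basis \<alpha> \<mu> v)"
  by (simp add: is_Vx_def Vx_basis_def left_module)

lemma Vx_basisD:
  assumes "Vx_basis \<alpha> \<mu> v"
  shows "i < n \<Longrightarrow> v i \<in> carrier V"
    and "i < n \<Longrightarrow> gen_y G \<odot>\<^bsub>V\<^esub> v i = \<zero>\<^bsub>V\<^esub>"
    and "i < n \<Longrightarrow> gen_x G \<odot>\<^bsub>V\<^esub> v i = scalar G (\<chi> c ^ i * \<alpha>) \<odot>\<^bsub>V\<^esub> v i"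
    and "i < n \<Longrightarrow> h \<in> N \<Longrightarrow> gen_grp h \<odot>\<^bsub>V\<^esub> v i = scalar G (\<mu> h) \<odot>\<^bsub>V\<^esub> v i"
    and "i < n \<Longrightarrow> gen_grp c \<odot>\<^bsub>V\<^esub> v i =
         (if i = n - 1 then scalar G (\<mu> (c [^]\<^bsub>G\<^esub> n)) \<odot>\<^bsub>V\<^esub> v 0 else v (i + 1))"
    and "u \<in> carrier V \<Longrightarrow> \<exists>a. u = lincomb a v"
    and "lincomb a v = \<zero>\<^bsub>V\<^esub> \<Longrightarrow> i < n \<Longrightarrow> a i = 0"
  using assms by (auto simp: Vx_basis_def scalar_basis_iff)

lemma lincomb_eq_iff:
  assumes v: "Vx_basis \<alpha> \<mu> v"
  shows "lincomb a v = lincomb d v \<longleftrightarrow> (\<forall>i<n. a i = d i)"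
proof
  note vV = Vx_basisD(1)[OF v]
  assume eq: "lincomb a v = lincomb d v"
  have closed: "lincomb a v \<in> carrier V" for a by (rule lincomb_closed) (rule vV)
  have "lincomb a v = lincomb (\<lambda>i. (a i - d i) + d i) v" by simp
  also have "\<dots> = lincomb (\<lambda>i. a i - d i) v \<oplus>\<^bsub>V\<^esub> lincomb d v"
    by (rule lincomb_add) (rule vV)
  finally have "lincomb (\<lambda>i. a i - d i) v \<oplus>\<^bsub>V\<^esub> lincomb d v = \<zero>\<^bsub>V\<^esub> \<oplus>\<^bsub>V\<^esub> lincomb d v"
    using eq closed[of d] by simp
  then have "lincomb (\<lambda>i. a i - d i) v = \<zero>\<^bsub>V\<^esub>"
    using closed by (simp del: V.M.l_zero V.M.r_zero)
  then show "\<forall>i<n. a i = d i" using Vx_basisD(7)[OF v] by fastforce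
next
  assume "\<forall>i<n. a i = d i"
  then show "lincomb a v = lincomb d v" by (intro lincomb_cong) (auto simp: Vx_basisD(1)[OF v])
qed

lemma Vx_basis_nonzero: "Vx_basis \<alpha> \<mu> v \<Longrightarrow> v 0 \<noteq> \<zero>\<^bsub>V\<^esub>"
  using Vx_basisD(7)[of \<alpha> \<mu> v "\<lambda>j. if 0 = j then 1 else 0" 0] lincomb_unit[of v 0 1] n_pos
  by (auto simp: Vx_basisD(1) scalar_smult)

text \<open>Acting by \<open>c\<close> permutes the basis lines cyclically and multiplies the \<open>x\<close>-eigenvalue of each by \<open>\<chi>(c)\<close>.
  This is why \<open>\<alpha>\<close> is determined only up to powers of \<open>q\<close>.\<close>
lemma Vx_basis_shift:
  assumes v: "Vx_basis \<alpha> \<mu> v"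
  shows "Vx_basis (\<chi> c * \<alpha>) \<mu> (\<lambda>i. gen_grp c \<odot>\<^bsub>V\<^esub> v i)"
proof -
  note vD = Vx_basisD[OF v]
  note vV = vD(1)
  let ?w = "\<lambda>i. gen_grp c \<odot>\<^bsub>V\<^esub> v i"
  let ?i = "gen_grp (inv\<^bsub>G\<^esub> c)"
  have inv: "gen_grp c \<odot>\<^bsub>V\<^esub> (?i \<odot>\<^bsub>V\<^esub> u) = u" "?i \<odot>\<^bsub>V\<^esub> (gen_grp c \<odot>\<^bsub>V\<^esub> u) = u"
    if "u \<in> carrier V" for u
    using that by (simp_all add: grp_grp grp_one)
  have lin: "gen_grp c \<odot>\<^bsub>V\<^esub> lincomb a v = lincomb a ?w" for a
    by (rule smult_lincomb) (auto simp: vV)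
  have "scalar_basis G V n ?w"
    unfolding scalar_basis_iff
  proof (intro conjI allI impI ballI)
    fix u assume u: "u \<in> carrier V"
    then obtain a where "?i \<odot>\<^bsub>V\<^esub> u = lincomb a v" using vD(6)[of "?i \<odot>\<^bsub>V\<^esub> u"] by auto
    then show "\<exists>a. u = lincomb a ?w" using inv(1)[OF u] lin by metis
  next
    fix a i assume "lincomb a ?w = \<zero>\<^bsub>V\<^esub>" "i < n"
    then have "?i \<odot>\<^bsub>V\<^esub> (gen_grp c \<odot>\<^bsub>V\<^esub> lincomb a v) = \<zero>\<^bsub>V\<^esub>" by (simp add: lin)
    then have "lincomb a v = \<zero>\<^bsub>V\<^esub>" using inv(2) lincomb_closed[OF vV] by simp
    then show "a i = 0" using vD(7) \<open>i < n\<close> by simp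
  qed (use vV in auto)
  moreover have "gen_grp c \<odot>\<^bsub>V\<^esub> ?w i =
      (if i = n - 1 then scalar G (\<mu> (c [^]\<^bsub>G\<^esub> n)) \<odot>\<^bsub>V\<^esub> ?w 0 else ?w (i + 1))" if "i < n" for i
    using arg_cong[OF vD(5)[OF that], of "\<lambda>u. gen_grp c \<odot>\<^bsub>V\<^esub> u"] vV[of 0] n_pos
    by (simp add: generator_scalar split: if_splits)
  moreover have "gen_grp h \<odot>\<^bsub>V\<^esub> ?w i = scalar G (\<mu> h) \<odot>\<^bsub>V\<^esub> ?w i" if "i < n" "h \<in> N" for i h
  proof -
    have "gen_grp h \<odot>\<^bsub>V\<^esub> ?w i = gen_grp c \<odot>\<^bsub>V\<^esub> (gen_grp h \<odot>\<^bsub>V\<^esub> v i)"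
      using that vV by (simp add: grp_grp N_carrier G.m_comm)
    then show ?thesis using that vV by (simp add: vD(4) generator_scalar)
  qed
  moreover have "gen_x G \<odot>\<^bsub>V\<^esub> ?w i = scalar G (\<chi> c ^ i * (\<chi> c * \<alpha>)) \<odot>\<^bsub>V\<^esub> ?w i" if "i < n" for i
    using that by (simp only: generator_grp c vV vD(3))
      (simp add: vV generator_scalar scalar_smult mult_ac del: vD(5))
  moreover have "gen_y G \<odot>\<^bsub>V\<^esub> ?w i = \<zero>\<^bsub>V\<^esub>" if "i < n" for i
    using that by (simp only: generator_grp c vV vD(2)) simp
  ultimately show ?thesis
    unfolding Vx_basis_def by (auto simp: vV)
qed

lemma Vx_basis_shift_power:
  assumes "Vx_basis \<alpha> \<mu> v"
  shows "\<exists>w. Vx_basis (\<chi> c ^ i * \<alpha>) \<mu> w"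
proof (induction i)
  case (Suc i)
  then obtain w where "Vx_basis (\<chi> c ^ i * \<alpha>) \<mu> w" by blast
  from Vx_basis_shift[OF this] show ?case by (auto simp: mult.assoc)
qed (use assms in auto)

end

locale two_skew_modules = M: skew_module G \<chi> \<eta> c n M + M': skew_module G \<chi> \<eta> c n M'
  for G :: "('g, 'm) monoid_scheme" and \<chi> \<eta> :: "'g \<Rightarrow> 'k::alg_closed_field" and c n
    and M :: "(nat \<times> nat \<times> 'g \<Rightarrow>\<^sub>0 'k, 'v1, 'z1) module_scheme"
    and M' :: "(nat \<times> nat \<times> 'g \<Rightarrow>\<^sub>0 'k, 'v2, 'z2) module_scheme"
begin

text \<open>The linear map matching the two bases commutes with each generator on basis vectors, hence
  everywhere.\<close>
lemma same_parameters_isomorphic: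
  assumes v: "M.Vx_basis \<alpha> \<mu> v" and v': "M'.Vx_basis \<alpha> \<mu> v'"
  shows "module_isomorphic M.H M M'"
proof -
  note vD = M.Vx_basisD[OF v] and vD' = M'.Vx_basisD[OF v']
  note vV = vD(1) and vV' = vD'(1)
  define f where "f m = M'.lincomb (SOME a. m = M.lincomb a v) v'" for m
  have f: "f (M.lincomb a v) = M'.lincomb a v'" for a
  proof -
    have "M.lincomb a v = M.lincomb (SOME d. M.lincomb a v = M.lincomb d v) v"
      by (rule someI[of "\<lambda>d. M.lincomb a v = M.lincomb d v" a]) (rule refl)
    then show ?thesis
      unfolding f_def M'.lincomb_eq_iff[OF v'] M.lincomb_eq_iff[OF v] by simp
  qed
  have closed: "f m \<in> carrier M'" for m
    unfolding f_def by (rule M'.lincomb_closed) (rule vV')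
  have add: "f (m \<oplus>\<^bsub>M\<^esub> m') = f m \<oplus>\<^bsub>M'\<^esub> f m'" if mm': "m \<in> carrier M" "m' \<in> carrier M" for m m'
  proof -
    obtain a d where "m = M.lincomb a v" "m' = M.lincomb d v" using vD(6) mm' by metis
    then show ?thesis by (simp add: f vV vV' M'.lincomb_add flip: M.lincomb_add)
  qed
  have scalar: "f (scalar G s \<odot>\<^bsub>M\<^esub> m) = scalar G s \<odot>\<^bsub>M'\<^esub> f m" if m: "m \<in> carrier M" for m s
  proof -
    obtain a where "m = M.lincomb a v" using vD(6) m by metis
    then show ?thesis
      by (simp add: f vV vV' M.smult_lincomb M'.smult_lincomb M.lincomb_scalars M'.lincomb_scalars)
  qed
  have zero: "f \<zero>\<^bsub>M\<^esub> = \<zero>\<^bsub>M'\<^esub>"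
    using scalar[of "\<zero>\<^bsub>M\<^esub>" 0] M.scalar_smult(2)[of "\<zero>\<^bsub>M\<^esub>"] M'.scalar_smult(2)[OF closed] by simp
  have lin: "f (M.lincomb a u) = M'.lincomb a (\<lambda>i. f (u i))"
    if u: "\<And>i. i < n \<Longrightarrow> u i \<in> carrier M" for a u
  proof -
    have "f (\<Oplus>\<^bsub>M\<^esub>i\<in>I. scalar G (a i) \<odot>\<^bsub>M\<^esub> u i) = (\<Oplus>\<^bsub>M'\<^esub>i\<in>I. scalar G (a i) \<odot>\<^bsub>M'\<^esub> f (u i))"
      if "I \<subseteq> {..<n}" for I
      using finite_subset[OF that finite_lessThan] that
    proof (induction I)
      case (insert i I)
      have "(\<lambda>i. scalar G (a i) \<odot>\<^bsub>M\<^esub> u i) \<in> I \<rightarrow> carrier M" using insert.prems u by auto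
      moreover have "u i \<in> carrier M" using insert.prems u by auto
      ultimately show ?case using insert closed by (simp add: add scalar Pi_def)
    qed (simp add: zero)
    then show ?thesis unfolding M.lincomb_def M'.lincomb_def by blast
  qed
  have f_v: "f (v i) = v' i" if "i < n" for i
    using f[of "\<lambda>j. if i = j then 1 else 0"] that
    by (simp add: M.lincomb_unit M'.lincomb_unit vV vV' M.scalar_smult M'.scalar_smult)
  have on_basis: "\<forall>m\<in>carrier M. f (r \<odot>\<^bsub>M\<^esub> m) = r \<odot>\<^bsub>M'\<^esub> f m"
    if r: "r \<in> carrier M.H" and eq: "\<And>i. i < n \<Longrightarrow> f (r \<odot>\<^bsub>M\<^esub> v i) = r \<odot>\<^bsub>M'\<^esub> v' i" for r
  proof
    fix m assume "m \<in> carrier M"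
    then obtain a where a: "m = M.lincomb a v" using vD(6) by metis
    have "f (r \<odot>\<^bsub>M\<^esub> m) = M'.lincomb a (\<lambda>i. f (r \<odot>\<^bsub>M\<^esub> v i))"
      using r by (simp add: a vV M.smult_lincomb lin)
    also have "\<dots> = M'.lincomb a (\<lambda>i. r \<odot>\<^bsub>M'\<^esub> v' i)"
      by (rule M'.lincomb_cong) (use r vV' in \<open>auto simp: eq\<close>)
    also have "\<dots> = r \<odot>\<^bsub>M'\<^esub> f m"
      using r by (simp add: a f vV' M'.smult_lincomb)
    finally show "f (r \<odot>\<^bsub>M\<^esub> m) = r \<odot>\<^bsub>M'\<^esub> f m" .
  qed
  have x: "f (gen_x G \<odot>\<^bsub>M\<^esub> v i) = gen_x G \<odot>\<^bsub>M'\<^esub> v' i" if "i < n" for i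
    using that by (simp only: vD(3) vD'(3) vV scalar f_v)
  have y: "f (gen_y G \<odot>\<^bsub>M\<^esub> v i) = gen_y G \<odot>\<^bsub>M'\<^esub> v' i" if "i < n" for i
    using that by (simp only: vD(2) vD'(2) zero)
  have c: "f (gen_grp c \<odot>\<^bsub>M\<^esub> v i) = gen_grp c \<odot>\<^bsub>M'\<^esub> v' i" if "i < n" for i
  proof (cases "i = n - 1")
    case True
    then show ?thesis
      using that by (simp only: vD(5) vD'(5) if_True refl scalar vV f_v M.n_pos)
  next
    case False
    then have "i + 1 < n" using that by simp
    then show ?thesis using that False by (simp only: vD(5) vD'(5) if_False f_v)
  qed
  have h: "f (gen_grp h \<odot>\<^bsub>M\<^esub> v i) = gen_grp h \<odot>\<^bsub>M'\<^esub> v' i" if "i < n" "h \<in> M.N" for i h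
    using that by (simp only: vD(4) vD'(4) vV scalar f_v)
  have H_linear: "\<forall>m\<in>carrier M. f (r \<odot>\<^bsub>M\<^esub> m) = r \<odot>\<^bsub>M'\<^esub> f m" if r: "r \<in> carrier M.H" for r
  proof (rule M.generators_induct[OF r])
    show "\<forall>m\<in>carrier M. f (scalar G a \<odot>\<^bsub>M\<^esub> m) = scalar G a \<odot>\<^bsub>M'\<^esub> f m" for a
      using scalar by blast
    show "\<forall>m\<in>carrier M. f (gen_x G \<odot>\<^bsub>M\<^esub> m) = gen_x G \<odot>\<^bsub>M'\<^esub> f m"
      by (rule on_basis) (auto simp: x)
    show "\<forall>m\<in>carrier M. f (gen_y G \<odot>\<^bsub>M\<^esub> m) = gen_y G \<odot>\<^bsub>M'\<^esub> f m"
      by (rule on_basis) (auto simp: y)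
    show "\<forall>m\<in>carrier M. f (gen_grp c \<odot>\<^bsub>M\<^esub> m) = gen_grp c \<odot>\<^bsub>M'\<^esub> f m"
      by (rule on_basis) (auto simp: c)
    show "\<forall>m\<in>carrier M. f (gen_grp g \<odot>\<^bsub>M\<^esub> m) = gen_grp g \<odot>\<^bsub>M'\<^esub> f m" if "g \<in> M.N" for g
      using that by (intro on_basis) (auto simp: h M.N_carrier)
  next
    fix p r
    assume pr: "p \<in> carrier M.H" "r \<in> carrier M.H"
      and p: "\<forall>m\<in>carrier M. f (p \<odot>\<^bsub>M\<^esub> m) = p \<odot>\<^bsub>M'\<^esub> f m"
      and r: "\<forall>m\<in>carrier M. f (r \<odot>\<^bsub>M\<^esub> m) = r \<odot>\<^bsub>M'\<^esub> f m"
    show "\<forall>m\<in>carrier M. f ((p + r) \<odot>\<^bsub>M\<^esub> m) = (p + r) \<odot>\<^bsub>M'\<^esub> f m"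
      using pr p r by (simp add: M.add_smult M'.add_smult closed add)
    show "\<forall>m\<in>carrier M. f (skew_mult G \<chi> \<eta> p r \<odot>\<^bsub>M\<^esub> m) = skew_mult G \<chi> \<eta> p r \<odot>\<^bsub>M'\<^esub> f m"
      using M.V.smult_assoc1[OF pr] M'.V.smult_assoc1[OF pr] pr p r
      by (simp add: M.H_simps closed)
  qed
  have "f \<in> iso (add_monoid M) (add_monoid M')"
    unfolding iso_def hom_def bij_betw_def
  proof (intro CollectI conjI)
    show "inj_on f (carrier (add_monoid M))"
    proof (rule inj_onI)
      fix m m' assume "m \<in> carrier (add_monoid M)" "m' \<in> carrier (add_monoid M)" and eq: "f m = f m'"
      then obtain a d where "m = M.lincomb a v" "m' = M.lincomb d v"
        using vD(6)[of m] vD(6)[of m'] by auto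
      then show "m = m'" using eq by (simp add: f M.lincomb_eq_iff[OF v] M'.lincomb_eq_iff[OF v'])
    qed
    show "f ` carrier (add_monoid M) = carrier (add_monoid M')"
    proof
      show "carrier (add_monoid M') \<subseteq> f ` carrier (add_monoid M)"
      proof
        fix m' assume "m' \<in> carrier (add_monoid M')"
        then obtain a where "m' = M'.lincomb a v'" using vD'(6)[of m'] by auto
        then show "m' \<in> f ` carrier (add_monoid M)"
          using M.lincomb_closed[OF vV] by (intro image_eqI[of _ _ "M.lincomb a v"]) (auto simp: f)
      qed
    qed (auto simp: closed)
  qed (auto simp: closed add)
  then show ?thesis using H_linear unfolding module_isomorphic_def by blast
qed

text \<open>Compare the actions on the image \<open>u\<close> of \<open>v 0\<close>: transported from \<open>M\<close>, \<open>x\<close> and \<open>h\<close> act on \<open>u\<close> by \<open>\<alpha>\<close> and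
  \<open>\<mu> h\<close>; expanded in the basis of \<open>M'\<close>, they act on the \<open>i\<close>-th coordinate by \<open>\<chi>(c)\<^sup>i \<alpha>'\<close> and \<open>\<mu>' h\<close>. Some
  coordinate of \<open>u\<close> is nonzero.\<close>
lemma isomorphic_imp_parameters:
  assumes v: "M.Vx_basis \<alpha> \<mu> v" and v': "M'.Vx_basis \<alpha>' \<mu>' v'"
    and \<mu>: "\<mu> \<in> carrier (char_group (G\<lparr>carrier := M.N\<rparr>))"
      "\<mu>' \<in> carrier (char_group (G\<lparr>carrier := M.N\<rparr>))"
    and "module_isomorphic M.H M M'"
  shows "\<mu> = \<mu>' \<and> (\<exists>i. \<alpha> = \<chi> c ^ i * \<alpha>')"
proof -
  note vD = M.Vx_basisD[OF v] and vD' = M'.Vx_basisD[OF v']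
  note vV = vD(1) and vV' = vD'(1)
  obtain f where f: "f \<in> iso (add_monoid M) (add_monoid M')"
    and lin: "\<And>r m. r \<in> carrier M.H \<Longrightarrow> m \<in> carrier M \<Longrightarrow> f (r \<odot>\<^bsub>M\<^esub> m) = r \<odot>\<^bsub>M'\<^esub> f m"
    using assms(5) unfolding module_isomorphic_def by blast
  have closed: "m \<in> carrier M \<Longrightarrow> f m \<in> carrier M'" for m
    using f by (auto simp: iso_def hom_def)
  have inj: "inj_on f (carrier M)" using f by (simp add: iso_def bij_betw_def)
  have v0: "v 0 \<in> carrier M" using vV M.n_pos by simp
  define u where "u = f (v 0)"
  have uV: "u \<in> carrier M'" by (simp add: u_def closed v0)
  have "f \<zero>\<^bsub>M\<^esub> = \<zero>\<^bsub>M'\<^esub>"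
    using lin[of "scalar G 0" "v 0"] closed[OF v0] v0 by (simp add: M.scalar_smult M'.scalar_smult)
  then have u0: "u \<noteq> \<zero>\<^bsub>M'\<^esub>"
    using inj_onD[OF inj _ v0 M.V.M.zero_closed] M.Vx_basis_nonzero[OF v] by (auto simp: u_def)
  obtain a where a: "u = M'.lincomb a v'" using vD'(6)[OF uV] by blast
  have "\<mu> h = \<mu>' h" if h: "h \<in> M.N" for h
  proof (rule M'.scalar_smult_inj[OF uV u0])
    have "gen_grp h \<odot>\<^bsub>M'\<^esub> u = f (gen_grp h \<odot>\<^bsub>M\<^esub> v 0)"
      using lin[of "gen_grp h" "v 0"] h v0 by (simp add: u_def M.N_carrier)
    also have "\<dots> = scalar G (\<mu> h) \<odot>\<^bsub>M'\<^esub> u"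
      using h v0 M.n_pos by (simp add: vD(4) lin u_def)
    finally have 1: "gen_grp h \<odot>\<^bsub>M'\<^esub> u = scalar G (\<mu> h) \<odot>\<^bsub>M'\<^esub> u" .
    have "gen_grp h \<odot>\<^bsub>M'\<^esub> u = M'.lincomb a (\<lambda>i. gen_grp h \<odot>\<^bsub>M'\<^esub> v' i)"
      using h by (simp add: a M'.smult_lincomb vV' M.N_carrier)
    also have "\<dots> = M'.lincomb a (\<lambda>i. scalar G (\<mu>' h) \<odot>\<^bsub>M'\<^esub> v' i)"
      by (rule M'.lincomb_cong) (use h vV' in \<open>auto simp: vD'(4)\<close>)
    also have "\<dots> = scalar G (\<mu>' h) \<odot>\<^bsub>M'\<^esub> u"
      by (simp add: a M'.smult_lincomb vV')
    finally show "scalar G (\<mu> h) \<odot>\<^bsub>M'\<^esub> u = scalar G (\<mu>' h) \<odot>\<^bsub>M'\<^esub> u" using 1 by simp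
  qed
  moreover have "\<mu> \<in> extensional M.N" "\<mu>' \<in> extensional M.N"
    using \<mu> by (simp_all add: char_group_def)
  ultimately have "\<mu> = \<mu>'" by (intro extensionalityI[of _ M.N]) auto
  moreover have "\<exists>i. \<alpha> = \<chi> c ^ i * \<alpha>'"
  proof -
    have "gen_x G \<odot>\<^bsub>M'\<^esub> u = f (gen_x G \<odot>\<^bsub>M\<^esub> v 0)"
      using lin[of "gen_x G" "v 0"] v0 by (simp add: u_def)
    also have "\<dots> = scalar G \<alpha> \<odot>\<^bsub>M'\<^esub> u"
      using v0 M.n_pos by (simp add: vD(3) lin u_def)
    also have "\<dots> = M'.lincomb (\<lambda>i. a i * \<alpha>) v'"
      by (simp add: a M'.smult_lincomb vV' M'.lincomb_scalars)
    finally have 1: "gen_x G \<odot>\<^bsub>M'\<^esub> u = M'.lincomb (\<lambda>i. a i * \<alpha>) v'" .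
    have "gen_x G \<odot>\<^bsub>M'\<^esub> u = M'.lincomb a (\<lambda>i. gen_x G \<odot>\<^bsub>M'\<^esub> v' i)"
      by (simp add: a M'.smult_lincomb vV')
    also have "\<dots> = M'.lincomb a (\<lambda>i. scalar G (\<chi> c ^ i * \<alpha>') \<odot>\<^bsub>M'\<^esub> v' i)"
      by (rule M'.lincomb_cong) (use vV' in \<open>auto simp: vD'(3)\<close>)
    also have "\<dots> = M'.lincomb (\<lambda>i. a i * (\<chi> c ^ i * \<alpha>')) v'"
      by (simp add: M'.lincomb_scalars vV')
    finally have "\<forall>i<n. a i * \<alpha> = a i * (\<chi> c ^ i * \<alpha>')"
      using 1 by (simp add: M'.lincomb_eq_iff[OF v'])
    moreover have "\<exists>i<n. a i \<noteq> 0"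
    proof (rule ccontr)
      assume "\<not> (\<exists>i<n. a i \<noteq> 0)"
      then have "u = M'.lincomb (\<lambda>_. 0) v'" unfolding a M'.lincomb_eq_iff[OF v'] by simp
      also have "\<dots> = \<zero>\<^bsub>M'\<^esub>"
        using M'.lincomb_unit[of v' 0 0] M.n_pos vV' by (simp add: M'.scalar_smult)
      finally show False using u0 by simp
    qed
    ultimately show ?thesis by fastforce
  qed
  ultimately show ?thesis by blast
qed

lemma isomorphic_iff:
  assumes M: "is_Vx G \<chi> \<eta> c n \<alpha> \<mu> M" and M': "is_Vx G \<chi> \<eta> c n \<alpha>' \<mu>' M'"
    and \<mu>: "\<mu> \<in> carrier (char_group (G\<lparr>carrier := M.N\<rparr>))"
      "\<mu>' \<in> carrier (char_group (G\<lparr>carrier := M.N\<rparr>))"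
  shows "module_isomorphic M.H M M' \<longleftrightarrow> \<mu> = \<mu>' \<and> (\<exists>i::nat. \<alpha> = \<chi> c ^ i * \<alpha>')"
proof -
  obtain v v' where v: "M.Vx_basis \<alpha> \<mu> v" and v': "M'.Vx_basis \<alpha>' \<mu>' v'"
    using M M' by (auto simp: M.is_Vx_iff M'.is_Vx_iff)
  show ?thesis
  proof
    assume "module_isomorphic M.H M M'"
    then show "\<mu> = \<mu>' \<and> (\<exists>i::nat. \<alpha> = \<chi> c ^ i * \<alpha>')"
      by (rule isomorphic_imp_parameters[OF v v' \<mu>])
  next
    assume "\<mu> = \<mu>' \<and> (\<exists>i::nat. \<alpha> = \<chi> c ^ i * \<alpha>')"
    then obtain i w where "M'.Vx_basis \<alpha> \<mu> w"
      using M'.Vx_basis_shift_power[OF v'] by metis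
    then show "module_isomorphic M.H M M'" by (rule same_parameters_isomorphic[OF v])
  qed
qed

end

theorem corollary5p5:
  fixes G :: "('g, 'm) monoid_scheme"
    and \<chi> \<eta> :: "'g \<Rightarrow> 'k::{alg_closed_field, field_char_0}"
    and b c :: 'g and q :: 'k and n :: nat
  assumes "comm_group G" and "finitely_generated G"
    and "b \<in> carrier G" and "c \<in> carrier G"
    and "\<chi> \<in> carrier (char_group G)" and "finite_order (char_group G) \<chi>"
    and "\<eta> \<in> carrier (char_group G)" and "finite_order (char_group G) \<eta>"
    and "q = \<chi> c" and "q = inverse (\<eta> b)"
    and "primitive_root_of_unity n q"
    and "\<chi> ` carrier G = generate Kunits {q}"
  shows "(\<forall>V :: (nat \<times> nat \<times> 'g \<Rightarrow>\<^sub>0 'k, 'v, 'z) module_scheme.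
            simple_module (skew_group_ring G \<chi> \<eta>) V \<and>
            torsion_free_wrt (skew_group_ring G \<chi> \<eta>) V (gen_x G) \<and>
            torsion_wrt (skew_group_ring G \<chi> \<eta>) V (gen_y G) \<longrightarrow>
            (\<exists>\<alpha>\<in>carrier Kunits. \<exists>\<mu>\<in>carrier (char_group (G\<lparr>carrier := char_kernel G \<chi>\<rparr>)).
               is_Vx G \<chi> \<eta> c n \<alpha> \<mu> V)) \<and>
         (\<forall>\<alpha>\<in>carrier Kunits. \<forall>\<alpha>'\<in>carrier Kunits.
          \<forall>\<mu>\<in>carrier (char_group (G\<lparr>carrier := char_kernel G \<chi>\<rparr>)).
          \<forall>\<mu>'\<in>carrier (char_group (G\<lparr>carrier := char_kernel G \<chi>\<rparr>)).
          \<forall>M :: (nat \<times> nat \<times> 'g \<Rightarrow>\<^sub>0 'k, 'v1, 'z1) module_scheme.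
          \<forall>M' :: (nat \<times> nat \<times> 'g \<Rightarrow>\<^sub>0 'k, 'v2, 'z2) module_scheme.
            is_Vx G \<chi> \<eta> c n \<alpha> \<mu> M \<and> is_Vx G \<chi> \<eta> c n \<alpha>' \<mu>' M' \<longrightarrow>
            (module_isomorphic (skew_group_ring G \<chi> \<eta>) M M' \<longleftrightarrow>
               \<mu> = \<mu>' \<and> (\<exists>i::nat. \<alpha> = q ^ i * \<alpha>')))"
proof -
  interpret skew_setup G \<chi> \<eta> c n
    by (rule skew_setup.intro) (use assms in auto)
  show ?thesis
  proof (intro conjI allI ballI impI)
    fix V :: "(nat \<times> nat \<times> 'g \<Rightarrow>\<^sub>0 'k, 'v, 'z) module_scheme"
    assume V: "simple_module (skew_group_ring G \<chi> \<eta>) V \<and>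
      torsion_free_wrt (skew_group_ring G \<chi> \<eta>) V (gen_x G) \<and>
      torsion_wrt (skew_group_ring G \<chi> \<eta>) V (gen_y G)"
    then have "left_module (skew_group_ring G \<chi> \<eta>) V" by (simp add: simple_module_def)
    then interpret simple_torsion_module G \<chi> \<eta> c n V
      using V assms(2)
      by (intro simple_torsion_module.intro skew_module.intro skew_setup_axioms
          simple_torsion_module_axioms.intro skew_module_axioms.intro) simp_all
    show "\<exists>\<alpha>\<in>carrier Kunits. \<exists>\<mu>\<in>carrier (char_group (G\<lparr>carrier := char_kernel G \<chi>\<rparr>)).
        is_Vx G \<chi> \<eta> c n \<alpha> \<mu> V"
      by (rule exists_parameters)
  next
    fix \<alpha> \<alpha>' \<mu> \<mu>'
    fix M :: "(nat \<times> nat \<times> 'g \<Rightarrow>\<^sub>0 'k, 'v1, 'z1) module_scheme"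
    fix M' :: "(nat \<times> nat \<times> 'g \<Rightarrow>\<^sub>0 'k, 'v2, 'z2) module_scheme"
    assume \<mu>: "\<mu> \<in> carrier (char_group (G\<lparr>carrier := char_kernel G \<chi>\<rparr>))"
        "\<mu>' \<in> carrier (char_group (G\<lparr>carrier := char_kernel G \<chi>\<rparr>))"
      and MM': "is_Vx G \<chi> \<eta> c n \<alpha> \<mu> M \<and> is_Vx G \<chi> \<eta> c n \<alpha>' \<mu>' M'"
    interpret two_skew_modules G \<chi> \<eta> c n M M'
      using MM' by (intro two_skew_modules.intro skew_module.intro skew_setup_axioms)
        (auto simp: skew_module_axioms_def is_Vx_def)
    show "module_isomorphic (skew_group_ring G \<chi> \<eta>) M M' \<longleftrightarrow>
        \<mu> = \<mu>' \<and> (\<exists>i::nat. \<alpha> = q ^ i * \<alpha>')"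
      using isomorphic_iff[of \<alpha> \<mu> \<alpha>' \<mu>'] MM' \<mu> by (simp add: assms(9))
  qed
qed

end
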